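(* Let $w\in\mathcal M$ be a submultiplicative normalized weight and let $q\in\mathcal H^w$. Then $$\sum_{n\ge N} w_n^2|\gamma_n(q)|^2\le 9\|T_Nq\|_w^2+\frac{576}{N}\|q\|_w^4$$ for all integers $N\ge1$ with $N\ge 4\|q\|_w$, where $T_Nq=\sum_{|n|\ge N}q_n e^{2n\pi i x}$.
   Context: Let $S^1=\mathbb R/\mathbb Z$. A normalized weight is a function $w:\mathbb Z\to\mathbb R$, $n\mapsto w_n$, with $w_n=w_{-n}\ge1$ for all $n$. $\mathcal M$ is the class of normalized weights that are submultiplicative: $w_{n+m}\le w_nw_m$ for all $n,m$. For a complex 1-periodic function $q=\sum_{n\in\mathbb Z}q_ne^{2n\pi ix}$ put $\|q\|_w^2=\sum_{n\in\mathbb Z}w_n^2|q_n|^2$, and $\mathcal H^w=\{q\in L^2(S^1,\mathbb C):\|q\|_w<\infty\}$. For complex $q\in L^2(S^1,\mathbb C)$, the periodic eigenvalues of $q$ are the eigenvalues of $L=-\frac{d^2}{dx^2}+q$ on $[0,1]$ with periodic or anti-periodic boundary conditions (both types taken together; equivalently the eigenvalues of $-\frac{d^2}{dx^2}+q$ on functions of period 2), listed with algebraic multiplicity. They are ordered lexicographically, first by real part and then by imaginary part: $\lambda_0(q)\prec\lambda_1^-(q)\preceq\lambda_1^+(q)\prec\dots\prec\lambda_n^-(q)\preceq\lambda_n^+(q)\prec\cdots$. The gap lengths are $\gamma_n(q)=\lambda_n^+(q)-\lambda_n^-(q)$, $n\ge1$ (complex numbers in general). *)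

theory Defs
  imports "HOL-Analysis.Analysis" "HOL-Library.Function_Algebras"
begin

text \<open>Elements of \<open>L\<^sup>2\<close> of the circle of length \<open>p\<close> are represented by everywhere
  periodic functions on the real line; all notions below depend only on the
  class of the function modulo null sets, except in \<open>hill_graph\<close>, where the elements of
  the operator domain are the continuously differentiable representatives.\<close>

definition L2_periodic :: "real \<Rightarrow> (real \<Rightarrow> complex) set" where
  "L2_periodic p = {f. (\<forall>x. f (x + p) = f x) \<and> f \<in> borel_measurable lebesgue \<and>
     set_integrable lebesgue {0..p} (\<lambda>x. (cmod (f x))\<^sup>2)}"

definition fourier_coeff :: "(real \<Rightarrow> complex) \<Rightarrow> int \<Rightarrow> complex" where
  "fourier_coeff q n = (LINT x:{0..1}|lebesgue. q x * cis (- 2 * of_int n * pi * x))"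

definition normalized_weight :: "(int \<Rightarrow> real) \<Rightarrow> bool" where
  "normalized_weight w \<longleftrightarrow> (\<forall>n. w n = w (- n) \<and> w n \<ge> 1)"

definition submult_weights :: "(int \<Rightarrow> real) set" where
  "submult_weights = {w. normalized_weight w \<and> (\<forall>n m. w (n + m) \<le> w n * w m)}"

definition weighted_space :: "(int \<Rightarrow> real) \<Rightarrow> (real \<Rightarrow> complex) set" where
  "weighted_space w = {q \<in> L2_periodic 1.
     (\<lambda>n. (w n)\<^sup>2 * (cmod (fourier_coeff q n))\<^sup>2) summable_on UNIV}"

text \<open>Meaningful for \<open>q\<close> in \<open>weighted_space w\<close> only, since \<open>infsum\<close> returns \<open>0\<close> for divergent sums.\<close>

definition weighted_norm :: "(int \<Rightarrow> real) \<Rightarrow> (real \<Rightarrow> complex) \<Rightarrow> real" where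
  "weighted_norm w q = sqrt (\<Sum>\<^sub>\<infinity>n\<in>UNIV. (w n)\<^sup>2 * (cmod (fourier_coeff q n))\<^sup>2)"

text \<open>The function with Fourier series \<open>\<Sum>|n| \<ge> N. q\<^sub>n e\<^sup>2\<^sup>\<pi>\<^sup>i\<^sup>n\<^sup>x\<close>, obtained by removing
  the finitely many remaining modes from \<open>q\<close>; see \<open>fourier_coeff_tail\<close> below.\<close>

definition fourier_tail :: "nat \<Rightarrow> (real \<Rightarrow> complex) \<Rightarrow> real \<Rightarrow> complex" where
  "fourier_tail N q x =
     q x - (\<Sum>n | \<bar>n\<bar> < int N. fourier_coeff q n * cis (2 * of_int n * pi * x))"

text \<open>\<open>hill_graph q f g\<close>: \<open>f\<close> lies in the domain (the \<open>2\<close>-periodic functions of Sobolev class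
  \<open>H\<^sup>2\<close>) of \<open>L = - d\<^sup>2/dx\<^sup>2 + q\<close>, and \<open>L f = g\<close> almost everywhere. Here \<open>f''\<close> is the
  a.e. derivative of the absolutely continuous function \<open>f'\<close>. Period \<open>2\<close> covers the periodic
  and the antiperiodic boundary conditions on \<open>[0,1]\<close> together.\<close>

definition hill_graph ::
    "(real \<Rightarrow> complex) \<Rightarrow> (real \<Rightarrow> complex) \<Rightarrow> (real \<Rightarrow> complex) \<Rightarrow> bool" where
  "hill_graph q f g \<longleftrightarrow> (\<forall>x. f (x + 2) = f x) \<and>
     (\<exists>f' f''. (\<forall>x. (f has_vector_derivative f' x) (at x)) \<and>
        f'' \<in> L2_periodic 2 \<and>
        (\<forall>a b. a \<le> b \<longrightarrow> (f'' has_integral (f' b - f' a)) {a..b}) \<and>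
        (AE x in lebesgue. g x = - f'' x + q x * f x))"

text \<open>\<open>hill_kernel q z k\<close> is the kernel of \<open>(L - z)\<^sup>k\<close>.\<close>

primrec hill_kernel ::
    "(real \<Rightarrow> complex) \<Rightarrow> complex \<Rightarrow> nat \<Rightarrow> (real \<Rightarrow> complex) set" where
  "hill_kernel q z 0 = {\<lambda>x. 0}"
| "hill_kernel q z (Suc k) = {f. \<exists>g \<in> hill_kernel q z k. hill_graph q f (\<lambda>x. z * f x + g x)}"

definition fscale :: "complex \<Rightarrow> (real \<Rightarrow> complex) \<Rightarrow> (real \<Rightarrow> complex)" where
  "fscale c f = (\<lambda>x. c * f x)"

interpretation fun_space: vector_space fscale
  by unfold_locales (auto simp: fscale_def fun_eq_iff algebra_simps)

definition algebraic_multiplicity :: "(real \<Rightarrow> complex) \<Rightarrow> complex \<Rightarrow> nat" where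
  "algebraic_multiplicity q z = vector_space.dim fscale (\<Union>k. hill_kernel q z k)"

definition lex_le :: "complex \<Rightarrow> complex \<Rightarrow> bool" where
  "lex_le z z' \<longleftrightarrow> Re z < Re z' \<or> Re z = Re z' \<and> Im z \<le> Im z'"

text \<open>\<open>ev\<close> lists the periodic eigenvalues with algebraic multiplicity in lexicographic order:
  \<open>\<lambda>\<^sub>0 = ev 0\<close>, \<open>\<lambda>\<^sub>n\<^sup>- = ev (2 n - 1)\<close> and \<open>\<lambda>\<^sub>n\<^sup>+ = ev (2 n)\<close> for \<open>n \<ge> 1\<close>. These conditions determine
  \<open>ev\<close> uniquely. Strictness between consecutive pairs is not demanded: for complex \<open>q\<close>
  finitely many pairs may collide.\<close>

definition periodic_eigenvalue_listing ::
    "(real \<Rightarrow> complex) \<Rightarrow> (nat \<Rightarrow> complex) \<Rightarrow> bool" where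
  "periodic_eigenvalue_listing q ev \<longleftrightarrow> (\<forall>n. lex_le (ev n) (ev (Suc n))) \<and>
     (\<forall>z. finite {n. ev n = z} \<and> card {n. ev n = z} = algebraic_multiplicity q z)"

definition gap_length :: "(nat \<Rightarrow> complex) \<Rightarrow> nat \<Rightarrow> complex" where
  "gap_length ev n = ev (2 * n) - ev (2 * n - 1)"

lemma L2_periodic_integrable:
  assumes "q \<in> L2_periodic 1"
  shows "set_integrable lebesgue {0..1} (\<lambda>x. q x * cis (c * x))"
proof -
  have m: "q \<in> borel_measurable lebesgue"
    and i: "set_integrable lebesgue {0..1} (\<lambda>x. (cmod (q x))\<^sup>2)"
    using assms by (auto simp: L2_periodic_def)
  have c: "continuous_on UNIV (\<lambda>x. cis (c * x))"
    by (intro continuous_intros)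
  have mc: "(\<lambda>x. cis (c * x)) \<in> borel_measurable lebesgue"
    by (rule measurable_completion) (use borel_measurable_continuous_onI[OF c] in simp)
  have 1: "set_integrable lebesgue {0..1} (\<lambda>x::real. 1::real)"
    by (simp add: set_integrable_def)
  have b: "set_integrable lebesgue {0..1} (\<lambda>x. 1 + (cmod (q x))\<^sup>2)"
    using set_integral_add(1)[OF 1 i] .
  have le: "t \<le> 1 + t\<^sup>2" for t :: real
    using zero_le_power2[of "t - 1/2"] by (simp add: power2_eq_square algebra_simps)
  show ?thesis
  proof (rule set_integrable_bound[OF b])
    show "set_borel_measurable lebesgue {0..1} (\<lambda>x. q x * cis (c * x))"
      unfolding set_borel_measurable_def
      by (intro borel_measurable_scaleR borel_measurable_times borel_measurable_indicator m mc) auto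
    show "AE x in lebesgue. x \<in> {0..1} \<longrightarrow> norm (q x * cis (c * x)) \<le> norm (1 + (cmod (q x))\<^sup>2)"
      using le by (auto simp: norm_mult)
  qed
qed

lemma LINT_cis:
  "(LINT x:{0..1}|lebesgue. cis (2 * of_int k * pi * x)) = (if k = 0 then 1 else 0)"
proof (cases "k = 0")
  case True
  then show ?thesis by (simp add: set_lebesgue_integral_def)
next
  case False
  define c where "c = 2 * of_int k * pi"
  have c0: "c \<noteq> 0" using False by (simp add: c_def)
  have ci: "continuous_on {0..1} (\<lambda>x. cis (c * x))"
    by (intro continuous_intros)
  have "((\<lambda>x. cis (c * x)) has_integral (cis (c * 1) / (\<i> * c) - cis (c * 0) / (\<i> * c))) {0..1}"
  proof (rule fundamental_theorem_of_calculus)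
    fix x :: real
    show "((\<lambda>x. cis (c * x) / (\<i> * c)) has_vector_derivative cis (c * x)) (at x within {0..1})"
    proof -
      have "((\<lambda>z. exp (\<i> * of_real c * z) / (\<i> * of_real c)) has_field_derivative
          exp (\<i> * of_real c * of_real x)) (at (of_real x))"
        using c0 by (auto intro!: derivative_eq_intros)
      from has_vector_derivative_real_field[OF this, of "{0..1}"] show ?thesis
        by (simp add: cis_conv_exp mult.assoc)
    qed
  qed simp
  moreover have "cis c = 1"
    using cis_multiple_2pi[of "of_int k"] by (simp add: c_def mult.assoc mult.commute mult.left_commute)
  ultimately have "((\<lambda>x. cis (c * x)) has_integral 0) {0..1}" by simp
  moreover have "set_integrable lebesgue {0..1} (\<lambda>x. cis (c * x))"
    using absolutely_integrable_continuous_real[OF ci] .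
  ultimately show ?thesis
    using False by (simp add: set_lebesgue_integral_eq_integral(2) integral_unique c_def)
qed

lemma fourier_coeff_tail:
  assumes "q \<in> L2_periodic 1"
  shows "fourier_coeff (fourier_tail N q) n = (if \<bar>n\<bar> \<ge> int N then fourier_coeff q n else 0)"
proof -
  define A where "A = {m. \<bar>m\<bar> < int N}"
  have fin: "finite A"
    by (rule finite_subset[of _ "{- int N..int N}"]) (auto simp: A_def)
  have e: "fourier_tail N q x * cis (- 2 * of_int n * pi * x) =
     q x * cis (- 2 * of_int n * pi * x) -
       (\<Sum>m\<in>A. fourier_coeff q m * cis (2 * of_int (m - n) * pi * x))" for x
    by (simp add: fourier_tail_def A_def left_diff_distrib sum_distrib_right mult.assoc cis_mult
        flip: distrib_right)
  have i: "set_integrable lebesgue {0..1} (\<lambda>x. fourier_coeff q m * cis (2 * of_int (m - n) * pi * x))" for m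
    by (intro absolutely_integrable_continuous_real continuous_intros)
  have "fourier_coeff (fourier_tail N q) n = fourier_coeff q n -
      (LINT x:{0..1}|lebesgue. (\<Sum>m\<in>A. fourier_coeff q m * cis (2 * of_int (m - n) * pi * x)))"
    unfolding fourier_coeff_def[of "fourier_tail N q"] e fourier_coeff_def[of q n]
    using L2_periodic_integrable[OF assms, of "- 2 * of_int n * pi"] absolutely_integrable_sum[OF fin i]
    by (intro set_integral_diff(2))
  also have "(LINT x:{0..1}|lebesgue. (\<Sum>m\<in>A. fourier_coeff q m * cis (2 * of_int (m - n) * pi * x)))
      = (\<Sum>m\<in>A. fourier_coeff q m * (LINT x:{0..1}|lebesgue. cis (2 * of_int (m - n) * pi * x)))"
    using i unfolding set_lebesgue_integral_def set_integrable_def scaleR_sum_right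
    by (subst Bochner_Integration.integral_sum) (simp_all only: mult_scaleR_right [symmetric] integral_mult_right_zero)
  also have "\<dots> = (\<Sum>m\<in>A. if m = n then fourier_coeff q m else 0)"
    unfolding LINT_cis by (intro sum.cong) auto
  also have "\<dots> = (if n \<in> A then fourier_coeff q n else 0)"
    using fin by simp
  finally show ?thesis by (auto simp: A_def)
qed

end

theory Submission
  imports Defs "HOL-Complex_Analysis.Great_Picard"
    "HOL-Computational_Algebra.Fundamental_Theorem_Algebra"
begin

text \<open>
  On Fourier coefficients with respect to \<open>cis (\<pi> k x)\<close> the operator becomes
  \<open>(L f)\<^sub>k = \<pi>\<^sup>2 k\<^sup>2 f\<^sub>k + (v * f)\<^sub>k\<close>, where \<open>v\<^sub>2\<^sub>m = q\<^sub>m\<close> and \<open>v\<close> vanishes at odd indices.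

  Counting. Let \<open>\<mu> = \<pi>\<^sup>2 (n + 1/2)\<^sup>2\<close> and let \<open>h\<close> be the indefinite form \<open>\<Sum>k. \<plusminus> \<bar>f\<^sub>k\<bar>\<^sup>2\<close> with sign \<open>-\<close>
  exactly for \<open>\<bar>k\<bar> \<le> n\<close>. If \<open>\<parallel>v\<parallel> \<le> (n + 1) / 4\<close>, then \<open>Re h((L - \<mu>) f, f) > 0\<close>, so by a Lyapunov argument
  \<open>h\<close> is negative definite on the sum of the generalized eigenspaces with \<open>Re z < \<mu>\<close>; hence the
  dimension of this sum is at most \<open>2 n + 1\<close>. For the truncations of \<open>L\<close> to \<open>\<bar>k\<bar> \<le> M\<close> the dimension is
  exactly \<open>2 n + 1\<close>, by the same bound on both sides of \<open>\<mu>\<close>, and the invariant subspace is the graph of a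
  map of norm at most \<open>1\<close> over the modes \<open>\<bar>k\<bar> \<le> n\<close>. A limit of these graphs as \<open>M \<rightarrow> \<infinity>\<close> is an
  invariant subspace of \<open>L\<close>. So exactly \<open>2 n + 1\<close> eigenvalues have \<open>Re z < \<mu>\<close>, and both
  \<open>\<lambda>\<^sub>n\<^sup>-\<close> and \<open>\<lambda>\<^sub>n\<^sup>+\<close> lie in the strip \<open>\<pi>\<^sup>2 (n - 1/2)\<^sup>2 \<le> Re z \<le> \<pi>\<^sup>2 (n + 1/2)\<^sup>2\<close>.

  Gaps. In that strip all modes except \<open>n\<close> and \<open>- n\<close> can be eliminated by a contraction in a weighted
  supremum norm, where submultiplicativity of \<open>w\<close> makes the weight compatible with convolution. What
  remains is \<open>(z - \<pi>\<^sup>2 n\<^sup>2 - a(z))\<^sup>2 = c\<^sub>n(z) c\<^sub>-\<^sub>n(z)\<close>, where \<open>a\<close> has Lipschitz constant \<open>1/4\<close> and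
  \<open>w\<^sub>n \<bar>c\<^sub>\<plusminus>\<^sub>n - q\<^sub>\<plusminus>\<^sub>n\<bar> \<le> 2 \<parallel>q\<parallel>\<^sub>w\<^sup>2 / n\<close>. Subtracting the equations for two eigenvalues bounds the gap.
\<close>

section \<open>Partially defined operators and generalized eigenspaces\<close>

text \<open>A complex \<open>q\<close> makes \<open>L\<close> non-selfadjoint, so neither a min-max
  principle nor orthogonal spectral projections count eigenvalues. The Lyapunov inequality does, and
  it counts generalized eigenvectors directly, as algebraic multiplicity demands. On its own it
  bounds dimensions only from above; a lower bound needs a total dimension to subtract from, hence
  the truncations. Limits of eigenvectors could become dependent, but graphs over the fixed modes
  \<bar>k\<bar> \<le> n cannot: there the coordinates remain those of unit vectors.

  The bound \<open>nw\<close> \<le> n / 4 serves both halves. It covers counting at n - 1 and at n,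
  and it makes the contraction factor 4 \<open>nw\<close> / (3 n) at most 1/3; the Lipschitz
  constant 1/4 and the error 2 \<open>nw\<close>^2 / n come from there. The Lipschitz term costs a
  factor 4/3, so a gap is at most 8/3, rounded to 3, times a geometric mean, which explains the 9.
  The error terms sum to 144 / N, below the stated 576 / N.

  Period 2 doubles the frequencies, so the weight has to be extended to odd indices. It is set to 1
  there and stays submultiplicative along the support of \<open>v\<close>.\<close>

locale partial_operator = vector_space scale
  for scale :: "complex \<Rightarrow> 'v::ab_group_add \<Rightarrow> 'v" (infixr "*s" 75) +
  fixes D :: "'v set" and L :: "'v \<Rightarrow> 'v"
  assumes subspace_D: "subspace D"
    and L_add: "x \<in> D \<Longrightarrow> y \<in> D \<Longrightarrow> L (x + y) = L x + L y"
    and L_scale: "x \<in> D \<Longrightarrow> L (c *s x) = c *s L x"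
begin

lemma L_0 [simp]: "L 0 = 0"
  using L_scale[of 0 0] subspace_0[OF subspace_D] by simp

lemma L_diff: "x \<in> D \<Longrightarrow> y \<in> D \<Longrightarrow> L (x - y) = L x - L y"
  using L_add[of "x - y" y] subspace_diff[OF subspace_D] by (simp add: algebra_simps)

lemma L_sum: "(\<And>i. i \<in> I \<Longrightarrow> f i \<in> D) \<Longrightarrow> L (\<Sum>i\<in>I. f i) = (\<Sum>i\<in>I. L (f i))"
proof (induction I rule: infinite_finite_induct)
  case (insert i I)
  then show ?case using L_add[of "f i" "sum f I"] subspace_sum[OF subspace_D, of I f] by simp
qed simp_all

text \<open>\<open>D\<close> need not be invariant under \<open>L\<close>; membership of
  \<open>L f - z *s f\<close> in the previous kernel keeps the whole chain inside \<open>D\<close>,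
  where \<open>L\<close> is linear.\<close>

primrec kerpow :: "complex \<Rightarrow> nat \<Rightarrow> 'v set" where
  "kerpow z 0 = {0}"
| "kerpow z (Suc k) = {f \<in> D. L f - z *s f \<in> kerpow z k}"

definition gen :: "complex \<Rightarrow> 'v set" where
  "gen z = (\<Union>k. kerpow z k)"

lemma kerpow_D: "kerpow z k \<subseteq> D"
  by (cases k) (use subspace_0[OF subspace_D] in auto)

lemma subspace_kerpow: "subspace (kerpow z k)"
proof (induction k)
  case (Suc k)
  have "0 \<in> kerpow z k" using Suc subspace_0 by blast
  moreover have "L (x + y) - z *s (x + y) \<in> kerpow z k"
    if "x \<in> D" "y \<in> D" "L x - z *s x \<in> kerpow z k" "L y - z *s y \<in> kerpow z k" for x y
    using subspace_add[OF Suc that(3,4)] that by (simp add: L_add algebra_simps)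
  moreover have "L (c *s x) - z *s (c *s x) \<in> kerpow z k"
    if "x \<in> D" "L x - z *s x \<in> kerpow z k" for c x
    using subspace_scale[OF Suc that(2), of c] that by (simp add: L_scale algebra_simps)
  ultimately show ?case
    using subspace_D by (intro subspaceI) (auto simp: subspace_0 subspace_add subspace_scale)
qed simp

lemma kerpow_Suc_mono: "kerpow z k \<subseteq> kerpow z (Suc k)"
proof (induction k)
  case 0
  then show ?case using subspace_0[OF subspace_D] by auto
qed auto

lemma kerpow_mono: "i \<le> j \<Longrightarrow> kerpow z i \<subseteq> kerpow z j"
  by (rule lift_Suc_mono_le[where f = "kerpow z"]) (rule kerpow_Suc_mono)

lemma L_kerpow: "f \<in> kerpow z k \<Longrightarrow> L f \<in> kerpow z k"
proof (cases k)
  case (Suc m)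
  assume f: "f \<in> kerpow z k"
  then have "L f - z *s f \<in> kerpow z k"
    using Suc kerpow_Suc_mono[of z m] by auto
  from subspace_add[OF subspace_kerpow this subspace_scale[OF subspace_kerpow f, of z]]
  show ?thesis by simp
qed simp

lemma gen_D: "gen z \<subseteq> D"
  using kerpow_D by (auto simp: gen_def)

lemma L_gen: "f \<in> gen z \<Longrightarrow> L f \<in> gen z"
  using L_kerpow by (auto simp: gen_def)

lemma subspace_gen: "subspace (gen z)"
proof (rule subspaceI)
  show "0 \<in> gen z" by (auto simp: gen_def intro!: exI[of _ 0])
next
  fix x y assume "x \<in> gen z" "y \<in> gen z"
  then obtain i j where "x \<in> kerpow z i" "y \<in> kerpow z j" by (auto simp: gen_def)
  then have "x \<in> kerpow z (max i j)" "y \<in> kerpow z (max i j)"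
    using kerpow_mono[of i "max i j"] kerpow_mono[of j "max i j"] by auto
  then show "x + y \<in> gen z"
    using subspace_add[OF subspace_kerpow] by (force simp: gen_def)
next
  fix c x assume "x \<in> gen z"
  then show "c *s x \<in> gen z"
    using subspace_scale[OF subspace_kerpow] by (force simp: gen_def)
qed

lemma gen_step: "f \<in> D \<Longrightarrow> L f - z *s f \<in> gen z \<Longrightarrow> f \<in> gen z"
  by (auto simp: gen_def intro: exI[of _ "Suc _"])

text \<open>On the chain of \<zeta> the operator L - z is the nonzero scalar \<zeta> - z plus the
  nilpotent L - \<zeta>, hence onto. The induction solves for g = (L - \<zeta>) u, whose chain is
  shorter, and corrects by \<open>t\<close>. Staying in \<open>W\<close> lets this be used inside an
  invariant subspace.\<close>

lemma kerpow_surj: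
  assumes "z \<noteq> \<zeta>" "subspace W" "\<And>x. x \<in> W \<Longrightarrow> L x \<in> W"
    and "u \<in> kerpow \<zeta> k" "u \<in> W"
  shows "\<exists>v \<in> kerpow \<zeta> k \<inter> W. L v - z *s v = u"
  using assms(4,5)
proof (induction k arbitrary: u)
  case 0
  then show ?case by auto
next
  case (Suc k)
  define g where "g = L u - \<zeta> *s u"
  have g: "g \<in> kerpow \<zeta> k" "g \<in> W"
    using Suc.prems assms(2,3) by (auto simp: g_def intro!: subspace_diff subspace_scale)
  from Suc.IH[OF this] obtain v where v: "v \<in> kerpow \<zeta> k" "v \<in> W" "L v - z *s v = g" by auto
  define t where "t = (1 / (\<zeta> - z)) *s (u - v)"
  have v': "v \<in> kerpow \<zeta> (Suc k)" using v kerpow_Suc_mono by blast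
  have D: "u \<in> D" "v \<in> D" using Suc.prems v' kerpow_D by blast+
  have "t \<in> kerpow \<zeta> (Suc k)"
    unfolding t_def using Suc.prems(1) v' subspace_kerpow by (blast intro: subspace_scale subspace_diff)
  moreover have "t \<in> W"
    unfolding t_def using Suc.prems(2) v(2) assms(2) by (blast intro: subspace_scale subspace_diff)
  moreover have "L t - z *s t = u"
  proof -
    have "L (u - v) - z *s (u - v) = (L u - z *s u) - (L v - z *s v)"
      using D by (simp add: L_diff algebra_simps)
    also have "\<dots> = (\<zeta> - z) *s u"
      unfolding v(3) g_def by (simp add: algebra_simps)
    finally have *: "L (u - v) - z *s (u - v) = (\<zeta> - z) *s u" .
    have "L t - z *s t = (1 / (\<zeta> - z)) *s (L (u - v) - z *s (u - v))"
      using L_scale[OF subspace_diff[OF subspace_D D]] by (simp add: t_def scale_right_diff_distrib mult.commute)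
    then show ?thesis using assms(1) unfolding * by simp
  qed
  ultimately show ?case by blast
qed

text \<open>Applying \<open>L - \<zeta>\<close> to an eigenvector \<open>x = g + m\<close> for \<open>z\<close> only rescales \<open>x\<close>, but shortens the chain of \<open>g\<close>.\<close>

lemma eigenvector_drop_gen:
  assumes "z \<noteq> \<zeta>" "subspace M" "M \<subseteq> D" "\<And>y. y \<in> M \<Longrightarrow> L y \<in> M"
    and "g \<in> kerpow \<zeta> k" "m \<in> M" "L (g + m) = z *s (g + m)"
  shows "g + m \<in> M"
  using assms(5-7)
proof (induction k arbitrary: g m)
  case (Suc k)
  have D: "g \<in> D" "m \<in> D" using Suc.prems assms(3) by auto
  have eq: "(L g - \<zeta> *s g) + (L m - \<zeta> *s m) = (z - \<zeta>) *s (g + m)"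
  proof -
    have "(L g - \<zeta> *s g) + (L m - \<zeta> *s m) = L (g + m) - \<zeta> *s (g + m)"
      using D by (simp add: L_add algebra_simps)
    then show ?thesis using Suc.prems(3) by (simp add: algebra_simps)
  qed
  have "(L g - \<zeta> *s g) + (L m - \<zeta> *s m) \<in> M"
  proof (rule Suc.IH)
    show "L g - \<zeta> *s g \<in> kerpow \<zeta> k" using Suc.prems by simp
    show "L m - \<zeta> *s m \<in> M"
      using Suc.prems assms(2,4) by (blast intro: subspace_diff subspace_scale)
    show "L ((L g - \<zeta> *s g) + (L m - \<zeta> *s m)) = z *s ((L g - \<zeta> *s g) + (L m - \<zeta> *s m))"
      unfolding eq using Suc.prems(3) L_scale[OF subspace_add[OF subspace_D D]]
      by (simp add: mult.commute)
  qed
  then have "(1 / (z - \<zeta>)) *s ((z - \<zeta>) *s (g + m)) \<in> M"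
    unfolding eq using assms(2) by (blast intro: subspace_scale)
  then show ?case using assms(1) by simp
qed auto

lemma span_gen_D: "span (\<Union>\<zeta>\<in>Z. gen \<zeta>) \<subseteq> D"
  using gen_D by (intro span_minimal subspace_D) auto

lemma L_span:
  assumes "S \<subseteq> D" "\<And>x. x \<in> S \<Longrightarrow> L x \<in> span S" "x \<in> span S"
  shows "L x \<in> span S"
proof -
  have "x \<in> D \<and> L x \<in> span S"
    using assms(3)
  proof (induction rule: span_induct_alt)
    case base
    then show ?case using subspace_0[OF subspace_D] by (simp add: span_zero)
  next
    case (step c x y)
    have D: "c *s x \<in> D" "x \<in> D" "y \<in> D"
      using step assms(1) subspace_scale[OF subspace_D] by auto
    have "L (c *s x + y) = c *s L x + L y"
      using D by (simp add: L_add L_scale)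
    then show ?case using step assms D by (auto intro: span_add span_scale subspace_add[OF subspace_D])
  qed
  then show ?thesis ..
qed

lemma span_gen_invariant: "x \<in> span (\<Union>\<zeta>\<in>Z. gen \<zeta>) \<Longrightarrow> L x \<in> span (\<Union>\<zeta>\<in>Z. gen \<zeta>)"
  by (rule L_span) (use gen_D L_gen in \<open>auto intro!: span_base\<close>)

text \<open>\<open>eigenvector_drop_gen\<close> removes the generalized eigenspaces from the sum one
  by one, until the empty sum is left.\<close>

lemma eigenvector_span_gen:
  assumes "finite Z" "z \<notin> Z" "x \<in> span (\<Union>\<zeta>\<in>Z. gen \<zeta>)" "L x = z *s x"
  shows "x = 0"
  using assms
proof (induction Z arbitrary: x rule: finite_induct)
  case (insert \<zeta> Z)
  from insert.prems have "x \<in> span (gen \<zeta> \<union> (\<Union>\<zeta>\<in>Z. gen \<zeta>))" by simp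
  then obtain g m where x: "x = g + m" "g \<in> span (gen \<zeta>)" "m \<in> span (\<Union>\<zeta>\<in>Z. gen \<zeta>)"
    by (auto simp: span_Un)
  have "g \<in> gen \<zeta>" using x(2) subspace_gen[of \<zeta>] by (simp add: span_eq_iff[THEN iffD2])
  then obtain k where g: "g \<in> kerpow \<zeta> k" by (auto simp: gen_def)
  have "g + m \<in> span (\<Union>\<zeta>\<in>Z. gen \<zeta>)"
    using eigenvector_drop_gen[OF _ subspace_span span_gen_D span_gen_invariant g x(3)] insert.prems x(1)
    by auto
  then show ?case using insert x(1) by auto
qed simp

text \<open>The last nonzero vector in the chain of \<open>f\<close> under L - z is an eigenvector,
  and invariance keeps it in \<open>W\<close>.\<close>

lemma eigenvector_of_kerpow:
  assumes "f \<in> kerpow z k" "f \<noteq> 0" "f \<in> W" "subspace W" "\<And>x. x \<in> W \<Longrightarrow> L x \<in> W"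
  shows "\<exists>x \<in> W \<inter> D. x \<noteq> 0 \<and> L x = z *s x"
  using assms(1-3)
proof (induction k arbitrary: f)
  case (Suc k)
  show ?case
  proof (cases "L f - z *s f = 0")
    case True
    then show ?thesis using Suc.prems by auto
  next
    case False
    show ?thesis
      by (rule Suc.IH[OF _ False]) (use Suc.prems assms(4,5) in \<open>auto intro: subspace_diff subspace_scale\<close>)
  qed
qed auto

text \<open>Independence of generalized eigenspaces: a nonzero common vector would produce an
  eigenvector for \<open>z\<close> inside the sum belonging to other values.\<close>

lemma gen_inter_span_gen:
  assumes "finite Z" "z \<notin> Z" "f \<in> gen z" "f \<in> span (\<Union>\<zeta>\<in>Z. gen \<zeta>)"
  shows "f = 0"
proof (rule ccontr)
  assume "f \<noteq> 0"
  moreover obtain k where "f \<in> kerpow z k" using assms(3) by (auto simp: gen_def)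
  ultimately obtain x where "x \<in> span (\<Union>\<zeta>\<in>Z. gen \<zeta>)" "x \<noteq> 0" "L x = z *s x"
    using eigenvector_of_kerpow[OF _ _ assms(4) subspace_span span_gen_invariant] by blast
  then show False using eigenvector_span_gen[OF assms(1,2)] by blast
qed

lemma independent_Un:
  assumes "independent A" "independent B" "span A \<inter> span B \<subseteq> {0}" "finite B"
  shows "independent (A \<union> B)"
proof -
  have "independent (A \<union> C)" if "C \<subseteq> B" for C
    using finite_subset[OF that assms(4)] that
  proof (induction C rule: finite_induct)
    case empty
    then show ?case using assms(1) by simp
  next
    case (insert x C)
    have "x \<notin> span (A \<union> C)"
    proof
      assume "x \<in> span (A \<union> C)"
      then obtain a c where ac: "x = a + c" "a \<in> span A" "c \<in> span C" by (auto simp: span_Un)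
      have "c \<in> span B" using ac(3) span_mono[of C B] insert by auto
      then have "x - c \<in> span B" using insert by (auto intro: span_diff span_base)
      then have "a = 0" using assms(3) ac by auto
      then have "x \<in> span C" using ac by simp
      moreover have "x \<notin> span C"
        using independent_mono[OF assms(2), of "insert x C"] insert by (simp add: independent_insert)
      ultimately show False by simp
    qed
    then show ?case using insert by (simp add: independent_insertI)
  qed
  then show ?thesis by blast
qed

text \<open>Bases of the single spaces are united. Finite spanning sets give \<open>dim\<close> its
  meaning here, as the cardinality of an infinite basis is 0.\<close>

lemma gen_bases:
  assumes "finite Z" "\<And>z. z \<in> Z \<Longrightarrow> \<exists>B. finite B \<and> gen z \<subseteq> span B"
  shows "\<exists>B. finite B \<and> independent B \<and> B \<subseteq> (\<Union>z\<in>Z. gen z) \<and> span B = span (\<Union>z\<in>Z. gen z)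
    \<and> card B = (\<Sum>z\<in>Z. dim (gen z))"
  using assms
proof (induction Z rule: finite_induct)
  case empty
  then show ?case using independent_empty by (auto intro!: exI[of _ "{}"])
next
  case (insert z Z)
  then obtain B where B: "finite B" "independent B" "B \<subseteq> (\<Union>z\<in>Z. gen z)"
    "span B = span (\<Union>z\<in>Z. gen z)" "card B = (\<Sum>z\<in>Z. dim (gen z))" by auto
  obtain F where F: "finite F" "gen z \<subseteq> span F" using insert.prems[of z] by blast
  obtain C where C: "C \<subseteq> gen z" "independent C" "gen z \<subseteq> span C" "card C = dim (gen z)"
    using basis_exists by blast
  have fC: "finite C" using independent_span_bound[OF F(1) C(2)] C(1) F(2) by auto
  have sC: "span C = gen z" using C subspace_gen by (metis span_subspace)
  have disj: "span B \<inter> span C \<subseteq> {0}"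
    unfolding sC B(4) using gen_inter_span_gen[OF insert(1,2)] by auto
  have i: "independent (B \<union> C)" by (rule independent_Un[OF B(2) C(2) disj fC])
  have "B \<inter> C = {}"
    using disj span_superset[of B] span_superset[of C] B(2) dependent_zero by blast
  then have "card (B \<union> C) = (\<Sum>z\<in>insert z Z. dim (gen z))"
    using B C fC insert by (simp add: card_Un_disjoint)
  moreover have "span (B \<union> C) = span (\<Union>z\<in>insert z Z. gen z)"
  proof -
    have "span (B \<union> C) = {x + y |x y. x \<in> span B \<and> y \<in> span C}" by (rule span_Un)
    also have "\<dots> = span ((\<Union>z\<in>Z. gen z) \<union> gen z)"
      unfolding span_Un B(4) sC using subspace_gen[of z] by (simp add: span_eq_iff[THEN iffD2])
    finally show ?thesis by (simp add: Un_commute)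
  qed
  ultimately show ?case
    using B C fC i by (intro exI[of _ "B \<union> C"]) auto
qed

section \<open>Polynomials in \<open>L\<close> on an invariant finite-dimensional subspace\<close>

definition pact :: "complex poly \<Rightarrow> 'v \<Rightarrow> 'v" where
  "pact p f = (\<Sum>i\<le>degree p. coeff p i *s (L ^^ i) f)"

lemma pact_bound: "degree p \<le> m \<Longrightarrow> pact p f = (\<Sum>i\<le>m. coeff p i *s (L ^^ i) f)"
  unfolding pact_def by (intro sum.mono_neutral_left) (auto simp: coeff_eq_0)

context
  fixes W assumes W: "subspace W" "W \<subseteq> D" "\<And>x. x \<in> W \<Longrightarrow> L x \<in> W"
begin

lemma iter_invariant: "f \<in> W \<Longrightarrow> (L ^^ i) f \<in> W"
  by (induction i) (use W in auto)

lemma pact_invariant: "f \<in> W \<Longrightarrow> pact p f \<in> W"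
  unfolding pact_def by (intro subspace_sum subspace_scale iter_invariant W)

text \<open>Multiplication by X shifts the coefficients by one, which matches one more application
  of \<open>L\<close>. One linear factor suffices, since an annihilating polynomial is split root by
  root.\<close>

lemma pact_linear_factor:
  assumes "f \<in> W"
  shows "pact ([:- z, 1:] * r) f = L (pact r f) - z *s pact r f"
proof -
  define m where "m = Suc (degree r)"
  have "degree ([:- z, 1:] * r) \<le> m"
    by (rule order.trans[OF degree_mult_le]) (simp add: m_def)
  then have "pact ([:- z, 1:] * r) f = (\<Sum>i\<le>m. coeff ([:- z, 1:] * r) i *s (L ^^ i) f)"
    by (rule pact_bound)
  also have "\<dots> = (\<Sum>i\<le>m. coeff (pCons 0 r) i *s (L ^^ i) f - z *s (coeff r i *s (L ^^ i) f))"
    by (intro sum.cong refl) (simp add: algebra_simps)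
  also have "\<dots> = (\<Sum>i\<le>m. coeff (pCons 0 r) i *s (L ^^ i) f) - z *s pact r f"
    using pact_bound[of r m f] by (simp only: sum_subtractf scale_sum_right m_def)
  also have "(\<Sum>i\<le>m. coeff (pCons 0 r) i *s (L ^^ i) f) = (\<Sum>i\<le>degree r. L (coeff r i *s (L ^^ i) f))"
    unfolding m_def sum.atMost_Suc_shift using iter_invariant[OF assms] W(2)
    by (auto simp: subset_iff L_scale intro!: sum.cong)
  also have "\<dots> = L (pact r f)"
    unfolding pact_def using iter_invariant[OF assms] W(1,2)
    by (subst L_sum) (auto intro: subspace_scale[OF subspace_D])
  finally show ?thesis .
qed

lemma exists_annihilator:
  assumes "f \<in> W" "finite B" "W \<subseteq> span B"
  shows "\<exists>p. p \<noteq> 0 \<and> pact p f = 0"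
proof -
  define m where "m = card B"
  have "\<exists>c. (\<exists>i\<le>m. c i \<noteq> 0) \<and> (\<Sum>i\<le>m. c i *s (L ^^ i) f) = 0"
  \<comment> \<open>Dependence is a property of sets, so equal iterates would collapse to one
    element; that case gets its own relation, the difference of two equal iterates.\<close>
  proof (cases "inj_on (\<lambda>i. (L ^^ i) f) {..m}")
    case False
    then obtain i j where ij: "i \<le> m" "j \<le> m" "i \<noteq> j" "(L ^^ i) f = (L ^^ j) f"
      by (auto simp: inj_on_def)
    define c :: "nat \<Rightarrow> complex" where "c = (\<lambda>l. (if l = i then 1 else 0) - (if l = j then 1 else 0))"
    have "(\<Sum>l\<le>m. c l *s (L ^^ l) f) = (\<Sum>l\<le>m. (if l = i then (L ^^ i) f else 0) - (if l = j then (L ^^ j) f else 0))"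
      using ij by (intro sum.cong) (auto simp: c_def scale_left_diff_distrib)
    also have "\<dots> = 0" using ij by (simp add: sum_subtractf)
    finally show ?thesis using ij by (intro exI[of _ c]) (auto simp: c_def)
  next
    case True
    let ?S = "(\<lambda>i. (L ^^ i) f) ` {..m}"
    have "dependent ?S"
    proof (rule ccontr)
      assume "independent ?S"
      moreover have "?S \<subseteq> span B" using iter_invariant assms by blast
      ultimately have "card ?S \<le> m" using independent_span_bound[OF assms(2)] m_def by blast
      then show False using card_image[OF True] by simp
    qed
    then obtain u v where "v \<in> ?S" "u v \<noteq> 0" "(\<Sum>v\<in>?S. u v *s v) = 0"
      by (auto simp: dependent_finite)
    then show ?thesis using True
      by (intro exI[of _ "\<lambda>i. u ((L ^^ i) f)"]) (auto simp: sum.reindex)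
  qed
  then obtain c where c: "\<exists>i\<le>m. c i \<noteq> 0" "(\<Sum>i\<le>m. c i *s (L ^^ i) f) = 0" by blast
  define p where "p = Poly (map c [0..<Suc m])"
  have cp: "coeff p i = (if i \<le> m then c i else 0)" for i
    by (auto simp: p_def nth_default_def nth_append simp del: upt_Suc)
  have "p \<noteq> 0" using c(1) cp by (metis coeff_0)
  moreover have "degree p \<le> m" by (rule degree_le) (auto simp: cp)
  then have "pact p f = 0" using c(2) by (simp add: pact_bound cp)
  ultimately show ?thesis by blast
qed

text \<open>Primary decomposition without projections. If (L - z) f lies in \<open>U\<close>, then
  so does f: \<open>dec\<close> writes it as (L - z) v + g with v in \<open>U\<close> and g in
  \<open>gen z\<close>, so f - v is itself a generalized eigenvector. Stripping the roots of an
  annihilating polynomial one by one then leads from 0 back to f.\<close>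

theorem invariant_subset_span_gen:
  assumes "finite B" "W \<subseteq> span B"
  shows "W \<subseteq> span {g \<in> W. \<exists>z. g \<in> gen z}"
proof -
  define U where "U = span {g \<in> W. \<exists>z. g \<in> gen z}"
  have UW: "U \<subseteq> W" unfolding U_def by (rule span_minimal) (use W in auto)
  \<comment> \<open>Parts of \<open>u\<close> at values other than \<open>z\<close> lie in the range
    of L - z by \<open>kerpow_surj\<close>; the parts at \<open>z\<close> are collected in
    \<open>g\<close>.\<close>
  have dec: "\<exists>v\<in>U. \<exists>g\<in>W \<inter> gen z. u = L v - z *s v + g" if "u \<in> U" for u z
    using that unfolding U_def
  proof (induction rule: span_induct_alt)
    case base
    then show ?case
      using subspace_0[OF W(1)] subspace_0[OF subspace_gen[of z]] by (intro bexI[of _ 0]) (auto simp: span_zero)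
  next
    case (step c x y)
    then obtain v g where vg: "v \<in> U" "g \<in> W \<inter> gen z" "y = L v - z *s v + g" unfolding U_def by blast
    from step obtain \<zeta> where x: "x \<in> W" "x \<in> gen \<zeta>" by auto
    have vD: "v \<in> D" using vg UW W by auto
    show ?case
    proof (cases "\<zeta> = z")
      case True
      then have "c *s x + y = L v - z *s v + (c *s x + g)" "c *s x + g \<in> W \<inter> gen z"
        using x vg W subspace_gen by (auto intro!: subspace_add subspace_scale)
      then show ?thesis using vg(1) unfolding U_def by blast
    next
      case False
      then obtain t where t: "t \<in> gen \<zeta>" "t \<in> W" "L t - z *s t = x"
        using x kerpow_surj[of z \<zeta> W x] W unfolding gen_def by blast
      have tU: "t \<in> U" unfolding U_def using t by (auto intro!: span_base)
      have "t \<in> D" using t W by auto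
      then have "c *s x + y = L (c *s t + v) - z *s (c *s t + v) + g"
        using vD subspace_scale[OF subspace_D, of t c]
        by (simp add: vg(3) t(3)[symmetric] L_add L_scale algebra_simps)
      moreover have "c *s t + v \<in> U"
        using tU vg unfolding U_def by (intro span_add span_scale)
      ultimately show ?thesis using vg(2) unfolding U_def by blast
    qed
  qed
  have step: "f \<in> U" if f: "f \<in> W" "L f - z *s f \<in> U" for f z
  proof -
    obtain v g where vg: "v \<in> U" "g \<in> W" "g \<in> gen z" "L f - z *s f = L v - z *s v + g"
      using dec[OF f(2), of z] by auto
    have D: "f \<in> D" "v \<in> D" using f vg UW W by auto
    have "L (f - v) - z *s (f - v) = (L f - z *s f) - (L v - z *s v)"
      using D by (simp add: L_diff algebra_simps)
    also have "\<dots> = g" using vg by simp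
    finally have eq: "L (f - v) - z *s (f - v) = g" .
    then have "f - v \<in> gen z"
      using vg(3) gen_step[OF subspace_diff[OF subspace_D D]] by simp
    moreover have "f - v \<in> W" using f(1) vg(1) UW by (intro subspace_diff[OF W(1)]) auto
    ultimately have "f - v \<in> U" unfolding U_def by (intro span_base) blast
    then have "(f - v) + v \<in> U" using vg(1) unfolding U_def by (rule span_add)
    then show ?thesis by simp
  qed
  have *: "f \<in> U" if "p \<noteq> 0" "pact p f \<in> U" "f \<in> W" for p f
    using that
  proof (induction "degree p" arbitrary: p)
    case 0
    then obtain c where "p = [:c:]" "c \<noteq> 0" by (metis degree_eq_zeroE pCons_0_0)
    then have "(1 / c) *s pact p f = f" by (simp add: pact_def)
    moreover have "(1 / c) *s pact p f \<in> U" using 0(3) unfolding U_def by (rule span_scale)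
    ultimately show ?case by simp
  next
    case (Suc d)
    then obtain z where "poly p z = 0" using alg_closed_imp_poly_has_root[of p] by auto
    then obtain r where r: "p = [:- z, 1:] * r" by (auto simp: poly_eq_0_iff_dvd elim: dvdE)
    have r0: "r \<noteq> 0" using Suc.prems r by auto
    have "degree p = Suc (degree r)"
      unfolding r by (subst degree_mult_eq) (use r0 in auto)
    moreover have "pact r f \<in> U"
      using step[of "pact r f" z] pact_linear_factor[OF Suc.prems(3), of z r] Suc.prems r
        pact_invariant by auto
    ultimately show ?case using Suc r0 by auto
  qed
  have "0 \<in> U" unfolding U_def by (rule span_zero)
  show ?thesis
  proof
    fix f assume f: "f \<in> W"
    obtain p where "p \<noteq> 0" "pact p f = 0" using exists_annihilator[OF f assms] by blast
    then have "f \<in> U" using *[of p f] f \<open>0 \<in> U\<close> by simp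
    then show "f \<in> span {g \<in> W. \<exists>z. g \<in> gen z}" unfolding U_def .
  qed
qed

end

end

section \<open>The Lyapunov argument for an indefinite Hermitian form\<close>

locale form_operator = partial_operator +
  fixes h :: "'a \<Rightarrow> 'a \<Rightarrow> complex" and \<mu> :: real
  assumes h_add: "x \<in> D \<Longrightarrow> y \<in> D \<Longrightarrow> z \<in> D \<Longrightarrow> h (x + y) z = h x z + h y z"
    and h_scale: "x \<in> D \<Longrightarrow> y \<in> D \<Longrightarrow> h (scale c x) y = c * h x y"
    and h_sym: "x \<in> D \<Longrightarrow> y \<in> D \<Longrightarrow> h y x = cnj (h x y)"
    and h_pos: "x \<in> D \<Longrightarrow> L x \<in> D \<Longrightarrow> x \<noteq> 0 \<Longrightarrow> 0 < Re (h (L x) x) - \<mu> * Re (h x x)"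
begin

lemma h_0: "y \<in> D \<Longrightarrow> h 0 y = 0"
  using h_scale[of 0 y 0] subspace_0[OF subspace_D] by simp

lemma h_diff: "x \<in> D \<Longrightarrow> y \<in> D \<Longrightarrow> z \<in> D \<Longrightarrow> h (x - y) z = h x z - h y z"
  using h_add[of "x - y" y z] subspace_diff[OF subspace_D] by (simp add: algebra_simps)

lemma h_sum: "(\<And>i. i \<in> I \<Longrightarrow> f i \<in> D) \<Longrightarrow> y \<in> D \<Longrightarrow> h (\<Sum>i\<in>I. f i) y = (\<Sum>i\<in>I. h (f i) y)"
proof (induction I rule: infinite_finite_induct)
  case (insert i I)
  then show ?case using h_add[of "f i" "sum f I" y] subspace_sum[OF subspace_D, of I f] by simp
qed (simp_all add: h_0)

lemma h_real: "x \<in> D \<Longrightarrow> h x x = of_real (Re (h x x))"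
  using h_sym[of x x] by (simp add: complex_eq_iff)

text \<open>An orthogonal basis of an invariant subspace on which \<open>h\<close> is definite. The
  sign \<epsilon> treats both sides of \<mu> at once: \<epsilon> = 1 goes with Re z < \<mu> and
  negative \<open>h\<close>, \<epsilon> = - 1 with Re z > \<mu> and positive
  \<open>h\<close>.\<close>

definition hbasis :: "real \<Rightarrow> 'a set \<Rightarrow> bool" where
  "hbasis \<epsilon> B \<longleftrightarrow> finite B \<and> B \<subseteq> D \<and> (\<forall>b\<in>B. \<forall>c\<in>B. b \<noteq> c \<longrightarrow> h b c = 0) \<and>
     (\<forall>b\<in>B. \<epsilon> * Re (h b b) < 0) \<and> (\<forall>b\<in>B. L b \<in> span B)"

lemma hbasis_span_D: "hbasis \<epsilon> B \<Longrightarrow> span B \<subseteq> D"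
  by (auto simp: hbasis_def dest: span_minimal[OF _ subspace_D])

lemma hbasis_comb:
  assumes "hbasis \<epsilon> B" "b \<in> B"
  shows "h (\<Sum>a\<in>B. scale (u a) a) b = u b * h b b"
proof -
  have B: "finite B" "B \<subseteq> D" "\<forall>b\<in>B. \<forall>c\<in>B. b \<noteq> c \<longrightarrow> h b c = 0" using assms by (auto simp: hbasis_def)
  have "h (\<Sum>a\<in>B. scale (u a) a) b = (\<Sum>a\<in>B. u a * h a b)"
    using B assms(2) subspace_scale[OF subspace_D] by (subst h_sum) (auto simp: subset_iff h_scale intro!: sum.cong)
  also have "\<dots> = (\<Sum>a\<in>B. if a = b then u b * h b b else 0)"
    using B assms(2) by (intro sum.cong) auto
  finally show ?thesis using B assms by simp
qed

lemma hbasis_independent: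
  assumes "hbasis \<epsilon> B" shows "independent B"
proof -
  have "u v = 0" if "v \<in> B" "(\<Sum>v\<in>B. scale (u v) v) = 0" for u v
  proof -
    have "v \<in> D" "h v v \<noteq> 0" using assms that by (auto simp: hbasis_def)
    then show ?thesis using hbasis_comb[OF assms that(1), of u] that(2) h_0 by auto
  qed
  then show ?thesis using assms by (auto simp: hbasis_def dependent_finite)
qed

lemma hbasis_orthogonal_span:
  assumes "B \<subseteq> D" "x \<in> D" "\<And>b. b \<in> B \<Longrightarrow> h x b = 0" "y \<in> span B"
  shows "h x y = 0"
proof -
  have "y \<in> D \<and> h x y = 0"
    using assms(4)
  proof (induction rule: span_induct_alt)
    case base
    then show ?case using h_sym[of 0 x] h_0[of x] assms subspace_0[OF subspace_D] by simp
  next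
    case (step c b y)
    have D: "b \<in> D" "y \<in> D" "scale c b \<in> D" "scale c b + y \<in> D"
      using step assms(1) subspace_scale[OF subspace_D] subspace_add[OF subspace_D] by auto
    have "h (scale c b + y) x = c * h b x + h y x" using D assms by (simp add: h_add h_scale)
    also have "\<dots> = 0" using h_sym[of x b] h_sym[of x y] D assms step by auto
    finally show ?case using h_sym[of "scale c b + y" x] D assms by auto
  qed
  then show ?thesis ..
qed

text \<open>Orthogonality turns \<open>h x x\<close> into a combination of the values
  \<open>h a a\<close>, all of one sign, with coefficients \<bar>u a\<bar>^2.\<close>

lemma hbasis_definite:
  assumes "hbasis \<epsilon> B" "x \<in> span B" "x \<noteq> 0"
  shows "\<epsilon> * Re (h x x) < 0"
proof -
  have B: "finite B" "B \<subseteq> D" "\<And>b. b \<in> B \<Longrightarrow> \<epsilon> * Re (h b b) < 0" using assms by (auto simp: hbasis_def)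
  obtain u where u: "x = (\<Sum>a\<in>B. scale (u a) a)" using assms(2) B(1) by (auto simp: span_finite)
  have xD: "x \<in> D" using assms hbasis_span_D by auto
  have hbx: "h b x = cnj (u b) * h b b" if "b \<in> B" for b
  proof -
    have "h x b = u b * h b b" unfolding u by (rule hbasis_comb[OF assms(1) that])
    moreover have "h b x = cnj (h x b)" using h_sym[of x b] xD B that by auto
    ultimately show ?thesis using h_real[of b] B that by (metis cnj.simps complex_cnj_complex_of_real complex_cnj_mult subsetD)
  qed
  have "h x x = (\<Sum>a\<in>B. u a * h a x)"
    by (subst u, subst h_sum) (use B xD subspace_scale[OF subspace_D] in \<open>auto simp: h_scale intro!: sum.cong\<close>)
  also have "\<dots> = (\<Sum>a\<in>B. of_real ((cmod (u a))\<^sup>2) * h a a)"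
    by (intro sum.cong refl) (simp add: hbx complex_norm_square mult.assoc[symmetric] del: of_real_power)
  finally have e: "\<epsilon> * Re (h x x) = (\<Sum>a\<in>B. (cmod (u a))\<^sup>2 * (\<epsilon> * Re (h a a)))"
    by (simp add: Re_sum sum_distrib_left mult_ac)
  have "\<exists>b\<in>B. u b \<noteq> 0"
  proof (rule ccontr)
    assume "\<not> ?thesis"
    then have "x = 0" unfolding u by (intro sum.neutral) auto
    then show False using assms by simp
  qed
  then obtain b where "b \<in> B" "u b \<noteq> 0" by blast
  then have "(\<Sum>a\<in>B. (cmod (u a))\<^sup>2 * (\<epsilon> * Re (h a a))) < (\<Sum>a\<in>B. 0)"
    using B by (intro sum_strict_mono_ex1)
      (auto intro!: mult_nonneg_nonpos[OF zero_le_power2] bexI[of _ b] mult_pos_neg[OF _ B(3)] less_imp_le[OF B(3)])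
  then show ?thesis unfolding e by simp
qed

text \<open>\<open>h\<close> is indefinite, but \<open>h b b\<close> is nonzero on the basis, so the
  usual formula for the orthogonal projection still applies.\<close>

lemma hbasis_projection:
  assumes "hbasis \<epsilon> B" "g \<in> D"
  shows "\<exists>u\<in>span B. \<forall>y\<in>span B. h (g - u) y = 0"
proof -
  have B: "finite B" "B \<subseteq> D" "\<And>b. b \<in> B \<Longrightarrow> h b b \<noteq> 0" using assms by (auto simp: hbasis_def)
  define u where "u = (\<Sum>a\<in>B. scale (h g a / h a a) a)"
  have uS: "u \<in> span B" unfolding u_def by (intro span_sum span_scale span_base)
  have uD: "u \<in> D" using uS hbasis_span_D[OF assms(1)] by auto
  have "h (g - u) b = 0" if "b \<in> B" for b
    using hbasis_comb[OF assms(1) that, of "\<lambda>a. h g a / h a a"] B that assms(2) uD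
    by (subst h_diff) (auto simp: u_def[symmetric])
  then show ?thesis
    using hbasis_orthogonal_span[OF B(2), of "g - u"] uS uD assms(2) subspace_diff[OF subspace_D] by blast
qed

lemma hbasis_invariant: "hbasis \<epsilon> B \<Longrightarrow> x \<in> span B \<Longrightarrow> L x \<in> span B"
  by (rule L_span) (auto simp: hbasis_def)

text \<open>For the component \<open>t\<close> of \<open>g\<close> orthogonal to \<open>span B\<close> one has \<open>h (L t) t = z * h t t\<close>, so positivity
  of \<open>h (L t - \<mu> t) t\<close> determines the sign of \<open>h t t\<close>.\<close>

lemma hbasis_extend:
  assumes "hbasis \<epsilon> B" "g \<in> D" "L g - scale z g \<in> span B" "\<epsilon> * (Re z - \<mu>) < 0"
  shows "\<exists>B'. hbasis \<epsilon> B' \<and> B \<subseteq> B' \<and> g \<in> span B'"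
proof -
  have B: "finite B" "B \<subseteq> D" using assms by (auto simp: hbasis_def)
  obtain u where u: "u \<in> span B" "\<forall>y\<in>span B. h (g - u) y = 0" using hbasis_projection[OF assms(1,2)] by blast
  define t where "t = g - u"
  have uD: "u \<in> D" using u hbasis_span_D[OF assms(1)] by auto
  have tD: "t \<in> D" unfolding t_def using uD assms(2) subspace_diff[OF subspace_D] by blast
  show ?thesis
  proof (cases "t = 0")
    case True
    then have "g \<in> span B" using u by (simp add: t_def)
    then show ?thesis using assms(1) by blast
  next
    case False
    define r where "r = L t - scale z t"
    have "r = (L g - scale z g) - (L u - scale z u)"
      using assms(2) uD by (simp add: r_def t_def L_diff algebra_simps)
    then have rS: "r \<in> span B"
      using assms(3) u(1) hbasis_invariant[OF assms(1)] by (auto intro!: span_diff span_scale)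
    then have rD: "r \<in> D" using hbasis_span_D[OF assms(1)] by auto
    have Lt: "L t = r + scale z t" by (simp add: r_def)
    then have LtD: "L t \<in> D" using rD tD subspace_add[OF subspace_D] subspace_scale[OF subspace_D] by simp
    have hrt: "h r t = 0" using u(2) rS h_sym[of t r] tD rD by (auto simp: t_def)
    have "h (L t) t = z * h t t"
      unfolding Lt using rD tD subspace_scale[OF subspace_D] hrt by (simp add: h_add h_scale)
    then have "Re (h (L t) t) = Re z * Re (h t t)"
      using h_real[OF tD] by (metis Im_complex_of_real mult_zero_right diff_zero times_complex.sel(1))
    then have p: "0 < (Re z - \<mu>) * Re (h t t)" using h_pos[OF tD LtD False] by (simp add: algebra_simps)
    have neg: "\<epsilon> * Re (h t t) < 0"
    proof -
      have "\<epsilon> \<noteq> 0" using assms(4) by auto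
      then have "\<epsilon> * \<epsilon> > 0" by (auto simp: zero_less_mult_iff)
      then have "\<epsilon> * \<epsilon> * ((Re z - \<mu>) * Re (h t t)) > 0" using p by (rule mult_pos_pos)
      then have "(\<epsilon> * (Re z - \<mu>)) * (\<epsilon> * Re (h t t)) > 0" by (simp add: mult_ac)
      then show ?thesis using assms(4) by (simp only: zero_less_mult_iff[of "\<epsilon> * (Re z - \<mu>)"]) linarith
    qed
    have ort: "h t b = 0 \<and> h b t = 0" if "b \<in> B" for b
      using u(2) that h_sym[of t b] tD B(2) by (auto simp: t_def span_base)
    have inv: "L b \<in> span (insert t B)" if "b \<in> insert t B" for b
    proof -
      have "span B \<subseteq> span (insert t B)" by (rule span_mono) auto
      moreover have "t \<in> span (insert t B)" by (rule span_base) auto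
      ultimately show ?thesis
        using that Lt rS assms(1) by (auto simp: hbasis_def intro!: span_add span_scale)
    qed
    have "hbasis \<epsilon> (insert t B)"
      using assms(1) tD neg ort inv unfolding hbasis_def by auto
    moreover have "g \<in> span (insert t B)"
    proof -
      have "t + u \<in> span (insert t B)"
        using u(1) span_mono[of B "insert t B"] by (intro span_add) (auto intro: span_base)
      then show ?thesis by (simp add: t_def)
    qed
    ultimately show ?thesis by blast
  qed
qed

text \<open>The chain is absorbed from its end: (L - z) f already lies in the span when f itself is
  adjoined.\<close>

lemma hbasis_kerpow:
  assumes "hbasis \<epsilon> B" "\<epsilon> * (Re z - \<mu>) < 0" "f \<in> kerpow z k"
  shows "\<exists>B'. hbasis \<epsilon> B' \<and> B \<subseteq> B' \<and> f \<in> span B'"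
  using assms(3)
proof (induction k arbitrary: f)
  case 0
  then show ?case using assms(1) by (auto simp: span_zero)
next
  case (Suc k)
  then obtain B1 where B1: "hbasis \<epsilon> B1" "B \<subseteq> B1" "L f - scale z f \<in> span B1" by auto
  show ?case using hbasis_extend[OF B1(1) _ B1(3) assms(2)] Suc.prems B1(2) by auto
qed

lemma hbasis_exists:
  assumes "finite F" "F \<subseteq> (\<Union>z\<in>{z. \<epsilon> * (Re z - \<mu>) < 0}. gen z)"
  shows "\<exists>B. hbasis \<epsilon> B \<and> F \<subseteq> span B"
  using assms
proof (induction F rule: finite_induct)
  case empty
  have "hbasis \<epsilon> {}" by (simp add: hbasis_def)
  then show ?case by blast
next
  case (insert f F)
  then obtain B where B: "hbasis \<epsilon> B" "F \<subseteq> span B" by auto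
  from insert obtain z k where "\<epsilon> * (Re z - \<mu>) < 0" "f \<in> kerpow z k" by (auto simp: gen_def)
  from hbasis_kerpow[OF B(1) this] obtain B' where B': "hbasis \<epsilon> B'" "B \<subseteq> B'" "f \<in> span B'" by blast
  then show ?case using B span_mono[of B B'] by blast
qed

text \<open>Here h (L x) x = z h x x. The inequality is used in two ways: it excludes Re z = \<mu>,
  and a known sign of \<open>h x x\<close> locates \<open>Re z\<close>.\<close>

lemma eigenvector_definite:
  assumes "x \<in> D" "x \<noteq> 0" "L x = scale z x"
  shows "0 < (Re z - \<mu>) * Re (h x x)"
proof -
  have "L x \<in> D" using assms subspace_scale[OF subspace_D] by simp
  moreover have "Re (h (L x) x) = Re z * Re (h x x)"
    using h_real[OF assms(1)] assms h_scale[of x x z]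
    by (metis Im_complex_of_real mult_zero_right diff_zero times_complex.sel(1))
  ultimately show ?thesis using h_pos[OF assms(1) _ assms(2)] by (simp add: algebra_simps)
qed

end

section \<open>The operator on Fourier coefficients\<close>

lemma infsum_cauchy_schwarz:
  fixes a b :: "'i \<Rightarrow> real"
  assumes "(\<lambda>i. (a i)\<^sup>2) summable_on A" "(\<lambda>i. (b i)\<^sup>2) summable_on A"
    and "\<And>i. i \<in> A \<Longrightarrow> 0 \<le> a i" "\<And>i. i \<in> A \<Longrightarrow> 0 \<le> b i"
  shows "(\<lambda>i. a i * b i) summable_on A"
    and "(\<Sum>\<^sub>\<infinity>i\<in>A. a i * b i) \<le> sqrt (\<Sum>\<^sub>\<infinity>i\<in>A. (a i)\<^sup>2) * sqrt (\<Sum>\<^sub>\<infinity>i\<in>A. (b i)\<^sup>2)"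
proof -
  have fin: "(\<Sum>i\<in>F. a i * b i) \<le> sqrt (\<Sum>\<^sub>\<infinity>i\<in>A. (a i)\<^sup>2) * sqrt (\<Sum>\<^sub>\<infinity>i\<in>A. (b i)\<^sup>2)"
    if "finite F" "F \<subseteq> A" for F
  proof -
    have "(\<Sum>i\<in>F. a i * b i)\<^sup>2 \<le> (\<Sum>i\<in>F. (a i)\<^sup>2) * (\<Sum>i\<in>F. (b i)\<^sup>2)"
      by (rule Cauchy_Schwarz_ineq_sum)
    also have "\<dots> \<le> (\<Sum>\<^sub>\<infinity>i\<in>A. (a i)\<^sup>2) * (\<Sum>\<^sub>\<infinity>i\<in>A. (b i)\<^sup>2)"
      by (intro mult_mono finite_sum_le_infsum assms that sum_nonneg infsum_nonneg) auto
    finally show ?thesis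
      by (metis real_le_rsqrt real_sqrt_mult)
  qed
  show s: "(\<lambda>i. a i * b i) summable_on A"
    by (rule nonneg_bdd_above_summable_on) (use assms fin in \<open>auto intro!: bdd_aboveI2\<close>)
  show "(\<Sum>\<^sub>\<infinity>i\<in>A. a i * b i) \<le> sqrt (\<Sum>\<^sub>\<infinity>i\<in>A. (a i)\<^sup>2) * sqrt (\<Sum>\<^sub>\<infinity>i\<in>A. (b i)\<^sup>2)"
    by (rule infsum_le_finite_sums[OF s fin])
qed

lemma infsum_diff:
  fixes f g :: "'i \<Rightarrow> 'a::{topological_ab_group_add, t2_space}"
  assumes "f summable_on A" "g summable_on A"
  shows "(\<Sum>\<^sub>\<infinity>i\<in>A. f i - g i) = infsum f A - infsum g A"
  using infsum_add[OF assms(1) summable_on_uminus[THEN iffD2, OF assms(2)]] by (simp add: infsum_uminus)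

lemma summable_on_int_shift:
  fixes f :: "int \<Rightarrow> 'a::{topological_comm_monoid_add, t2_space}"
  shows "(\<lambda>l. f (k - l)) summable_on UNIV \<longleftrightarrow> f summable_on UNIV"
    and "(\<lambda>l. f (l - k)) summable_on UNIV \<longleftrightarrow> f summable_on UNIV"
    and "(\<Sum>\<^sub>\<infinity>l. f (k - l)) = (\<Sum>\<^sub>\<infinity>l. f l)"
    and "(\<Sum>\<^sub>\<infinity>l. f (l - k)) = (\<Sum>\<^sub>\<infinity>l. f l)"
proof -
  have 1: "bij_betw (\<lambda>l. k - l) UNIV (UNIV::int set)"
    by (rule bij_betwI[of _ _ _ "\<lambda>l. k - l"]) auto
  have 2: "bij_betw (\<lambda>l. l - k) UNIV (UNIV::int set)"
    by (rule bij_betwI[of _ _ _ "\<lambda>l. l + k"]) auto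
  show "(\<lambda>l. f (k - l)) summable_on UNIV \<longleftrightarrow> f summable_on UNIV"
    "(\<Sum>\<^sub>\<infinity>l. f (k - l)) = (\<Sum>\<^sub>\<infinity>l. f l)"
    using summable_on_reindex_bij_betw[OF 1, of f] infsum_reindex_bij_betw[OF 1, of f] by auto
  show "(\<lambda>l. f (l - k)) summable_on UNIV \<longleftrightarrow> f summable_on UNIV"
    "(\<Sum>\<^sub>\<infinity>l. f (l - k)) = (\<Sum>\<^sub>\<infinity>l. f l)"
    using summable_on_reindex_bij_betw[OF 2, of f] infsum_reindex_bij_betw[OF 2, of f] by auto
qed

text \<open>With \<open>1 / 0 = 0\<close> the summand at \<open>0\<close> vanishes.\<close>

lemma infsum_inverse_squares_int:
  shows "(\<lambda>m::int. 1 / (of_int m)\<^sup>2 :: real) summable_on UNIV"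
    and "(\<Sum>\<^sub>\<infinity>m::int. 1 / (of_int m)\<^sup>2 :: real) \<le> 4"
proof -
  \<comment> \<open>The correction term makes the induction telescope, by 2 / M^2 \<le> 2 / (M - 1)
    - 2 / M; it starts with the range from - 1 to 1, where both sides are 2.\<close>
  have sym: "(\<Sum>m=-int (Suc M)..int (Suc M). 1 / (of_int m)\<^sup>2 :: real) \<le> 4 - 2 / real (Suc M)" for M
  proof (induction M)
    case 0
    have "{-1..1::int} = {-1,0,1}" by auto
    then show ?case by simp
  next
    case (Suc M)
    have e: "{-int (Suc (Suc M))..int (Suc (Suc M))} =
        insert (-int (Suc (Suc M))) (insert (int (Suc (Suc M))) {-int (Suc M)..int (Suc M)})" by auto
    have "(\<Sum>m=-int (Suc (Suc M))..int (Suc (Suc M)). 1 / (of_int m)\<^sup>2 :: real) =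
        2 / (real (Suc (Suc M)))\<^sup>2 + (\<Sum>m=-int (Suc M)..int (Suc M). 1 / (of_int m)\<^sup>2)"
      unfolding e by (subst sum.insert; simp)+ (simp add: power2_eq_square algebra_simps)
    also have "\<dots> \<le> 2 / (real (Suc (Suc M)))\<^sup>2 + (4 - 2 / real (Suc M))" using Suc by simp
    also have "2 / (real (Suc (Suc M)))\<^sup>2 \<le> 2 / real (Suc M) - 2 / real (Suc (Suc M))"
      by (simp add: field_simps power2_eq_square) (auto intro!: divide_left_mono mult_pos_pos add_pos_nonneg)
    finally show ?case by simp
  qed
  have fin: "(\<Sum>m\<in>F. 1 / (of_int m)\<^sup>2 :: real) \<le> 4" if "finite F" for F :: "int set"
  proof -
    obtain b where b: "\<And>x. x \<in> F \<Longrightarrow> \<bar>x\<bar> \<le> b"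
    proof
      show "\<bar>x\<bar> \<le> Max (abs ` F)" if "x \<in> F" for x using that \<open>finite F\<close> by simp
    qed
    have "F \<subseteq> {-int (Suc (nat b))..int (Suc (nat b))}" using b by force
    then have "(\<Sum>m\<in>F. 1 / (of_int m)\<^sup>2 :: real) \<le> (\<Sum>m=-int (Suc (nat b))..int (Suc (nat b)). 1 / (of_int m)\<^sup>2)"
      by (intro sum_mono2) auto
    also have "\<dots> \<le> 4 - 2 / real (Suc (nat b))" by (rule sym)
    also have "\<dots> \<le> 4" by simp
    finally show ?thesis .
  qed
  show s: "(\<lambda>m::int. 1 / (of_int m)\<^sup>2 :: real) summable_on UNIV"
    by (rule nonneg_bdd_above_summable_on) (use fin in \<open>auto intro!: bdd_aboveI2\<close>)
  show "(\<Sum>\<^sub>\<infinity>m::int. 1 / (of_int m)\<^sup>2 :: real) \<le> 4"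
    by (rule infsum_le_finite_sums[OF s fin])
qed

section \<open>Inverse squares and quadratically decaying sequences\<close>

definition isq :: "int \<Rightarrow> real" where
  "isq m = 1 / (of_int m)\<^sup>2 + (if m = 0 then 1 else 0)"

lemma isq_nonneg: "0 \<le> isq m"
  by (simp add: isq_def)

lemma isq_has_sum: "(isq has_sum ((\<Sum>\<^sub>\<infinity>m::int. 1 / (of_int m)\<^sup>2) + 1)) UNIV"
proof -
  have "((\<lambda>m::int. if m = 0 then 1 else 0 :: real) has_sum 1) UNIV"
    using has_sum_cong_neutral[of UNIV "{0::int}" "\<lambda>m::int. if m = 0 then 1 else 0 :: real" "\<lambda>_. 1" 1]
      has_sum_finite[of "{0::int}" "\<lambda>_. 1::real"] by auto
  then show ?thesis
    unfolding isq_def using infsum_inverse_squares_int(1) by (intro has_sum_add has_sum_infsum)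
qed

lemma isq_summable: "isq summable_on UNIV" and infsum_isq: "(\<Sum>\<^sub>\<infinity>m. isq m) \<le> 5"
proof -
  show "isq summable_on UNIV" using isq_has_sum by (auto simp: summable_on_def)
  show "(\<Sum>\<^sub>\<infinity>m. isq m) \<le> 5"
    using infsumI[OF isq_has_sum] infsum_inverse_squares_int(2) by simp
qed

lemma le_isq: "1 / (1 + (of_int k)\<^sup>2) \<le> isq k"
  by (cases "k = 0") (auto simp: isq_def add_pos_nonneg intro!: divide_left_mono mult_pos_pos)

text \<open>The domain of \<open>L\<close> on the coefficient side. A supremum bound on k^2 f k
  replaces the square-summability of the Sobolev class: it follows at once when
  \<open>hill f\<close> and \<open>conv f\<close> are bounded, it makes the Fourier series
  absolutely convergent, and it leads to the same kernels of the powers of L - z.\<close>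

definition decay :: "(int \<Rightarrow> complex) set" where
  "decay = {f. \<exists>C. \<forall>k. (1 + (of_int k)\<^sup>2) * cmod (f k) \<le> C}"

lemma decay_bound: "f \<in> decay \<Longrightarrow> \<exists>C. \<forall>k. (1 + (of_int k)\<^sup>2) * cmod (f k) \<le> C"
  by (simp add: decay_def)

lemma decay_bound_isq: "f \<in> decay \<Longrightarrow> \<exists>C\<ge>0. \<forall>k. cmod (f k) \<le> C * isq k"
proof -
  assume "f \<in> decay"
  then obtain C where C: "\<And>k. (1 + (of_int k)\<^sup>2) * cmod (f k) \<le> C" by (auto simp: decay_def)
  have "cmod (f 0) \<le> C" using C[of 0] by simp
  then have C0: "0 \<le> C" using norm_ge_zero[of "f 0"] by linarith
  have pos: "0 < 1 + (of_int k :: real)\<^sup>2" for k :: int by (simp add: add_pos_nonneg)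
  have "cmod (f k) \<le> C * (1 / (1 + (of_int k)\<^sup>2))" for k
    using C[of k] pos[of k] by (simp add: field_simps)
  then have "cmod (f k) \<le> C * isq k" for k
    using mult_left_mono[OF le_isq C0] order_trans by blast
  then show ?thesis using C0 by blast
qed

lemma decay_bounded: "f \<in> decay \<Longrightarrow> \<exists>B. \<forall>k. cmod (f k) \<le> B"
proof -
  assume "f \<in> decay"
  then obtain C where C: "\<And>k. (1 + (of_int k)\<^sup>2) * cmod (f k) \<le> C" by (auto simp: decay_def)
  have "cmod (f k) \<le> C" for k
  proof -
    have "1 * cmod (f k) \<le> (1 + (of_int k)\<^sup>2) * cmod (f k)" by (intro mult_right_mono) auto
    then show ?thesis using C[of k] by simp
  qed
  then show ?thesis by blast
qed

lemma decay_abs_summable: "f \<in> decay \<Longrightarrow> (\<lambda>k. cmod (f k)) summable_on UNIV"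
proof -
  assume "f \<in> decay"
  then obtain C where "\<And>k. cmod (f k) \<le> C * isq k" using decay_bound_isq by blast
  then show ?thesis
    by (intro summable_on_comparison_test[OF summable_on_cmult_right[OF isq_summable, of C]]) auto
qed

lemma decay_mult_abs_summable:
  assumes "f \<in> decay" "\<And>k. cmod (x k) \<le> B"
  shows "(\<lambda>k. cmod (x k * f k)) summable_on UNIV"
proof (rule summable_on_comparison_test)
  show "(\<lambda>k. B * cmod (f k)) summable_on UNIV"
    by (rule summable_on_cmult_right[OF decay_abs_summable[OF assms(1)]])
qed (auto simp: norm_mult intro!: mult_right_mono assms)

lemma decay_l2: "f \<in> decay \<Longrightarrow> (\<lambda>k. (cmod (f k))\<^sup>2) summable_on UNIV"
proof -
  assume f: "f \<in> decay"
  then obtain C where "\<And>k. cmod (f k) \<le> C" using decay_bounded by blast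
  from decay_mult_abs_summable[OF f this] show ?thesis by (simp add: norm_mult power2_eq_square)
qed

definition sscale :: "complex \<Rightarrow> (int \<Rightarrow> complex) \<Rightarrow> int \<Rightarrow> complex" where
  "sscale c f = (\<lambda>k. c * f k)"

interpretation seq: vector_space sscale
  by unfold_locales (auto simp: sscale_def fun_eq_iff algebra_simps)

lemma subspace_decay: "seq.subspace decay"
proof (rule seq.subspaceI)
  show "0 \<in> decay" by (auto simp: decay_def)
next
  fix x y assume xy: "x \<in> decay" "y \<in> decay"
  obtain C where C: "\<And>k. (1 + (of_int k)\<^sup>2) * cmod (x k) \<le> C" using decay_bound[OF xy(1)] by blast
  obtain C' where C': "\<And>k. (1 + (of_int k)\<^sup>2) * cmod (y k) \<le> C'" using decay_bound[OF xy(2)] by blast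
  have "(1 + (of_int k)\<^sup>2) * cmod ((x + y) k) \<le> C + C'" for k
  proof -
    have "(1 + (of_int k)\<^sup>2) * cmod ((x + y) k) \<le> (1 + (of_int k)\<^sup>2) * (cmod (x k) + cmod (y k))"
      by (intro mult_left_mono) (auto simp: norm_triangle_ineq)
    then show ?thesis using C[of k] C'[of k] by (simp add: distrib_left)
  qed
  then show "x + y \<in> decay" by (auto simp: decay_def)
next
  fix c x assume "x \<in> decay"
  then obtain C where C: "\<And>k. (1 + (of_int k)\<^sup>2) * cmod (x k) \<le> C" using decay_bound by blast
  have "(1 + (of_int k)\<^sup>2) * cmod (sscale c x k) \<le> cmod c * C" for k
    using mult_left_mono[OF C[of k] norm_ge_zero[of c]] by (simp add: sscale_def norm_mult mult_ac)
  then show "sscale c x \<in> decay" by (auto simp: decay_def)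
qed

section \<open>Convolution with a square-summable potential\<close>

locale potential =
  fixes v :: "int \<Rightarrow> complex"
  assumes v_l2: "(\<lambda>m. (cmod (v m))\<^sup>2) summable_on UNIV"
begin

definition nv :: real where "nv = sqrt (\<Sum>\<^sub>\<infinity>m. (cmod (v m))\<^sup>2)"

definition conv :: "(int \<Rightarrow> complex) \<Rightarrow> int \<Rightarrow> complex" where
  "conv f k = (\<Sum>\<^sub>\<infinity>l. v (k - l) * f l)"

definition hill :: "(int \<Rightarrow> complex) \<Rightarrow> int \<Rightarrow> complex" where
  "hill f k = of_real (pi\<^sup>2 * (of_int k)\<^sup>2) * f k + conv f k"

lemma nv_nonneg: "0 \<le> nv"
  by (simp add: nv_def infsum_nonneg)

lemma nv_squared: "nv\<^sup>2 = (\<Sum>\<^sub>\<infinity>m. (cmod (v m))\<^sup>2)"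
  by (simp add: nv_def infsum_nonneg)

lemma v_shift: "(\<lambda>l. (cmod (v (k - l)))\<^sup>2) summable_on UNIV"
    "(\<Sum>\<^sub>\<infinity>l. (cmod (v (k - l)))\<^sup>2) = nv\<^sup>2"
    "(\<lambda>l. (cmod (v (l - k)))\<^sup>2) summable_on UNIV"
    "(\<Sum>\<^sub>\<infinity>l. (cmod (v (l - k)))\<^sup>2) = nv\<^sup>2"
  using summable_on_int_shift[of "\<lambda>l. (cmod (v l))\<^sup>2" k] v_l2 by (auto simp: nv_squared)

lemma v_bounded: "cmod (v m) \<le> nv"
proof -
  have "(\<Sum>m\<in>{m}. (cmod (v m))\<^sup>2) \<le> nv\<^sup>2"
    unfolding nv_squared by (intro finite_sum_le_infsum v_l2) auto
  then show ?thesis using nv_nonneg by (auto intro: power2_le_imp_le)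
qed

lemma conv_summable:
  assumes "(\<lambda>l. (cmod (f l))\<^sup>2) summable_on UNIV"
  shows "(\<lambda>l. cmod (v (k - l) * f l)) summable_on UNIV"
    and "(\<lambda>l. v (k - l) * f l) summable_on UNIV"
    and "cmod (conv f k) \<le> nv * sqrt (\<Sum>\<^sub>\<infinity>l. (cmod (f l))\<^sup>2)"
    and "cmod (conv f k) \<le> (\<Sum>\<^sub>\<infinity>l. cmod (v (k - l)) * cmod (f l))"
proof -
  note cs = infsum_cauchy_schwarz[OF v_shift(1)[of k] assms]
  show s: "(\<lambda>l. cmod (v (k - l) * f l)) summable_on UNIV" using cs(1) by (simp add: norm_mult)
  then show "(\<lambda>l. v (k - l) * f l) summable_on UNIV" by (rule abs_summable_summable)
  show b: "cmod (conv f k) \<le> (\<Sum>\<^sub>\<infinity>l. cmod (v (k - l)) * cmod (f l))"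
    unfolding conv_def using norm_infsum_bound[OF s] by (simp add: norm_mult)
  also have "\<dots> \<le> nv * sqrt (\<Sum>\<^sub>\<infinity>l. (cmod (f l))\<^sup>2)"
    using cs(2) v_shift(2)[of k] nv_nonneg by simp
  finally show "cmod (conv f k) \<le> nv * sqrt (\<Sum>\<^sub>\<infinity>l. (cmod (f l))\<^sup>2)" .
qed

lemma conv_add:
  assumes "f \<in> decay" "g \<in> decay" shows "conv (f + g) k = conv f k + conv g k"
  unfolding conv_def using infsum_add[OF conv_summable(2)[OF decay_l2[OF assms(1)]] conv_summable(2)[OF decay_l2[OF assms(2)]]]
  by (simp add: distrib_left)

lemma conv_scale: "conv (sscale c f) k = c * conv f k"
  unfolding conv_def sscale_def by (simp add: infsum_cmult_right'[symmetric] mult_ac)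

sublocale hill: partial_operator sscale decay hill
proof
  show "seq.subspace decay" by (rule subspace_decay)
  show "hill (x + y) = hill x + hill y" if "x \<in> decay" "y \<in> decay" for x y
    using that by (auto simp: hill_def conv_add fun_eq_iff algebra_simps)
  show "hill (sscale c x) = sscale c (hill x)" for c x
    by (auto simp: hill_def conv_scale fun_eq_iff) (simp add: sscale_def hill_def algebra_simps)
qed

lemma conv_bounded: "f \<in> decay \<Longrightarrow> \<exists>B. \<forall>k. cmod (conv f k) \<le> B"
  using conv_summable(3)[OF decay_l2] by blast

text \<open>The image of a decaying sequence need not decay; boundedness is what pairing it with a
  decaying one in \<open>hform\<close> requires.\<close>

lemma hill_bounded: "f \<in> decay \<Longrightarrow> \<exists>B. \<forall>k. cmod (hill f k) \<le> B"
proof -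
  assume f: "f \<in> decay"
  obtain B where B: "\<And>k. cmod (conv f k) \<le> B" using conv_bounded[OF f] by blast
  obtain C where C: "\<And>k. (1 + (of_int k)\<^sup>2) * cmod (f k) \<le> C" using decay_bound[OF f] by blast
  have "cmod (hill f k) \<le> pi\<^sup>2 * C + B" for k
  proof -
    have "(of_int k)\<^sup>2 * cmod (f k) \<le> C" using C[of k] norm_ge_zero[of "f k"] by (simp add: distrib_right del: norm_ge_zero)
    then have "pi\<^sup>2 * ((of_int k)\<^sup>2 * cmod (f k)) \<le> pi\<^sup>2 * C" by (intro mult_left_mono) auto
    moreover have "cmod (of_real (pi\<^sup>2 * (of_int k)\<^sup>2) * f k) = pi\<^sup>2 * ((of_int k)\<^sup>2 * cmod (f k))"
      by (simp only: norm_mult norm_of_real) (simp add: norm_mult power_mult_distrib mult.assoc abs_mult)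
    ultimately show ?thesis
      unfolding hill_def using B[of k] norm_triangle_ineq[of "of_real (pi\<^sup>2 * (of_int k)\<^sup>2) * f k" "conv f k"]
      by linarith
  qed
  then show ?thesis by blast
qed

end

section \<open>Distance of the free levels from the threshold, and the form bound\<close>

definition nu :: "nat \<Rightarrow> real" where "nu n = real n + 1/2"

definition mu :: "nat \<Rightarrow> real" where "mu n = pi\<^sup>2 * (nu n)\<^sup>2"

definition dst :: "nat \<Rightarrow> int \<Rightarrow> real" where "dst n k = \<bar>pi\<^sup>2 * (of_int k)\<^sup>2 - mu n\<bar>"

lemma pi_squared_ge: "pi\<^sup>2 \<ge> 9"
  using power_mono[of 3 pi 2] pi_gt3 by simp

text \<open>\<bar>m - 1/2\<bar> \<ge> \<bar>m\<bar> / 2 for m \<noteq> 0; at 0 both sides equal 4,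
  thanks to the value 1 of \<open>isq\<close> there.\<close>

lemma inverse_half_shift: "1 / (of_int m - 1/2)\<^sup>2 \<le> 4 * isq m"
proof (cases "m = 0")
  case False
  have "(of_int m)\<^sup>2 \<le> 4 * (of_int m - 1/2 :: real)\<^sup>2"
  proof (cases "m \<ge> 1")
    case True
    then have "of_int m \<ge> (1::real)" by simp
    then show ?thesis using power_mono[of "of_int m" "2 * (of_int m - 1/2) :: real" 2] by (simp add: power2_eq_square algebra_simps)
  next
    case 2: False
    then have "of_int m \<le> (-1::real)" using False by linarith
    then show ?thesis using power_mono[of "- of_int m" "2 * (1/2 - of_int m) :: real" 2] by (simp add: power2_eq_square algebra_simps)
  qed
  moreover have "(of_int m - 1/2 :: real) \<noteq> 0"
  proof
    assume "(of_int m - 1/2 :: real) = 0"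
    then have "of_int (2 * m) = (1::real)" by simp
    then have "2 * m = 1" by (metis of_int_1 of_int_eq_iff)
    then show False by presburger
  qed
  ultimately show ?thesis using False by (simp add: isq_def field_simps)
qed (simp add: isq_def power2_eq_square)

lemma nu_ne_int: "nu n \<noteq> of_int k"
proof
  assume "nu n = of_int k"
  then have "of_int (2 * int n + 1) = (of_int (2 * k) :: real)" by (simp add: nu_def)
  then have "2 * int n + 1 = 2 * k" by (metis of_int_eq_iff)
  then show False by presburger
qed

lemma dst_factor: "dst n k = pi\<^sup>2 * (\<bar>\<bar>of_int k\<bar> - nu n\<bar> * (\<bar>of_int k\<bar> + nu n))"
proof -
  have "nu n > 0" by (simp add: nu_def)
  then have "\<bar>\<bar>of_int k\<bar> - nu n\<bar> * (\<bar>of_int k\<bar> + nu n) = \<bar>(\<bar>of_int k\<bar> - nu n) * (\<bar>of_int k\<bar> + nu n)\<bar>"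
    by (simp add: abs_mult)
  also have "(\<bar>of_int k\<bar> - nu n) * (\<bar>of_int k\<bar> + nu n) = (of_int k)\<^sup>2 - (nu n)\<^sup>2"
    by (simp add: algebra_simps power2_eq_square)
  finally show ?thesis by (simp add: dst_def mu_def right_diff_distrib[symmetric] abs_mult)
qed

lemma dst_pos: "0 < dst n k"
proof -
  have "nu n > 0" by (simp add: nu_def)
  then show ?thesis unfolding dst_factor using nu_ne_int[of n "\<bar>k\<bar>"] by simp
qed

text \<open>In \<open>dst_factor\<close>, pi^2 \<ge> 9 and \<bar>k\<bar> + nu n \<ge> nu n. The
  remaining \<bar>k\<bar> - nu n is, up to sign, m - 1/2 with m = k - n for k \<ge> 0 and m = k + n
  + 1 for k < 0, hence the two terms.\<close>

lemma inverse_dst_squared: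
  "1 / (dst n k)\<^sup>2 \<le> 4 / (81 * (nu n)\<^sup>2) * (isq (k - int n) + isq (k + int n + 1))"
proof -
  have nu: "nu n > 0" by (simp add: nu_def)
  let ?a = "\<bar>of_int k\<bar> - nu n"
  have a0: "?a \<noteq> 0" using nu_ne_int[of n "\<bar>k\<bar>"] by simp
  have "9 * (\<bar>?a\<bar> * nu n) \<le> dst n k"
    unfolding dst_factor using nu by (intro mult_mono pi_squared_ge mult_left_mono) auto
  then have "(9 * (\<bar>?a\<bar> * nu n))\<^sup>2 \<le> (dst n k)\<^sup>2" using nu by (intro power_mono) auto
  then have "1 / (dst n k)\<^sup>2 \<le> 1 / (9 * (\<bar>?a\<bar> * nu n))\<^sup>2"
    using nu a0 dst_pos[of n k] by (intro divide_left_mono mult_pos_pos zero_less_power) auto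
  also have "\<dots> = 1 / (81 * (nu n)\<^sup>2) * (1 / ?a\<^sup>2)" by (simp add: power_mult_distrib)
  also have "1 / ?a\<^sup>2 \<le> 4 * (isq (k - int n) + isq (k + int n + 1))"
  proof (cases "k \<ge> 0")
    case True
    then have "?a = of_int (k - int n) - 1/2" by (simp add: nu_def)
    then show ?thesis using inverse_half_shift[of "k - int n"] isq_nonneg[of "k + int n + 1"] by simp
  next
    case False
    then have "?a = - (of_int (k + int n + 1) - 1/2)" by (simp add: nu_def)
    then have "?a\<^sup>2 = (of_int (k + int n + 1) - 1/2)\<^sup>2" by (simp only: power2_minus)
    then show ?thesis using inverse_half_shift[of "k + int n + 1"] isq_nonneg[of "k - int n"] by simp
  qed
  finally show ?thesis using nu by (simp add: mult_left_mono divide_right_mono)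
qed

lemma isq_pair:
  shows "(\<lambda>k. isq (k - a) + isq (k + b)) summable_on UNIV"
    and "(\<Sum>\<^sub>\<infinity>k. isq (k - a) + isq (k + b)) \<le> 10"
proof -
  have 1: "(\<lambda>k. isq (k - a)) summable_on UNIV" "(\<Sum>\<^sub>\<infinity>k. isq (k - a)) \<le> 5" for a
    using summable_on_int_shift[of isq a] isq_summable infsum_isq by auto
  show "(\<lambda>k. isq (k - a) + isq (k + b)) summable_on UNIV"
    using summable_on_add[OF 1(1)[of a] 1(1)[of "-b"]] by simp
  show "(\<Sum>\<^sub>\<infinity>k. isq (k - a) + isq (k + b)) \<le> 10"
    using infsum_add[OF 1(1)[of a] 1(1)[of "-b"]] 1(2)[of a] 1(2)[of "-b"] by simp
qed

lemma infsum_inverse_dst: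
  shows "(\<lambda>k. 1 / (dst n k)\<^sup>2) summable_on UNIV"
    and "(\<Sum>\<^sub>\<infinity>k. 1 / (dst n k)\<^sup>2) \<le> 40 / (81 * (nu n)\<^sup>2)"
proof -
  let ?c = "4 / (81 * (nu n)\<^sup>2)" and ?g = "\<lambda>k. isq (k - int n) + isq (k + (int n + 1))"
  have g: "(\<lambda>k. ?c * ?g k) summable_on UNIV"
    by (rule summable_on_cmult_right[OF isq_pair(1)])
  show s: "(\<lambda>k. 1 / (dst n k)\<^sup>2) summable_on UNIV"
    by (rule summable_on_comparison_test[OF g]) (use inverse_dst_squared in \<open>auto simp: add.assoc\<close>)
  have "(\<Sum>\<^sub>\<infinity>k. 1 / (dst n k)\<^sup>2) \<le> (\<Sum>\<^sub>\<infinity>k. ?c * ?g k)"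
    by (rule infsum_mono[OF s g]) (use inverse_dst_squared in \<open>auto simp: add.assoc\<close>)
  also have "\<dots> = ?c * (\<Sum>\<^sub>\<infinity>k. ?g k)" by (rule infsum_cmult_right')
  also have "\<dots> \<le> ?c * 10" by (intro mult_left_mono isq_pair(2)) simp
  finally show "(\<Sum>\<^sub>\<infinity>k. 1 / (dst n k)\<^sup>2) \<le> 40 / (81 * (nu n)\<^sup>2)" by simp
qed

definition theta :: "nat \<Rightarrow> real" where "theta n = sqrt (\<Sum>\<^sub>\<infinity>k. 1 / (dst n k)\<^sup>2)"

context potential
begin

text \<open>nv \<le> (n + 1) / 4 \<le> nu n / 2, so the square of the product is at most (1/4)
  (40/81) = 10/81.\<close>

lemma theta_less_1:
  assumes "nv \<le> (real n + 1) / 4"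
  shows "nv * theta n < 1"
proof -
  have nu: "nu n > 0" by (simp add: nu_def)
  have "nv \<le> nu n / 2" using assms by (simp add: nu_def)
  then have "nv\<^sup>2 \<le> (nu n / 2)\<^sup>2" using nv_nonneg by (intro power_mono)
  moreover have "(theta n)\<^sup>2 \<le> 40 / (81 * (nu n)\<^sup>2)"
    using infsum_inverse_dst(2)[of n] by (simp add: theta_def infsum_nonneg)
  ultimately have "nv\<^sup>2 * (theta n)\<^sup>2 \<le> (nu n / 2)\<^sup>2 * (40 / (81 * (nu n)\<^sup>2))" by (intro mult_mono) auto
  also have "\<dots> = 10 / 81" using nu by (simp add: field_simps power2_eq_square)
  finally have "(nv * theta n)\<^sup>2 < 1\<^sup>2" by (simp add: power_mult_distrib)
  then show ?thesis by (rule power_less_imp_less_base) simp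
qed

text \<open>Multiplication by a merely square-integrable \<open>q\<close> may be unbounded on l2, so
  it is compared with the free form. With d = \<open>dst n\<close>, the kernel v (k - l) / sqrt (d k
  d l) has Hilbert-Schmidt norm at most \<open>nv * theta n\<close>: the arithmetic-geometric mean
  splits 1 / (d k d l) into one part summed along rows and one summed along columns.\<close>

lemma form_bound_finite:
  fixes x :: "int \<Rightarrow> real"
  assumes "finite A" "\<And>k. 0 \<le> x k"
  shows "(\<Sum>k\<in>A. \<Sum>l\<in>A. cmod (v (k - l)) * x k * x l) \<le> nv * theta n * (\<Sum>k\<in>A. dst n k * (x k)\<^sup>2)"
proof -
  let ?d = "dst n" and ?X = "\<Sum>k\<in>A. dst n k * (x k)\<^sup>2"
  define a where "a = (\<lambda>(k,l). cmod (v (k - l)) / sqrt (?d k * ?d l))"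
  define b where "b = (\<lambda>(k,l). sqrt (?d k * ?d l) * (x k * x l))"
  have d: "0 < ?d k" for k by (rule dst_pos)
  have X: "0 \<le> ?X" using d by (auto intro!: sum_nonneg mult_nonneg_nonneg less_imp_le[OF d])
  have row: "(\<Sum>k\<in>A. \<Sum>l\<in>A. (cmod (v (k - l)))\<^sup>2 * (1 / (?d k)\<^sup>2)) \<le> nv\<^sup>2 * (theta n)\<^sup>2"
  proof -
    have "(\<Sum>l\<in>A. (cmod (v (k - l)))\<^sup>2) \<le> nv\<^sup>2" for k
      using finite_sum_le_infsum[OF v_shift(1)[of k] assms(1)] v_shift(2)[of k] by auto
    then have "(\<Sum>k\<in>A. (\<Sum>l\<in>A. (cmod (v (k - l)))\<^sup>2) * (1 / (?d k)\<^sup>2)) \<le> (\<Sum>k\<in>A. nv\<^sup>2 * (1 / (?d k)\<^sup>2))"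
      by (intro sum_mono mult_right_mono) auto
    also have "\<dots> = nv\<^sup>2 * (\<Sum>k\<in>A. 1 / (?d k)\<^sup>2)" by (simp add: sum_distrib_left)
    also have "\<dots> \<le> nv\<^sup>2 * (theta n)\<^sup>2"
      using finite_sum_le_infsum[OF infsum_inverse_dst(1)[of n] assms(1)]
      by (intro mult_left_mono) (auto simp: theta_def infsum_nonneg)
    finally show ?thesis by (simp only: sum_distrib_right)
  qed
  have col: "(\<Sum>k\<in>A. \<Sum>l\<in>A. (cmod (v (k - l)))\<^sup>2 * (1 / (?d l)\<^sup>2)) \<le> nv\<^sup>2 * (theta n)\<^sup>2"
  proof -
    have "(\<Sum>k\<in>A. (cmod (v (k - l)))\<^sup>2) \<le> nv\<^sup>2" for l
      using finite_sum_le_infsum[OF v_shift(3)[of l] assms(1)] v_shift(4)[of l] by auto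
    then have "(\<Sum>l\<in>A. (\<Sum>k\<in>A. (cmod (v (k - l)))\<^sup>2) * (1 / (?d l)\<^sup>2)) \<le> (\<Sum>l\<in>A. nv\<^sup>2 * (1 / (?d l)\<^sup>2))"
      by (intro sum_mono mult_right_mono) auto
    also have "\<dots> = nv\<^sup>2 * (\<Sum>k\<in>A. 1 / (?d k)\<^sup>2)" by (simp add: sum_distrib_left)
    also have "\<dots> \<le> nv\<^sup>2 * (theta n)\<^sup>2"
      using finite_sum_le_infsum[OF infsum_inverse_dst(1)[of n] assms(1)]
      by (intro mult_left_mono) (auto simp: theta_def infsum_nonneg)
    finally have "(\<Sum>l\<in>A. \<Sum>k\<in>A. (cmod (v (k - l)))\<^sup>2 * (1 / (?d l)\<^sup>2)) \<le> nv\<^sup>2 * (theta n)\<^sup>2"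
      by (simp only: sum_distrib_right)
    then show ?thesis by (subst sum.swap)
  qed
  have a2: "(\<Sum>p\<in>A\<times>A. (a p)\<^sup>2) \<le> (nv * theta n)\<^sup>2"
  proof -
    have amgm: "1 / (?d k * ?d l) \<le> (1 / (?d k)\<^sup>2 + 1 / (?d l)\<^sup>2) / 2" for k l
      using sum_squares_bound[of "1 / ?d k" "1 / ?d l"] by (simp add: power_divide)
    have "(\<Sum>p\<in>A\<times>A. (a p)\<^sup>2) = (\<Sum>k\<in>A. \<Sum>l\<in>A. (cmod (v (k - l)))\<^sup>2 * (1 / (?d k * ?d l)))"
      unfolding sum.cartesian_product' using d by (simp add: a_def power_divide less_imp_le)
    also have "\<dots> \<le> (\<Sum>k\<in>A. \<Sum>l\<in>A. (cmod (v (k - l)))\<^sup>2 * ((1 / (?d k)\<^sup>2 + 1 / (?d l)\<^sup>2) / 2))"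
      by (intro sum_mono mult_left_mono amgm) auto
    also have "\<dots> = ((\<Sum>k\<in>A. \<Sum>l\<in>A. (cmod (v (k - l)))\<^sup>2 * (1 / (?d k)\<^sup>2))
        + (\<Sum>k\<in>A. \<Sum>l\<in>A. (cmod (v (k - l)))\<^sup>2 * (1 / (?d l)\<^sup>2))) / 2"
      by (simp only: sum.distrib[symmetric] sum_divide_distrib distrib_left add_divide_distrib times_divide_eq_right)
    also have "\<dots> \<le> (nv * theta n)\<^sup>2" using row col by (simp add: power_mult_distrib)
    finally show ?thesis .
  qed
  have b2: "(\<Sum>p\<in>A\<times>A. (b p)\<^sup>2) = ?X\<^sup>2"
  proof -
    have "(\<Sum>p\<in>A\<times>A. (b p)\<^sup>2) = (\<Sum>k\<in>A. \<Sum>l\<in>A. (?d k * (x k)\<^sup>2) * (?d l * (x l)\<^sup>2))"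
      unfolding sum.cartesian_product' using d by (simp add: b_def power_mult_distrib less_imp_le mult_ac)
    then show ?thesis by (simp add: power2_eq_square sum_product)
  qed
  have "(\<Sum>k\<in>A. \<Sum>l\<in>A. cmod (v (k - l)) * x k * x l) = (\<Sum>p\<in>A\<times>A. a p * b p)"
  proof -
    have "a (k,l) * b (k,l) = cmod (v (k - l)) * x k * x l" for k l
      using d[of k] d[of l] by (simp add: a_def b_def)
    then show ?thesis unfolding sum.cartesian_product' by simp
  qed
  moreover have "(\<Sum>p\<in>A\<times>A. a p * b p)\<^sup>2 \<le> (nv * theta n)\<^sup>2 * ?X\<^sup>2"
    by (rule order_trans[OF Cauchy_Schwarz_ineq_sum]) (use a2 b2 in \<open>simp add: mult_right_mono\<close>)
  moreover have "0 \<le> nv * theta n * ?X" using X nv_nonneg by (simp add: theta_def infsum_nonneg)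
  ultimately show ?thesis
    by (simp only: power_mult_distrib[symmetric]) (rule power2_le_imp_le)
qed

text \<open>Every finite set of index pairs lies in a square A \<times> A, so the finite bound
  controls the double series, which therefore converges absolutely.\<close>

lemma form_bound:
  assumes "f \<in> decay"
  shows "(\<lambda>k. dst n k * (cmod (f k))\<^sup>2) summable_on UNIV"
    and "(\<lambda>k. cmod (conv f k * cnj (f k))) summable_on UNIV"
    and "(\<Sum>\<^sub>\<infinity>k. cmod (conv f k * cnj (f k))) \<le> nv * theta n * (\<Sum>\<^sub>\<infinity>k. dst n k * (cmod (f k))\<^sup>2)"
proof -
  obtain C where C: "\<And>k. (1 + (of_int k)\<^sup>2) * cmod (f k) \<le> C" using decay_bound[OF assms] by blast
  have nu: "nu n > 0" by (simp add: nu_def)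
  have d: "0 < dst n k" for k by (rule dst_pos)
  show s: "(\<lambda>k. dst n k * (cmod (f k))\<^sup>2) summable_on UNIV"
  proof (rule summable_on_comparison_test)
    show "(\<lambda>k. (pi\<^sup>2 + mu n) * C * cmod (f k)) summable_on UNIV"
      by (rule summable_on_cmult_right[OF decay_abs_summable[OF assms]])
    fix k :: int
    have "dst n k \<le> pi\<^sup>2 * (of_int k)\<^sup>2 + mu n" by (simp add: dst_def abs_le_iff mu_def)
    also have "\<dots> \<le> (pi\<^sup>2 + mu n) * (1 + (of_int k)\<^sup>2)" by (simp add: algebra_simps mu_def)
    finally have "dst n k * cmod (f k) \<le> (pi\<^sup>2 + mu n) * ((1 + (of_int k)\<^sup>2) * cmod (f k))"
      by (metis mult.assoc mult_right_mono norm_ge_zero)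
    also have "\<dots> \<le> (pi\<^sup>2 + mu n) * C" by (intro mult_left_mono C) (simp add: mu_def)
    finally have "dst n k * cmod (f k) * cmod (f k) \<le> (pi\<^sup>2 + mu n) * C * cmod (f k)"
      by (rule mult_right_mono) simp
    then show "dst n k * (cmod (f k))\<^sup>2 \<le> (pi\<^sup>2 + mu n) * C * cmod (f k)" by (simp add: power2_eq_square mult.assoc)
    show "0 \<le> dst n k * (cmod (f k))\<^sup>2" using d[of k] by simp
  qed
  define X where "X = (\<Sum>\<^sub>\<infinity>k. dst n k * (cmod (f k))\<^sup>2)"
  define g where "g = (\<lambda>(k,l). cmod (v (k - l)) * cmod (f k) * cmod (f l))"
  have th: "0 \<le> nv * theta n" using nv_nonneg by (simp add: theta_def infsum_nonneg)
  have fin: "sum g F \<le> nv * theta n * X" if "finite F" for F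
  proof -
    define A where "A = fst ` F \<union> snd ` F"
    have A: "finite A" using that by (simp add: A_def)
    have "sum g F \<le> sum g (A \<times> A)"
    proof (rule sum_mono2)
      show "F \<subseteq> A \<times> A" by (force simp: A_def)
    qed (use A in \<open>auto simp: g_def\<close>)
    also have "\<dots> = (\<Sum>k\<in>A. \<Sum>l\<in>A. cmod (v (k - l)) * cmod (f k) * cmod (f l))"
      by (simp add: g_def sum.cartesian_product)
    also have "\<dots> \<le> nv * theta n * (\<Sum>k\<in>A. dst n k * (cmod (f k))\<^sup>2)"
      by (rule form_bound_finite[OF A]) simp
    also have "\<dots> \<le> nv * theta n * X"
      unfolding X_def using less_imp_le[OF d] by (intro mult_left_mono th finite_sum_le_infsum s A) auto
    finally show ?thesis .
  qed
  have gs: "g summable_on UNIV"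
    by (rule nonneg_bdd_above_summable_on) (use fin in \<open>auto intro!: bdd_aboveI2 simp: g_def\<close>)
  have gX: "infsum g UNIV \<le> nv * theta n * X" by (rule infsum_le_finite_sums[OF gs fin])
  have gs': "g summable_on (UNIV \<times> UNIV)" using gs by simp
  have it: "(\<Sum>\<^sub>\<infinity>k. \<Sum>\<^sub>\<infinity>l. g (k,l)) = infsum g UNIV"
    using infsum_Sigma_banach[OF gs'] by simp
  have its: "(\<lambda>k. \<Sum>\<^sub>\<infinity>l. g (k,l)) summable_on UNIV"
    using summable_on_Sigma_banach[of "\<lambda>k l. g (k,l)" UNIV "\<lambda>_. UNIV"] gs by simp
  have le: "cmod (conv f k * cnj (f k)) \<le> (\<Sum>\<^sub>\<infinity>l. g (k,l))" for k
  proof -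
    have "cmod (conv f k * cnj (f k)) \<le> cmod (f k) * (\<Sum>\<^sub>\<infinity>l. cmod (v (k - l)) * cmod (f l))"
      using mult_left_mono[OF conv_summable(4)[OF decay_l2[OF assms], of k] norm_ge_zero[of "f k"]]
      by (simp add: norm_mult mult.commute)
    also have "\<dots> = (\<Sum>\<^sub>\<infinity>l. g (k,l))"
      by (simp add: g_def infsum_cmult_right'[symmetric] mult_ac)
    finally show ?thesis .
  qed
  show s2: "(\<lambda>k. cmod (conv f k * cnj (f k))) summable_on UNIV"
    by (rule summable_on_comparison_test[OF its]) (use le in auto)
  have "(\<Sum>\<^sub>\<infinity>k. cmod (conv f k * cnj (f k))) \<le> (\<Sum>\<^sub>\<infinity>k. \<Sum>\<^sub>\<infinity>l. g (k,l))"
    by (rule infsum_mono[OF s2 its le])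
  then show "(\<Sum>\<^sub>\<infinity>k. cmod (conv f k * cnj (f k))) \<le> nv * theta n * (\<Sum>\<^sub>\<infinity>k. dst n k * (cmod (f k))\<^sup>2)"
    using it gX by (simp add: X_def)
qed

end

section \<open>The indefinite form\<close>

definition sg :: "nat \<Rightarrow> int \<Rightarrow> real" where "sg n k = (if \<bar>k\<bar> \<le> int n then -1 else 1)"

definition hform :: "nat \<Rightarrow> (int \<Rightarrow> complex) \<Rightarrow> (int \<Rightarrow> complex) \<Rightarrow> complex" where
  "hform n x y = (\<Sum>\<^sub>\<infinity>k. of_real (sg n k) * (x k * cnj (y k)))"

lemma sg_abs: "\<bar>sg n k\<bar> = 1" by (simp add: sg_def)

lemma sg_dst: "sg n k * (pi\<^sup>2 * (of_int k)\<^sup>2 - mu n) = dst n k"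
proof -
  have nu: "nu n > 0" by (simp add: nu_def)
  have e: "pi\<^sup>2 * (of_int k)\<^sup>2 - mu n = pi\<^sup>2 * ((of_int k)\<^sup>2 - (nu n)\<^sup>2)" by (simp add: mu_def algebra_simps)
  show ?thesis
  proof (cases "\<bar>k\<bar> \<le> int n")
    case True
    then have "\<bar>of_int k\<bar> \<le> nu n" unfolding nu_def by linarith
    then have "(of_int k)\<^sup>2 \<le> (nu n)\<^sup>2" using power_mono[of "\<bar>of_int k\<bar>" "nu n" 2] by simp
    then show ?thesis unfolding dst_def e sg_def using True by (simp add: abs_mult algebra_simps)
  next
    case False
    then have "nu n \<le> \<bar>of_int k\<bar>" unfolding nu_def by linarith
    then have "(nu n)\<^sup>2 \<le> (of_int k)\<^sup>2" using power_mono[of "nu n" "\<bar>of_int k\<bar>" 2] nu by simp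
    then show ?thesis unfolding dst_def e sg_def using False by (simp add: abs_mult)
  qed
qed

lemma hform_summable:
  assumes "f \<in> decay" "\<And>k. cmod (x k) \<le> B"
  shows "(\<lambda>k. of_real (sg n k) * (x k * cnj (f k))) summable_on UNIV"
    and "(\<lambda>k. of_real (sg n k) * (f k * cnj (x k))) summable_on UNIV"
proof -
  have 1: "(\<lambda>k. cmod (of_real (sg n k) * (x k * cnj (f k)))) summable_on UNIV"
    using decay_mult_abs_summable[OF assms] by (simp add: norm_mult sg_abs)
  then show "(\<lambda>k. of_real (sg n k) * (x k * cnj (f k))) summable_on UNIV" by (rule abs_summable_summable)
  have "(\<lambda>k. cmod (of_real (sg n k) * (f k * cnj (x k)))) summable_on UNIV"
    using decay_mult_abs_summable[OF assms] by (simp add: norm_mult sg_abs mult.commute)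
  then show "(\<lambda>k. of_real (sg n k) * (f k * cnj (x k))) summable_on UNIV" by (rule abs_summable_summable)
qed

text \<open>Only boundedness is asked of the first arguments, because they may be values of
  \<open>hill\<close>.\<close>

lemma hform_add:
  assumes "\<exists>B. \<forall>k. cmod (x k) \<le> B" "\<exists>B. \<forall>k. cmod (y k) \<le> B" "z \<in> decay"
  shows "hform n (x + y) z = hform n x z + hform n y z"
proof -
  obtain B B' where "\<And>k. cmod (x k) \<le> B" "\<And>k. cmod (y k) \<le> B'" using assms by blast
  from infsum_add[OF hform_summable(1)[OF assms(3), where x = x] hform_summable(1)[OF assms(3), where x = y], OF this, of n n]
  show ?thesis by (simp add: hform_def distrib_left distrib_right)
qed

lemma hform_scale: "hform n (sscale c x) y = c * hform n x y"
  unfolding hform_def sscale_def by (simp add: infsum_cmult_right'[symmetric] mult_ac)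

lemma hform_sym: "hform n y x = cnj (hform n x y)"
  unfolding hform_def by (simp add: infsum_cnj[symmetric] mult_ac)

lemma hform_diag:
  assumes "f \<in> decay"
  shows "(\<lambda>k. sg n k * (cmod (f k))\<^sup>2) summable_on UNIV"
    "hform n f f = of_real (\<Sum>\<^sub>\<infinity>k. sg n k * (cmod (f k))\<^sup>2)"
proof -
  obtain B where "\<And>k. cmod (f k) \<le> B" using decay_bounded[OF assms] by blast
  from hform_summable(1)[OF assms, where x = f and n = n, OF this]
  have s: "(\<lambda>k. of_real (sg n k * (cmod (f k))\<^sup>2) :: complex) summable_on UNIV"
    by (simp add: complex_norm_square del: of_real_power)
  from summable_on_Re[OF this] show s': "(\<lambda>k. sg n k * (cmod (f k))\<^sup>2) summable_on UNIV"
    by simp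
  have "hform n f f = (\<Sum>\<^sub>\<infinity>k. of_real (sg n k * (cmod (f k))\<^sup>2))"
    unfolding hform_def by (simp add: complex_norm_square del: of_real_power)
  then show "hform n f f = of_real (\<Sum>\<^sub>\<infinity>k. sg n k * (cmod (f k))\<^sup>2)"
    by (simp only:) (intro infsumI has_sum_of_real has_sum_infsum s')
qed

context potential
begin

text \<open>By \<open>sg_dst\<close> every mode contributes to the diagonal part with a positive
  sign, in total X. The potential contributes at most \<open>nv * theta n * X\<close>, which is less
  than X.\<close>

lemma hform_pos:
  assumes "nv \<le> (real n + 1) / 4" "f \<in> decay" "f \<noteq> 0"
  shows "0 < Re (hform n (hill f) f) - mu n * Re (hform n f f)"
proof -
  define X where "X = (\<Sum>\<^sub>\<infinity>k. dst n k * (cmod (f k))\<^sup>2)"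
  note fb = form_bound(1)[OF assms(2), of n] form_bound(2)[OF assms(2)] form_bound(3)[OF assms(2), of n]
  obtain B where B: "\<And>k. cmod (hill f k) \<le> B" using hill_bounded[OF assms(2)] by blast
  obtain B' where B': "\<And>k. cmod (f k) \<le> B'" using decay_bounded[OF assms(2)] by blast
  let ?c = "\<lambda>k. of_real (sg n k) * (conv f k * cnj (f k))"
  have sX: "(\<lambda>k. of_real (dst n k * (cmod (f k))\<^sup>2) :: complex) summable_on UNIV"
    using has_sum_of_real[OF has_sum_infsum[OF fb(1)]] by (auto simp: summable_on_def)
  have cs: "(\<lambda>k. cmod (?c k)) summable_on UNIV" using fb(2) by (simp add: norm_mult sg_abs)
  have "hform n (hill f) f - of_real (mu n) * hform n f f =
     (\<Sum>\<^sub>\<infinity>k. of_real (sg n k) * (hill f k * cnj (f k)) - of_real (mu n) * (of_real (sg n k) * (f k * cnj (f k))))"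
    unfolding hform_def infsum_cmult_right'[symmetric]
    by (subst infsum_diff) (auto intro!: hform_summable(1)[OF assms(2) B] summable_on_cmult_right hform_summable(1)[OF assms(2) B'])
  also have "\<dots> = (\<Sum>\<^sub>\<infinity>k. of_real (dst n k * (cmod (f k))\<^sup>2) + ?c k)"
  proof (rule infsum_cong)
    fix k
    have "of_real (sg n k) * (hill f k * cnj (f k)) - of_real (mu n) * (of_real (sg n k) * (f k * cnj (f k)))
      = of_real (sg n k * (pi\<^sup>2 * (of_int k)\<^sup>2 - mu n)) * (f k * cnj (f k)) + ?c k"
      by (simp add: hill_def algebra_simps)
    then show "of_real (sg n k) * (hill f k * cnj (f k)) - of_real (mu n) * (of_real (sg n k) * (f k * cnj (f k)))
      = of_real (dst n k * (cmod (f k))\<^sup>2) + ?c k"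
      unfolding sg_dst complex_norm_square[symmetric] by simp
  qed
  also have "\<dots> = of_real X + (\<Sum>\<^sub>\<infinity>k. ?c k)"
    using infsum_add[OF sX abs_summable_summable[OF cs]]
      infsumI[OF has_sum_of_real[OF has_sum_infsum[OF fb(1)]]]
    by (simp add: X_def)
  finally have eq: "hform n (hill f) f - of_real (mu n) * hform n f f = of_real X + (\<Sum>\<^sub>\<infinity>k. ?c k)" .
  have "cmod (\<Sum>\<^sub>\<infinity>k. ?c k) \<le> (\<Sum>\<^sub>\<infinity>k. cmod (?c k))" by (rule norm_infsum_bound[OF cs])
  also have "\<dots> = (\<Sum>\<^sub>\<infinity>k. cmod (conv f k * cnj (f k)))" by (simp add: norm_mult sg_abs)
  also have "\<dots> \<le> nv * theta n * X" using fb(3) by (simp add: X_def)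
  finally have c: "cmod (\<Sum>\<^sub>\<infinity>k. ?c k) \<le> nv * theta n * X" .
  have "X > 0"
  proof -
    obtain k where "f k \<noteq> 0" using assms(3) by (auto simp: fun_eq_iff)
    then have "0 < (\<Sum>k\<in>{k}. dst n k * (cmod (f k))\<^sup>2)" using dst_pos[of n k] by simp
    also have "\<dots> \<le> X" unfolding X_def using less_imp_le[OF dst_pos] by (intro finite_sum_le_infsum fb(1)) auto
    finally show ?thesis .
  qed
  then have "nv * theta n * X < X" using theta_less_1[OF assms(1)] by simp
  then have "0 < Re (of_real X + (\<Sum>\<^sub>\<infinity>k. ?c k))"
    using c abs_Re_le_cmod[of "\<Sum>\<^sub>\<infinity>k. ?c k"] by simp
  then show ?thesis unfolding eq[symmetric] by simp
qed

end

section \<open>Counting eigenvalues by Galerkin approximation\<close>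

interpretation seq_pair: vector_space_pair sscale sscale
  by unfold_locales

section \<open>Dimension counts by coordinates\<close>

definition crd :: "int set \<Rightarrow> (int \<Rightarrow> complex) \<Rightarrow> int \<Rightarrow> complex" where
  "crd K f = (\<lambda>k. if k \<in> K then f k else 0)"

definition unit_seq :: "int \<Rightarrow> int \<Rightarrow> complex" where
  "unit_seq j = (\<lambda>k. if k = j then 1 else 0)"

lemma linear_crd: "Vector_Spaces.linear sscale sscale (crd K)"
  by unfold_locales (auto simp: crd_def sscale_def fun_eq_iff algebra_simps)

lemma sum_seq_apply: "(\<Sum>i\<in>I. sscale (c i) (f i)) k = (\<Sum>i\<in>I. c i * f i k)"
  by (induction I rule: infinite_finite_induct) (auto simp: sscale_def)

lemma crd_span: "finite K \<Longrightarrow> crd K f \<in> seq.span (unit_seq ` K)"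
proof -
  assume K: "finite K"
  have "crd K f = (\<Sum>j\<in>K. sscale (f j) (unit_seq j))"
    using K by (auto simp: fun_eq_iff sum_seq_apply crd_def unit_seq_def if_distrib cong: if_cong)
  also have "\<dots> \<in> seq.span (unit_seq ` K)"
    by (intro seq.span_sum seq.span_scale seq.span_base) auto
  finally show ?thesis .
qed

lemma card_unit_seq: "card (unit_seq ` K) = card K"
  by (intro card_image inj_onI) (auto simp: unit_seq_def fun_eq_iff split: if_splits)

lemma independent_unit_seq: "finite K \<Longrightarrow> seq.independent (unit_seq ` K)"
proof -
  assume K: "finite K"
  have inj: "inj_on unit_seq K" by (intro inj_onI) (auto simp: unit_seq_def fun_eq_iff split: if_splits)
  have "u (unit_seq j) = 0" if "(\<Sum>x\<in>unit_seq ` K. sscale (u x) x) = 0" "j \<in> K" for u j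
  proof -
    have "(\<Sum>i\<in>K. u (unit_seq i) * unit_seq i j) = 0"
      using that(1) by (simp add: sum.reindex[OF inj] sum_seq_apply[of "\<lambda>i. u (unit_seq i)" unit_seq, symmetric])
    then show ?thesis using K that(2) by (simp add: unit_seq_def if_distrib cong: if_cong)
  qed
  then show ?thesis using K by (auto simp: seq.dependent_finite)
qed

text \<open>The coordinate map is injective on the span. This converts definiteness of the form into
  bounds on dimensions.\<close>

lemma coordinates_independent:
  assumes "finite K" "seq.independent B" "\<And>f. f \<in> seq.span B \<Longrightarrow> (\<And>k. k \<in> K \<Longrightarrow> f k = 0) \<Longrightarrow> f = 0"
  shows "seq.independent (crd K ` B)" "card (crd K ` B) = card B" "finite B" "card B \<le> card K"
proof -
  have inj: "inj_on (crd K) (seq.span B)"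
  proof (rule inj_onI)
    fix x y assume xy: "x \<in> seq.span B" "y \<in> seq.span B" "crd K x = crd K y"
    have "x - y = 0"
    proof (rule assms(3))
      show "x - y \<in> seq.span B" using xy by (intro seq.span_diff)
      fix k assume "k \<in> K"
      then show "(x - y) k = 0" using fun_cong[OF xy(3), of k] by (simp add: crd_def)
    qed
    then show "x = y" by simp
  qed
  show i: "seq.independent (crd K ` B)"
    by (rule seq_pair.linear_independent_injective_image[OF linear_crd assms(2) inj])
  have injB: "inj_on (crd K) B" by (rule inj_on_subset[OF inj seq.span_superset])
  show c: "card (crd K ` B) = card B" by (rule card_image[OF injB])
  have *: "finite (crd K ` B) \<and> card (crd K ` B) \<le> card (unit_seq ` K)"
    by (rule seq.independent_span_bound[OF _ i]) (use assms(1) crd_span in auto)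
  then show "finite B" using finite_imageD[OF _ injB] by blast
  show "card B \<le> card K" using * c card_unit_seq by simp
qed

text \<open>With as many basis vectors as coordinates the injective coordinate map is onto, so the
  subspace is a graph over the coordinates in \<open>K\<close>.\<close>

lemma coordinates_onto:
  assumes "finite K" "seq.independent B" "\<And>f. f \<in> seq.span B \<Longrightarrow> (\<And>k. k \<in> K \<Longrightarrow> f k = 0) \<Longrightarrow> f = 0"
    and "card K \<le> card B" "j \<in> K"
  shows "\<exists>f\<in>seq.span B. \<forall>k\<in>K. f k = unit_seq j k"
proof -
  have ci: "seq.independent (crd K ` B)" "card (crd K ` B) = card B" "finite B"
    using coordinates_independent[OF assms(1,2)] assms(3) by (metis (no_types))+
  interpret crd: Vector_Spaces.linear sscale sscale "crd K" by (rule linear_crd)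
  have "unit_seq j \<in> seq.span (crd K ` B)"
  proof (rule ccontr)
    assume *: "unit_seq j \<notin> seq.span (crd K ` B)"
    then have "seq.independent (insert (unit_seq j) (crd K ` B))"
      using ci(1) by (simp add: seq.independent_insertI)
    then have "card (insert (unit_seq j) (crd K ` B)) \<le> card (unit_seq ` K)"
    proof (intro conjunct2[OF seq.independent_span_bound])
      show "insert (unit_seq j) (crd K ` B) \<subseteq> seq.span (unit_seq ` K)"
        using crd_span[OF assms(1)] seq.span_base[of "unit_seq j" "unit_seq ` K"] assms(5) by auto
    qed (use assms(1) in auto)
    moreover have "unit_seq j \<notin> crd K ` B" by (rule contra_subsetD[OF seq.span_superset *])
    ultimately have "Suc (card (crd K ` B)) \<le> card (unit_seq ` K)" using ci(3) by simp
    then show False using ci(2) assms(4) card_unit_seq[of K] by simp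
  qed
  then obtain f where "f \<in> seq.span B" "unit_seq j = crd K f" by (auto simp: crd.span_image)
  then show ?thesis by (intro bexI[of _ f]) (auto simp: crd_def)
qed

context vector_space begin

lemma finite_subset_span:
  assumes "finite A" "A \<subseteq> span S"
  shows "\<exists>T. finite T \<and> T \<subseteq> S \<and> A \<subseteq> span T"
  using assms
proof (induction A rule: finite_induct)
  case (insert a A)
  then obtain T where T: "finite T" "T \<subseteq> S" "A \<subseteq> span T" by auto
  from insert.prems have "a \<in> span S" by simp
  then obtain U r where U: "finite U" "U \<subseteq> S" "a = (\<Sum>x\<in>U. scale (r x) x)" by (auto simp: span_explicit)
  have "a \<in> span U" unfolding U(3) by (intro span_sum span_scale span_base)
  then show ?case using T U span_mono[of T "T \<union> U"] span_mono[of U "T \<union> U"]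
    by (intro exI[of _ "T \<union> U"]) auto
qed auto

end

section \<open>Truncations and their limit\<close>

definition VM :: "nat \<Rightarrow> (int \<Rightarrow> complex) set" where
  "VM M = {f. \<forall>k. int M < \<bar>k\<bar> \<longrightarrow> f k = 0}"

definition idx :: "nat \<Rightarrow> int set" where "idx n = {- int n..int n}"

lemma finite_idx [simp]: "finite (idx n)" by (simp add: idx_def)
lemma card_idx: "card (idx n) = 2 * n + 1" by (simp add: idx_def)
lemma idx_iff: "k \<in> idx n \<longleftrightarrow> \<bar>k\<bar> \<le> int n" by (auto simp: idx_def)

lemma VM_subset_decay: "VM M \<subseteq> decay"
proof
  fix f assume f: "f \<in> VM M"
  have "(1 + (of_int k)\<^sup>2) * cmod (f k) \<le> (\<Sum>k\<in>idx M. (1 + (of_int k)\<^sup>2) * cmod (f k))" for k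
  proof (cases "k \<in> idx M")
    case True
    then show ?thesis by (intro member_le_sum) auto
  next
    case False
    then show ?thesis using f by (auto simp: VM_def idx_iff intro!: sum_nonneg)
  qed
  then show "f \<in> decay" by (auto simp: decay_def)
qed

lemma subspace_VM: "seq.subspace (VM M)"
  by (rule seq.subspaceI) (auto simp: VM_def sscale_def)

lemma crd_VM: "crd (idx M) f \<in> VM M"
  by (auto simp: VM_def crd_def idx_iff)

lemma VM_crd: "f \<in> VM M \<Longrightarrow> crd (idx M) f = f"
  by (auto simp: VM_def crd_def idx_iff fun_eq_iff)

lemma hform_VM:
  assumes "f \<in> VM M"
  shows "hform n f f = of_real (\<Sum>k\<in>idx M. sg n k * (cmod (f k))\<^sup>2)"
proof -
  have "(\<Sum>\<^sub>\<infinity>k. sg n k * (cmod (f k))\<^sup>2) = (\<Sum>\<^sub>\<infinity>k\<in>idx M. sg n k * (cmod (f k))\<^sup>2)"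
    using assms by (intro infsum_cong_neutral) (auto simp: VM_def idx_iff)
  then show ?thesis using hform_diag(2)[of f n] VM_subset_decay assms by auto
qed

context potential
begin

definition hillM :: "nat \<Rightarrow> (int \<Rightarrow> complex) \<Rightarrow> int \<Rightarrow> complex" where
  "hillM M f = crd (idx M) (hill f)"

text \<open>Entries removed by the truncation are paired with f k = 0. Thus the Lyapunov inequality
  passes to every truncation with the same threshold and no loss.\<close>

lemma hform_hillM:
  assumes "f \<in> VM M"
  shows "hform n (hillM M f) f = hform n (hill f) f"
  unfolding hform_def hillM_def crd_def using assms by (intro infsum_cong) (auto simp: VM_def idx_iff)

lemma hill_form_operator:
  assumes "nv \<le> (real n + 1) / 4"
  shows "form_operator sscale decay hill (hform n) (mu n)"
proof unfold_locales
  show "hform n (x + y) z = hform n x z + hform n y z" if "x \<in> decay" "y \<in> decay" "z \<in> decay" for x y z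
    using hform_add decay_bounded that by blast
  show "hform n y x = cnj (hform n x y)" for x y by (rule hform_sym)
qed (use hform_scale hform_pos[OF assms] in auto)

lemma hillM_form_operator:
  assumes "nv \<le> (real n + 1) / 4"
  shows "form_operator sscale (VM M) (hillM M) (hform n) (mu n)"
proof unfold_locales
  interpret crd: Vector_Spaces.linear sscale sscale "crd (idx M)" by (rule linear_crd)
  show "seq.subspace (VM M)" by (rule subspace_VM)
  show "hillM M (x + y) = hillM M x + hillM M y" if "x \<in> VM M" "y \<in> VM M" for x y
    using hill.L_add[of x y] that VM_subset_decay[of M] crd.add[of "hill x" "hill y"]
    by (metis hillM_def subsetD)
  show "hillM M (sscale c x) = sscale c (hillM M x)" if "x \<in> VM M" for c x
    using hill.L_scale[of x c] that VM_subset_decay[of M] crd.scale[of c "hill x"]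
    by (metis hillM_def subsetD)
  show "hform n (x + y) z = hform n x z + hform n y z" if "x \<in> VM M" "y \<in> VM M" "z \<in> VM M" for x y z
    using that VM_subset_decay[of M] by (intro hform_add decay_bounded) auto
  show "hform n y x = cnj (hform n x y)" for x y by (rule hform_sym)
  show "0 < Re (hform n (hillM M x) x) - mu n * Re (hform n x x)" if "x \<in> VM M" "x \<noteq> 0" for x
    using hform_pos[OF assms, of x] that VM_subset_decay[of M] by (auto simp: hform_hillM)
qed (use hform_scale in auto)

lemma hform_nonneg:
  assumes "f \<in> decay" "\<And>k. k \<in> idx n \<Longrightarrow> f k = 0"
  shows "0 \<le> Re (hform n f f)"
  unfolding hform_diag(2)[OF assms(1)] using assms(2) by (auto intro!: infsum_nonneg simp: sg_def idx_iff)

lemma hform_nonpos: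
  assumes "f \<in> VM M" "\<And>k. k \<in> idx M - idx n \<Longrightarrow> f k = 0"
  shows "Re (hform n f f) \<le> 0"
  unfolding hform_VM[OF assms(1)] using assms(2) by (auto intro!: sum_nonpos simp: sg_def idx_iff)

text \<open>Negativity on the span contradicts \<open>hform_nonneg\<close>, so the coordinates in
  \<open>idx n\<close> determine a vector of the span.\<close>

lemma negative_eq_0:
  assumes "form_operator sscale D L (hform n) \<mu>" "D \<subseteq> decay" "form_operator.hbasis sscale D L (hform n) 1 B"
    "f \<in> seq.span B" "\<And>k. k \<in> idx n \<Longrightarrow> f k = 0"
  shows "f = 0"
proof (rule ccontr)
  interpret F: form_operator sscale D L "hform n" \<mu> by (rule assms(1))
  assume "f \<noteq> 0"
  then have "Re (hform n f f) < 0" using F.hbasis_definite[OF assms(3,4)] by simp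
  moreover have "f \<in> decay" using F.hbasis_span_D[OF assms(3)] assms(2,4) by auto
  ultimately show False using hform_nonneg[of f n] assms(5) by simp
qed

text \<open>In finite dimension generalized eigenvectors span everything, and no eigenvalue has Re z
  = mu n, so the negative and the positive basis together have at least 2 M + 1 elements. The
  positive one has at most 2 (M - n), as its vectors are determined by the modes outside
  \<open>idx n\<close>.\<close>

lemma hillM_negative_basis:
  assumes nv: "nv \<le> (real n + 1) / 4" and "n \<le> M"
  shows "\<exists>B. form_operator.hbasis sscale (VM M) (hillM M) (hform n) 1 B \<and> 2 * n + 1 \<le> card B"
proof -
  interpret G: form_operator sscale "VM M" "hillM M" "hform n" "mu n" by (rule hillM_form_operator[OF nv])
  let ?U = "unit_seq ` idx M"
  define S where "S = {g \<in> VM M. \<exists>z. g \<in> G.gen z}"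
  have "VM M \<subseteq> seq.span ?U" using VM_crd[of _ M] crd_span[of "idx M"] by (metis finite_idx subsetI)
  then have "VM M \<subseteq> seq.span S"
    unfolding S_def using crd_VM by (intro G.invariant_subset_span_gen[of _ ?U]) (auto simp: hillM_def subspace_VM)
  moreover have "?U \<subseteq> VM M" by (auto simp: VM_def unit_seq_def idx_iff)
  ultimately obtain T where T: "finite T" "T \<subseteq> S" "?U \<subseteq> seq.span T"
    using seq.finite_subset_span[of ?U S] by auto
  define Tm where "Tm = {g \<in> T. \<exists>z. 1 * (Re z - mu n) < 0 \<and> g \<in> G.gen z}"
  define Tp where "Tp = {g \<in> T. \<exists>z. (-1) * (Re z - mu n) < 0 \<and> g \<in> G.gen z}"
  obtain Bm where Bm: "G.hbasis 1 Bm" "Tm \<subseteq> seq.span Bm"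
    using G.hbasis_exists[of Tm 1] T(1) unfolding Tm_def by auto
  obtain Bp where Bp: "G.hbasis (-1) Bp" "Tp \<subseteq> seq.span Bp"
    using G.hbasis_exists[of Tp "-1"] T(1) unfolding Tp_def by auto
  have "T \<subseteq> seq.span (Bm \<union> Bp)"
  proof
    fix g assume g: "g \<in> T"
    then obtain z k where z: "g \<in> G.kerpow z k" "g \<in> VM M" using T(2) by (auto simp: S_def G.gen_def)
    consider "Re z < mu n" | "Re z > mu n" | "Re z = mu n" by linarith
    then show "g \<in> seq.span (Bm \<union> Bp)"
    proof cases
      case 1
      then have "g \<in> Tm" using g z by (auto simp: Tm_def G.gen_def)
      then show ?thesis using Bm(2) seq.span_mono[of Bm "Bm \<union> Bp"] by auto
    next
      case 2
      then have "g \<in> Tp" using g z by (auto simp: Tp_def G.gen_def)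
      then show ?thesis using Bp(2) seq.span_mono[of Bp "Bm \<union> Bp"] by auto
    next
      case 3
      \<comment> \<open>An eigenvector on the line Re z = mu n would make the product in
        \<open>eigenvector_definite\<close> both positive and zero.\<close>
      have "g = 0"
      proof (rule ccontr)
        assume "g \<noteq> 0"
        then obtain x where "x \<in> VM M" "x \<noteq> 0" "hillM M x = sscale z x"
          using G.eigenvector_of_kerpow[OF z(1) _ z(2) subspace_VM] crd_VM by (auto simp: hillM_def)
        then show False using G.eigenvector_definite[of x z] 3 by simp
      qed
      then show ?thesis by (simp add: seq.span_zero)
    qed
  qed
  then have "?U \<subseteq> seq.span (Bm \<union> Bp)" using T(3) seq.span_minimal[OF _ seq.subspace_span] by blast
  moreover have fin: "finite Bm" "finite Bp" using Bm Bp by (auto simp: G.hbasis_def)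
  ultimately have "card ?U \<le> card (Bm \<union> Bp)"
    using seq.independent_span_bound[OF _ independent_unit_seq[OF finite_idx]] by blast
  also have "\<dots> \<le> card Bm + card Bp" by (rule card_Un_le)
  finally have 1: "card (idx M) \<le> card Bm + card Bp" by (simp add: card_unit_seq)
  have "card Bp \<le> card (idx M - idx n)"
  proof (rule coordinates_independent(4))
    show "seq.independent Bp" by (rule G.hbasis_independent[OF Bp(1)])
    fix f assume f: "f \<in> seq.span Bp" "\<And>k. k \<in> idx M - idx n \<Longrightarrow> f k = 0"
    have "f \<in> VM M" using f(1) G.hbasis_span_D[OF Bp(1)] by auto
    then have "Re (hform n f f) \<le> 0" using hform_nonpos f(2) by blast
    then show "f = 0" using G.hbasis_definite[OF Bp(1) f(1)] by fastforce
  qed simp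
  moreover have "card (idx M - idx n) = card (idx M) - card (idx n)"
    using assms(2) by (intro card_Diff_subset) (auto simp: idx_def)
  ultimately show ?thesis using 1 Bm(1) assms(2) by (intro exI[of _ Bm]) (auto simp: card_idx)
qed

text \<open>\<open>f j\<close> lies over the j-th unit vector of the modes in \<open>idx n\<close>;
  the last clause bounds the norm of the graph map by 1. \<open>K\<close> and \<open>D\<close> cover
  two uses: \<open>idx M\<close> and \<open>VM M\<close> for a truncation, \<open>UNIV\<close> and
  \<open>decay\<close> for \<open>L\<close>. Invariance is stated coordinatewise and the norm over
  finite sets so that both survive pointwise limits.\<close>

definition graph_family :: "nat \<Rightarrow> int set \<Rightarrow> (int \<Rightarrow> complex) set \<Rightarrow> (int \<Rightarrow> int \<Rightarrow> complex) \<Rightarrow> bool" where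
  "graph_family n K D f \<longleftrightarrow>
    (\<forall>j\<in>idx n. f j \<in> D \<and> (\<forall>i\<in>idx n. f j i = unit_seq j i) \<and>
      (\<forall>k\<in>K. hill (f j) k = (\<Sum>i\<in>idx n. hill (f j) i * f i k))) \<and>
    (\<forall>c A. finite A \<longrightarrow> A \<inter> idx n = {} \<longrightarrow>
      (\<Sum>k\<in>A. (cmod (\<Sum>j\<in>idx n. c j * f j k))\<^sup>2) \<le> (\<Sum>i\<in>idx n. (cmod (c i))\<^sup>2))"

lemma graph_familyD:
  assumes "graph_family n K D f"
  shows "j \<in> idx n \<Longrightarrow> f j \<in> D" "j \<in> idx n \<Longrightarrow> i \<in> idx n \<Longrightarrow> f j i = unit_seq j i"
    "j \<in> idx n \<Longrightarrow> k \<in> K \<Longrightarrow> hill (f j) k = (\<Sum>i\<in>idx n. hill (f j) i * f i k)"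
    "finite A \<Longrightarrow> A \<inter> idx n = {} \<Longrightarrow>
      (\<Sum>k\<in>A. (cmod (\<Sum>j\<in>idx n. c j * f j k))\<^sup>2) \<le> (\<Sum>i\<in>idx n. (cmod (c i))\<^sup>2)"
  using assms unfolding graph_family_def by blast+

lemma galerkin:
  assumes nv: "nv \<le> (real n + 1) / 4" and "n \<le> M"
  shows "\<exists>f. graph_family n (idx M) (VM M) f"
proof -
  interpret G: form_operator sscale "VM M" "hillM M" "hform n" "mu n" by (rule hillM_form_operator[OF nv])
  obtain B where B: "G.hbasis 1 B" "2 * n + 1 \<le> card B" using hillM_negative_basis[OF assms] by blast
  have zero: "f = 0" if "f \<in> seq.span B" "\<And>k. k \<in> idx n \<Longrightarrow> f k = 0" for f
    by (rule negative_eq_0[OF G.form_operator_axioms VM_subset_decay B(1) that])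
  have BV: "seq.span B \<subseteq> VM M" by (rule G.hbasis_span_D[OF B(1)])
  have "\<forall>j\<in>idx n. \<exists>f\<in>seq.span B. \<forall>k\<in>idx n. f k = unit_seq j k"
    using coordinates_onto[OF finite_idx G.hbasis_independent[OF B(1)] zero] B(2) by (simp add: card_idx)
  then obtain f where f: "\<And>j. j \<in> idx n \<Longrightarrow> f j \<in> seq.span B" "\<And>j k. j \<in> idx n \<Longrightarrow> k \<in> idx n \<Longrightarrow> f j k = unit_seq j k"
    by metis
  \<comment> \<open>Both sides have the same coordinates in \<open>idx n\<close>, and these
    determine a vector of the span.\<close>
  have expand: "x = (\<Sum>i\<in>idx n. sscale (x i) (f i))" if "x \<in> seq.span B" for x
  proof -
    have "x - (\<Sum>i\<in>idx n. sscale (x i) (f i)) = 0"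
    proof (rule zero)
      show "x - (\<Sum>i\<in>idx n. sscale (x i) (f i)) \<in> seq.span B"
        using that f(1) by (intro seq.span_diff seq.span_sum seq.span_scale)
      fix k assume "k \<in> idx n"
      then show "(x - (\<Sum>i\<in>idx n. sscale (x i) (f i))) k = 0"
        by (simp add: sum_seq_apply f(2) unit_seq_def if_distrib cong: if_cong)
    qed
    then show ?thesis by simp
  qed
  have 1: "hill (f j) k = (\<Sum>i\<in>idx n. hill (f j) i * f i k)" if "j \<in> idx n" "k \<in> idx M" for j k
  proof -
    have h: "hillM M (f j) l = hill (f j) l" if "l \<in> idx M" for l
      using that by (simp add: hillM_def crd_def)
    have "hillM M (f j) \<in> seq.span B" by (rule G.hbasis_invariant[OF B(1) f(1)[OF that(1)]])
    from fun_cong[OF expand[OF this], of k]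
    have "hill (f j) k = (\<Sum>i\<in>idx n. hillM M (f j) i * f i k)" using h that by (simp add: sum_seq_apply)
    also have "\<dots> = (\<Sum>i\<in>idx n. hill (f j) i * f i k)"
      using h assms(2) by (intro sum.cong) (auto simp: idx_iff)
    finally show ?thesis .
  qed
  have 2: "(\<Sum>k\<in>A. (cmod (\<Sum>j\<in>idx n. c j * f j k))\<^sup>2) \<le> (\<Sum>i\<in>idx n. (cmod (c i))\<^sup>2)"
    if A: "finite A" "A \<inter> idx n = {}" for c A
  proof -
    define x where "x = (\<Sum>j\<in>idx n. sscale (c j) (f j))"
    have xk: "x k = (\<Sum>j\<in>idx n. c j * f j k)" for k by (simp add: x_def sum_seq_apply)
    have xB: "x \<in> seq.span B" unfolding x_def using f(1) by (intro seq.span_sum seq.span_scale)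
    have xV: "x \<in> VM M" using xB BV by auto
    have xc: "x i = c i" if "i \<in> idx n" for i
      unfolding xk using that by (simp add: f(2) unit_seq_def if_distrib cong: if_cong)
    \<comment> \<open>A nonpositive form means that the modes outside \<open>idx n\<close> carry no
      more mass than those inside, which is the norm bound of the graph.\<close>
    have "Re (hform n x x) \<le> 0"
      using G.hbasis_definite[OF B(1) xB] by (cases "x = 0") (auto simp: hform_def)
    then have "(\<Sum>k\<in>idx M. sg n k * (cmod (x k))\<^sup>2) \<le> 0" using hform_VM[OF xV, of n] by simp
    moreover have "idx n \<subseteq> idx M" using assms(2) by (auto simp: idx_iff)
    then have "(\<Sum>k\<in>idx M. sg n k * (cmod (x k))\<^sup>2) =
       (\<Sum>k\<in>idx n. sg n k * (cmod (x k))\<^sup>2) + (\<Sum>k\<in>idx M - idx n. sg n k * (cmod (x k))\<^sup>2)"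
      using sum.subset_diff[of "idx n" "idx M" "\<lambda>k. sg n k * (cmod (x k))\<^sup>2"] by (simp add: add.commute)
    moreover have "(\<Sum>k\<in>idx n. sg n k * (cmod (x k))\<^sup>2) = - (\<Sum>k\<in>idx n. (cmod (c k))\<^sup>2)"
      by (simp add: sum_negf[symmetric]) (rule sum.cong, auto simp: sg_def idx_iff xc)
    moreover have "(\<Sum>k\<in>idx M - idx n. sg n k * (cmod (x k))\<^sup>2) = (\<Sum>k\<in>idx M - idx n. (cmod (x k))\<^sup>2)"
      by (rule sum.cong) (auto simp: sg_def idx_iff)
    ultimately have le: "(\<Sum>k\<in>idx M - idx n. (cmod (x k))\<^sup>2) \<le> (\<Sum>i\<in>idx n. (cmod (c i))\<^sup>2)" by simp
    have "(\<Sum>k\<in>A. (cmod (x k))\<^sup>2) = (\<Sum>k\<in>A \<inter> idx M. (cmod (x k))\<^sup>2)"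
      using A xV by (intro sum.mono_neutral_right) (auto simp: VM_def idx_iff)
    also have "\<dots> \<le> (\<Sum>k\<in>idx M - idx n. (cmod (x k))\<^sup>2)" using A by (intro sum_mono2) auto
    finally show ?thesis using le by (simp add: xk)
  qed
  show ?thesis unfolding graph_family_def using f BV 1 2 by (intro exI[of _ f]) blast
qed

text \<open>Coordinatewise convergence with a uniform l2 bound is weak convergence in l2, and
  evaluating \<open>conv\<close> at k is a pairing with the square-summable sequence l \<mapsto> v
  (k - l).\<close>

lemma conv_tendsto:
  assumes bd: "\<And>r A. finite A \<Longrightarrow> (\<Sum>l\<in>A. (cmod (x r l))\<^sup>2) \<le> C"
    and lim: "\<And>l. (\<lambda>r. x r l) \<longlonglongrightarrow> y l"
  shows "(\<lambda>l. (cmod (y l))\<^sup>2) summable_on UNIV" "(\<lambda>r. conv (x r) k) \<longlonglongrightarrow> conv y k"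
proof -
  have C0: "0 \<le> C" using bd[of "{}"] by simp
  have ybd: "(\<Sum>l\<in>A. (cmod (y l))\<^sup>2) \<le> C" if "finite A" for A
    by (rule tendsto_upperbound[of "\<lambda>r. \<Sum>l\<in>A. (cmod (x r l))\<^sup>2" _ sequentially])
      (use bd[OF that] in \<open>auto intro!: tendsto_intros lim\<close>)
  have summ: "(\<lambda>l. (cmod (z l))\<^sup>2) summable_on UNIV" if "\<And>A. finite A \<Longrightarrow> (\<Sum>l\<in>A. (cmod (z l))\<^sup>2) \<le> B" for z :: "int \<Rightarrow> complex" and B
    by (rule nonneg_bdd_above_summable_on) (use that in \<open>auto intro!: bdd_aboveI2\<close>)
  show ys: "(\<lambda>l. (cmod (y l))\<^sup>2) summable_on UNIV" by (rule summ[OF ybd])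
  define d where "d = (\<lambda>r l. x r l - y l)"
  have dbd: "(\<Sum>l\<in>A. (cmod (d r l))\<^sup>2) \<le> 4 * C" if "finite A" for r A
  proof -
    have "(cmod (d r l))\<^sup>2 \<le> 2 * (cmod (x r l))\<^sup>2 + 2 * (cmod (y l))\<^sup>2" for l
    proof -
      have "(cmod (d r l))\<^sup>2 \<le> (cmod (x r l) + cmod (y l))\<^sup>2"
        unfolding d_def by (intro power_mono norm_triangle_ineq4) auto
      also have "\<dots> \<le> 2 * (cmod (x r l))\<^sup>2 + 2 * (cmod (y l))\<^sup>2"
        using sum_squares_bound[of "cmod (x r l)" "cmod (y l)"] by (simp add: power2_sum)
      finally show ?thesis .
    qed
    then have "(\<Sum>l\<in>A. (cmod (d r l))\<^sup>2) \<le> (\<Sum>l\<in>A. 2 * (cmod (x r l))\<^sup>2 + 2 * (cmod (y l))\<^sup>2)" by (intro sum_mono)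
    also have "\<dots> = 2 * (\<Sum>l\<in>A. (cmod (x r l))\<^sup>2) + 2 * (\<Sum>l\<in>A. (cmod (y l))\<^sup>2)"
      by (simp add: sum.distrib sum_distrib_left)
    finally show ?thesis using bd[OF that, of r] ybd[OF that] by linarith
  qed
  have ds: "(\<lambda>l. (cmod (d r l))\<^sup>2) summable_on UNIV" for r by (rule summ[OF dbd])
  have xs: "(\<lambda>l. (cmod (x r l))\<^sup>2) summable_on UNIV" for r by (rule summ[OF bd])
  have diff: "conv (x r) k - conv y k = (\<Sum>\<^sub>\<infinity>l. v (k - l) * d r l)" for r
    unfolding conv_def d_def
    using infsum_diff[OF conv_summable(2)[OF xs[of r], of k] conv_summable(2)[OF ys, of k]] by (simp add: algebra_simps)
  show "(\<lambda>r. conv (x r) k) \<longlonglongrightarrow> conv y k"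
  proof (rule LIMSEQ_I)
    fix e :: real assume e: "e > 0"
    \<comment> \<open>Chosen so that sqrt \<epsilon> sqrt (4 C) \<le> e / 2, where 4 C bounds the
      differences by (a + b)^2 \<le> 2 a^2 + 2 b^2; the 1 in the denominator covers C = 0.\<close>
    define \<epsilon> where "\<epsilon> = (e / (4 * (sqrt C + 1)))\<^sup>2"
    have sC: "sqrt C + 1 > 0" using C0 by (simp add: add_nonneg_pos)
    have \<epsilon>: "\<epsilon> > 0" using e sC by (simp add: \<epsilon>_def)
    let ?w = "\<lambda>l. (cmod (v (k - l)))\<^sup>2"
    obtain A where A: "finite A" "dist (sum ?w A) (infsum ?w UNIV) \<le> \<epsilon>"
      using infsum_finite_approximation[OF v_shift(1)[of k] \<epsilon>] by auto
    have tail: "infsum ?w (- A) \<le> \<epsilon>"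
    proof -
      have "infsum ?w UNIV = infsum ?w A + infsum ?w (- A)"
        using infsum_Un_disjoint[of ?w A "- A"] summable_on_subset_banach[OF v_shift(1)[of k]] by simp
      then show ?thesis using A by (simp add: dist_real_def)
    qed
    have "(\<lambda>r. \<Sum>l\<in>A. cmod (v (k - l)) * cmod (d r l)) \<longlonglongrightarrow> (\<Sum>l\<in>A. cmod (v (k - l)) * cmod (y l - y l))"
      unfolding d_def by (intro tendsto_intros lim)
    then have "(\<lambda>r. \<Sum>l\<in>A. cmod (v (k - l)) * cmod (d r l)) \<longlonglongrightarrow> 0" by simp
    then have "eventually (\<lambda>r. (\<Sum>l\<in>A. cmod (v (k - l)) * cmod (d r l)) < e / 2) sequentially"
      using e by (intro order_tendstoD(2)) auto
    then obtain r0 where r0: "\<And>r. r \<ge> r0 \<Longrightarrow> (\<Sum>l\<in>A. cmod (v (k - l)) * cmod (d r l)) < e / 2"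
      by (auto simp: eventually_sequentially)
    have "norm (conv (x r) k - conv y k) < e" if r: "r \<ge> r0" for r
    proof -
      let ?g = "\<lambda>l. cmod (v (k - l)) * cmod (d r l)"
      have gs: "(\<lambda>l. cmod (v (k - l) * d r l)) summable_on UNIV" by (rule conv_summable(1)[OF ds])
      have "norm (conv (x r) k - conv y k) \<le> (\<Sum>\<^sub>\<infinity>l. ?g l)"
        unfolding diff using norm_infsum_bound[OF gs] by (simp add: norm_mult)
      also have "\<dots> = infsum ?g A + infsum ?g (- A)"
        using infsum_Un_disjoint[of ?g A "- A"] summable_on_subset_banach[OF gs] by (simp add: norm_mult)
      also have "infsum ?g (- A) \<le> sqrt (infsum ?w (- A)) * sqrt (\<Sum>\<^sub>\<infinity>l\<in>-A. (cmod (d r l))\<^sup>2)"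
        using summable_on_subset_banach[OF v_shift(1)[of k]] summable_on_subset_banach[OF ds[of r]]
        by (intro infsum_cauchy_schwarz) auto
      also have "\<dots> \<le> sqrt \<epsilon> * sqrt (4 * C)"
      proof (intro mult_mono real_sqrt_le_mono tail)
        show "(\<Sum>\<^sub>\<infinity>l\<in>-A. (cmod (d r l))\<^sup>2) \<le> 4 * C"
          by (rule infsum_le_finite_sums) (use summable_on_subset_banach[OF ds[of r]] dbd in auto)
      qed (auto simp: infsum_nonneg \<epsilon> less_imp_le)
      also have "\<dots> = e / (4 * (sqrt C + 1)) * (2 * sqrt C)"
        using e sC by (simp add: \<epsilon>_def real_sqrt_mult)
      also have "\<dots> \<le> e / 2"
      proof -
        have "e / (4 * (sqrt C + 1)) * (2 * sqrt C) = e / 2 * (sqrt C / (sqrt C + 1))"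
          using sC by (simp add: divide_simps)
        also have "\<dots> \<le> e / 2 * 1" using e sC by (intro mult_left_mono) auto
        finally show ?thesis by simp
      qed
      finally show ?thesis using r0[OF r] A(1) by simp
    qed
    then show "\<exists>r0. \<forall>r\<ge>r0. norm (conv (x r) k - conv y k) < e" by blast
  qed
qed

text \<open>All coordinates of the truncated graphs are bounded by 1, so a subsequence converges
  coordinatewise; norm bound and invariance pass to the limit. The limit is at first only
  square-summable, and the invariance equation then gives the decay.\<close>

lemma invariant_graph:
  assumes nv: "nv \<le> (real n + 1) / 4"
  shows "\<exists>f. graph_family n UNIV decay f"
proof -
  let ?I = "idx n"
  have "\<forall>r. \<exists>f. graph_family n (idx (n + r)) (VM (n + r)) f"
    using galerkin[OF nv] by simp
  then obtain F where GF: "\<And>r. graph_family n (idx (n + r)) (VM (n + r)) (F r)" by metis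
  note F = graph_familyD[OF GF]
  have single: "(\<Sum>k\<in>A. (cmod (F r j k))\<^sup>2) \<le> 1" if "finite A" "A \<inter> ?I = {}" "j \<in> ?I" for r j A
    using F(4)[OF that(1,2), of "unit_seq j" r] that(3)
    by (simp add: unit_seq_def if_distrib[of cmod] if_distrib[of "\<lambda>x. x\<^sup>2"] if_distrib[of "\<lambda>x. x * _"] cong: if_cong)
  have Fbd: "cmod (F r j k) \<le> 1" if "j \<in> ?I" for r j k
  proof (cases "k \<in> ?I")
    case True
    then show ?thesis using F(2)[OF that] by (simp add: unit_seq_def)
  next
    case False
    then have "(cmod (F r j k))\<^sup>2 \<le> 1\<^sup>2" using single[of "{k}" j r] that by simp
    then show ?thesis by (rule power2_le_imp_le) simp
  qed
  \<comment> \<open>At most 1 for each mode in \<open>idx n\<close>, plus 1 for all modes outside by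
    the norm bound of the graph.\<close>
  have Fl2: "(\<Sum>k\<in>A. (cmod (F r j k))\<^sup>2) \<le> card ?I + 1" if "finite A" "j \<in> ?I" for r j A
  proof -
    have "(\<Sum>k\<in>A. (cmod (F r j k))\<^sup>2) \<le> (\<Sum>k\<in>?I \<union> (A - ?I). (cmod (F r j k))\<^sup>2)"
      using that by (intro sum_mono2) auto
    also have "\<dots> = (\<Sum>k\<in>?I. (cmod (F r j k))\<^sup>2) + (\<Sum>k\<in>A - ?I. (cmod (F r j k))\<^sup>2)"
      using that by (intro sum.union_disjoint) auto
    also have "(\<Sum>k\<in>?I. (cmod (F r j k))\<^sup>2) \<le> (\<Sum>k\<in>?I. 1)"
      using Fbd[OF that(2)] by (intro sum_mono) (simp add: power_le_one)
    also have "(\<Sum>k\<in>A - ?I. (cmod (F r j k))\<^sup>2) \<le> 1" using that by (intro single) auto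
    finally show ?thesis by simp
  qed
  have cS: "countable (?I \<times> (UNIV::int set))" by (intro countable_SIGMA) auto
  have bS: "norm (case p of (j,k) \<Rightarrow> F r j k) \<le> 1" if "p \<in> ?I \<times> (UNIV::int set)" for r p
    using that Fbd by auto
  obtain s where s: "strict_mono (s::nat\<Rightarrow>nat)"
    "\<And>p. p \<in> ?I \<times> UNIV \<Longrightarrow> \<exists>l. (\<lambda>r. case p of (j,k) \<Rightarrow> F (s r) j k) \<longlonglongrightarrow> l"
    using function_convergent_subsequence[OF cS, of "\<lambda>r p. case p of (j,k) \<Rightarrow> F r j k" 1] bS by blast
  have "\<exists>l. (\<lambda>r. F (s r) j k) \<longlonglongrightarrow> l" if "j \<in> ?I" for j k
    using s(2)[of "(j,k)"] that by simp
  then obtain f where lim: "\<And>j k. j \<in> ?I \<Longrightarrow> (\<lambda>r. F (s r) j k) \<longlonglongrightarrow> f j k" by metis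
  have f2: "f j i = unit_seq j i" if "j \<in> ?I" "i \<in> ?I" for j i
    using lim[OF that(1), of i] F(2)[OF that] by (simp add: LIMSEQ_const_iff)
  have f4: "(\<Sum>k\<in>A. (cmod (\<Sum>j\<in>?I. c j * f j k))\<^sup>2) \<le> (\<Sum>i\<in>?I. (cmod (c i))\<^sup>2)"
    if "finite A" "A \<inter> ?I = {}" for c A
    by (rule tendsto_upperbound[of "\<lambda>r. (\<Sum>k\<in>A. (cmod (\<Sum>j\<in>?I. c j * F (s r) j k))\<^sup>2)" _ sequentially])
      (use F(4)[OF that] in \<open>auto intro!: tendsto_intros lim\<close>)
  have fbd: "cmod (f j k) \<le> 1" if "j \<in> ?I" for j k
    by (rule tendsto_upperbound[OF tendsto_norm[OF lim[OF that]]]) (use Fbd[OF that] in auto)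
  note ct = conv_tendsto[where x = "\<lambda>r. F (s r) j" and y = "f j" and C = "real (card ?I + 1)" for j]
  have fl2: "(\<lambda>l. (cmod (f j l))\<^sup>2) summable_on UNIV" if "j \<in> ?I" for j
    by (rule ct(1)) (use Fl2[OF _ that] lim[OF that] in auto)
  have hl: "(\<lambda>r. hill (F (s r) j) k) \<longlonglongrightarrow> hill (f j) k" if "j \<in> ?I" for j k
    unfolding hill_def by (intro tendsto_intros lim[OF that] ct(2)) (use Fl2[OF _ that] lim[OF that] in auto)
  have f3: "hill (f j) k = (\<Sum>i\<in>?I. hill (f j) i * f i k)" if "j \<in> ?I" for j k
  proof -
    have "(\<lambda>r. \<Sum>i\<in>?I. hill (F (s r) j) i * F (s r) i k) \<longlonglongrightarrow> (\<Sum>i\<in>?I. hill (f j) i * f i k)"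
      by (intro tendsto_intros hl[OF that] lim)
    moreover have "eventually (\<lambda>r. (\<Sum>i\<in>?I. hill (F (s r) j) i * F (s r) i k) = hill (F (s r) j) k) sequentially"
    proof -
      \<comment> \<open>A fixed mode \<open>k\<close> belongs to all but finitely many truncations,
        so the invariance equation at \<open>k\<close> holds eventually.\<close>
      have "\<forall>r\<ge>nat \<bar>k\<bar>. k \<in> idx (n + s r)"
        using seq_suble[OF s(1)] by (auto simp: idx_iff) (metis le_trans nat_le_iff of_nat_mono trans_le_add2 of_nat_add)
      then show ?thesis unfolding eventually_sequentially using F(3)[OF that] by metis
    qed
    ultimately have "(\<lambda>r. hill (F (s r) j) k) \<longlonglongrightarrow> (\<Sum>i\<in>?I. hill (f j) i * f i k)"
      by (rule Lim_transform_eventually)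
    then show ?thesis using hl[OF that] LIMSEQ_unique by blast
  qed
  \<comment> \<open>\<open>hill (f j)\<close> is a combination of bounded sequences and
    \<open>conv (f j)\<close> is bounded, hence so is pi^2 k^2 f j k.\<close>
  have f1: "f j \<in> decay" if "j \<in> ?I" for j
  proof -
    have "\<forall>k. cmod (conv (f j) k) \<le> nv * sqrt (\<Sum>\<^sub>\<infinity>l. (cmod (f j l))\<^sup>2)"
      using conv_summable(3)[OF fl2[OF that]] by simp
    then obtain B where B: "\<And>k. cmod (conv (f j) k) \<le> B" by blast
    define C where "C = (\<Sum>i\<in>?I. cmod (hill (f j) i))"
    have "(1 + (of_int k)\<^sup>2) * cmod (f j k) \<le> 1 + (C + B)" for k
    proof -
      have "cmod (hill (f j) k) \<le> C"
        unfolding f3[OF that, of k] C_def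
        by (rule order_trans[OF norm_sum sum_mono]) (use fbd in \<open>auto simp: norm_mult intro!: mult_left_le\<close>)
      then have "cmod (of_real (pi\<^sup>2 * (of_int k)\<^sup>2) * f j k) \<le> C + B"
        using B[of k] norm_triangle_ineq4[of "hill (f j) k" "conv (f j) k"] by (simp add: hill_def)
      then have "pi\<^sup>2 * ((of_int k)\<^sup>2 * cmod (f j k)) \<le> C + B"
        by (simp only: norm_mult norm_of_real) (simp add: norm_mult power_mult_distrib mult.assoc abs_mult)
      moreover have "1 * ((of_int k)\<^sup>2 * cmod (f j k)) \<le> pi\<^sup>2 * ((of_int k)\<^sup>2 * cmod (f j k))"
        using pi_squared_ge by (intro mult_right_mono) auto
      ultimately show ?thesis using fbd[OF that, of k] by (simp add: distrib_right)
    qed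
    then show ?thesis by (auto simp: decay_def)
  qed
  show ?thesis unfolding graph_family_def using f1 f2 f3 f4 by (intro exI[of _ f]) blast
qed

text \<open>Finitely many vectors from these eigenspaces lie in the span of an \<open>hbasis\<close>
  with \<epsilon> = 1, which has at most \<open>card (idx n)\<close> elements. Finite subsets of a
  basis are tested to obtain finiteness, after which the basis itself can be counted.\<close>

theorem dim_gen_upper:
  assumes nv: "nv \<le> (real n + 1) / 4" and Z: "finite Z" "\<And>z. z \<in> Z \<Longrightarrow> Re z < mu n"
  shows "\<And>z. z \<in> Z \<Longrightarrow> \<exists>B. finite B \<and> hill.gen z \<subseteq> seq.span B"
    and "(\<Sum>z\<in>Z. seq.dim (hill.gen z)) \<le> 2 * n + 1"
proof -
  interpret F: form_operator sscale decay hill "hform n" "mu n" by (rule hill_form_operator[OF nv])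
  have small: "card A \<le> 2 * n + 1" if A: "finite A" "seq.independent A" "A \<subseteq> (\<Union>z\<in>{z. Re z < mu n}. hill.gen z)" for A
  proof -
    obtain B where B: "F.hbasis 1 B" "A \<subseteq> seq.span B"
      using F.hbasis_exists[of A 1] A by auto
    have "card B \<le> card (idx n)"
      using coordinates_independent(4)[OF finite_idx F.hbasis_independent[OF B(1)] negative_eq_0[OF F.form_operator_axioms _ B(1)]]
      by blast
    moreover have "card A \<le> card B"
      using seq.independent_span_bound[OF _ A(2) B(2)] B(1) by (auto simp: F.hbasis_def)
    ultimately show ?thesis by (simp add: card_idx)
  qed
  show fin: "\<exists>B. finite B \<and> hill.gen z \<subseteq> seq.span B" if "z \<in> Z" for z
  proof -
    obtain B where B: "B \<subseteq> hill.gen z" "seq.independent B" "hill.gen z \<subseteq> seq.span B"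
      by (rule seq.basis_exists)
    have "finite B \<and> card B \<le> 2 * n + 1"
    proof (rule finite_if_finite_subsets_card_bdd)
      fix A assume A: "A \<subseteq> B" "finite A"
      show "card A \<le> 2 * n + 1"
        by (rule small) (use A B seq.independent_mono Z(2)[OF that] in auto)
    qed
    then show ?thesis using B by blast
  qed
  obtain B where B: "finite B" "seq.independent B" "B \<subseteq> (\<Union>z\<in>Z. hill.gen z)" "card B = (\<Sum>z\<in>Z. seq.dim (hill.gen z))"
    using hill.gen_bases[OF Z(1) fin] by blast
  show "(\<Sum>z\<in>Z. seq.dim (hill.gen z)) \<le> 2 * n + 1"
    unfolding B(4)[symmetric] by (rule small) (use B Z in auto)
qed

text \<open>The limit graph is invariant of dimension 2 n + 1. The limit preserves only a weak
  inequality for the form; strictness returns through \<open>eigenvector_definite\<close>, which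
  puts every eigenvalue on the graph to the left of the line.\<close>

theorem dim_gen_lower:
  assumes nv: "nv \<le> (real n + 1) / 4"
  shows "\<exists>Z. finite Z \<and> (\<forall>z\<in>Z. Re z < mu n) \<and> 2 * n + 1 \<le> (\<Sum>z\<in>Z. seq.dim (hill.gen z))"
proof -
  interpret F: form_operator sscale decay hill "hform n" "mu n" by (rule hill_form_operator[OF nv])
  let ?I = "idx n"
  obtain f where gf: "graph_family n UNIV decay f" using invariant_graph[OF nv] by blast
  note f = graph_familyD[OF gf, simplified]
  define W where "W = seq.span (f ` ?I)"
  have WD: "W \<subseteq> decay" unfolding W_def using f(1) by (intro seq.span_minimal subspace_decay) auto
  have inv: "hill x \<in> W" if "x \<in> W" for x
    using that unfolding W_def
  proof (rule hill.L_span[rotated 2])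
    fix y assume "y \<in> f ` ?I"
    then obtain j where j: "j \<in> ?I" "y = f j" by auto
    have "hill y = (\<Sum>i\<in>?I. sscale (hill y i) (f i))"
      unfolding j(2) by (rule ext) (simp only: sum_seq_apply f(3)[OF j(1), symmetric])
    also have "\<dots> \<in> seq.span (f ` ?I)" by (intro seq.span_sum seq.span_scale seq.span_base) auto
    finally show "hill y \<in> seq.span (f ` ?I)" .
  qed (use f(1) in auto)
  have injf: "inj_on f ?I"
  proof (rule inj_onI)
    fix i j assume ij: "i \<in> ?I" "j \<in> ?I" "f i = f j"
    then have "unit_seq i i = unit_seq j i" using f(2) by metis
    then show "i = j" by (simp add: unit_seq_def split: if_splits)
  qed
  have ind: "seq.independent (f ` ?I)"
  proof -
    have "u (f j) = 0" if "(\<Sum>x\<in>f ` ?I. sscale (u x) x) = 0" "j \<in> ?I" for u j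
    proof -
      have "(\<Sum>i\<in>?I. u (f i) * f i j) = 0"
        using that(1) by (simp add: sum.reindex[OF injf] sum_seq_apply[of "\<lambda>i. u (f i)" f, symmetric])
      then show ?thesis using that(2) by (simp add: f(2) unit_seq_def if_distrib cong: if_cong)
    qed
    then show ?thesis by (auto simp: seq.dependent_finite)
  qed
  have nonpos: "Re (hform n x x) \<le> 0" if x: "x \<in> W" for x
  proof -
    from x obtain u where "x = (\<Sum>y\<in>f ` ?I. sscale (u y) y)" by (auto simp: W_def seq.span_finite)
    then have "x = (\<Sum>i\<in>?I. sscale (u (f i)) (f i))" by (simp add: sum.reindex[OF injf])
    then have xk: "x k = (\<Sum>i\<in>?I. u (f i) * f i k)" for k by (simp add: sum_seq_apply)
    have xc: "x i = u (f i)" if "i \<in> ?I" for i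
      unfolding xk using that by (simp add: f(2) unit_seq_def if_distrib cong: if_cong)
    let ?g = "\<lambda>k. sg n k * (cmod (x k))\<^sup>2"
    have s: "?g summable_on UNIV" using hform_diag(1) x WD by blast
    have "infsum ?g UNIV = infsum ?g ?I + infsum ?g (- ?I)"
      using infsum_Un_disjoint[of ?g ?I "- ?I"] summable_on_subset_banach[OF s] by simp
    moreover have "infsum ?g ?I = - (\<Sum>k\<in>?I. (cmod (u (f k)))\<^sup>2)"
      by (simp add: sum_negf[symmetric]) (rule sum.cong, auto simp: sg_def idx_iff xc)
    moreover have "infsum ?g (- ?I) \<le> (\<Sum>k\<in>?I. (cmod (u (f k)))\<^sup>2)"
    proof (rule infsum_le_finite_sums)
      fix A assume A: "finite A" "A \<subseteq> - ?I"
      have "sum ?g A = (\<Sum>k\<in>A. (cmod (x k))\<^sup>2)"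
        using A by (intro sum.cong) (auto simp: sg_def idx_iff)
      also have "\<dots> \<le> (\<Sum>k\<in>?I. (cmod (u (f k)))\<^sup>2)"
        unfolding xk using A by (intro f(4)) auto
      finally show "sum ?g A \<le> (\<Sum>k\<in>?I. (cmod (u (f k)))\<^sup>2)" .
    qed (use summable_on_subset_banach[OF s] in auto)
    ultimately have "infsum ?g UNIV \<le> 0" by simp
    then show ?thesis using hform_diag(2)[of x n] x WD by auto
  qed
  have "W \<subseteq> seq.span {g \<in> W. \<exists>z. g \<in> hill.gen z}"
    by (rule hill.invariant_subset_span_gen[OF _ WD inv, of "f ` ?I"]) (auto simp: W_def)
  then have "f ` ?I \<subseteq> seq.span {g \<in> W. \<exists>z. g \<in> hill.gen z}"
    using seq.span_superset[of "f ` ?I"] by (auto simp: W_def)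
  from seq.finite_subset_span[OF finite_imageI[OF finite_idx] this] obtain T where
    T: "finite T" "T \<subseteq> {g \<in> W. \<exists>z. g \<in> hill.gen z}" "f ` ?I \<subseteq> seq.span T" by (elim exE conjE)
  have "\<exists>z. Re z < mu n \<and> g \<in> hill.gen z" if gT: "g \<in> T" for g
  proof (cases "g = 0")
    \<comment> \<open>The zero vector belongs to every \<open>gen z\<close>, so any value left of
      the line will do.\<close>
    case True
    have "Re (of_real (mu n - 1)) < mu n" by simp
    then show ?thesis using True seq.subspace_0[OF hill.subspace_gen] by blast
  next
    case False
    obtain z k where z: "g \<in> hill.kerpow z k" "g \<in> W"
      using subsetD[OF T(2) gT] by (auto simp: hill.gen_def)
    then obtain x where x: "x \<in> W" "x \<noteq> 0" "hill x = sscale z x"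
      using hill.eigenvector_of_kerpow[OF z(1) False z(2) _ inv] by (auto simp: W_def)
    have "0 < (Re z - mu n) * Re (hform n x x)" using F.eigenvector_definite[of x z] x WD by auto
    then have "Re z < mu n" using nonpos[OF x(1)] by (simp add: zero_less_mult_iff)
    then show ?thesis using z by (auto simp: hill.gen_def)
  qed
  then obtain zz where zz: "\<And>g. g \<in> T \<Longrightarrow> Re (zz g) < mu n" "\<And>g. g \<in> T \<Longrightarrow> g \<in> hill.gen (zz g)" by metis
  define Z where "Z = zz ` T"
  have Z: "finite Z" "\<And>z. z \<in> Z \<Longrightarrow> Re z < mu n" using T(1) zz(1) by (auto simp: Z_def)
  obtain B where B: "finite B" "seq.span B = seq.span (\<Union>z\<in>Z. hill.gen z)" "card B = (\<Sum>z\<in>Z. seq.dim (hill.gen z))"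
    using hill.gen_bases[OF Z(1) dim_gen_upper(1)[OF nv Z]] by blast
  have "T \<subseteq> (\<Union>z\<in>Z. hill.gen z)" using zz(2) by (auto simp: Z_def)
  then have "f ` ?I \<subseteq> seq.span B" unfolding B(2) using T(3) seq.span_mono by blast
  then have "card (f ` ?I) \<le> card B" using seq.independent_span_bound[OF B(1) ind] by blast
  then show ?thesis using Z B(3) card_image[OF injf] by (intro exI[of _ Z]) (auto simp: card_idx)
qed

end

section \<open>Reduction to two modes\<close>

lemma bounded_contraction:
  fixes d :: "int \<Rightarrow> complex"
  assumes "\<And>l. cmod (d l) \<le> B" "\<And>M l. (\<And>k. cmod (d k) \<le> M) \<Longrightarrow> cmod (d l) \<le> E + M / 3"
  shows "cmod (d l) \<le> 3 / 2 * E"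
proof -
  \<comment> \<open>The supremum satisfies M \<le> E + M / 3, hence M \<le> 3/2 E; the a priori
    bound \<open>B\<close> makes it finite and then disappears.\<close>
  define M where "M = (SUP l. cmod (d l))"
  have bdd: "bdd_above (range (\<lambda>l. cmod (d l)))" by (rule bdd_aboveI2[OF assms(1)])
  have M: "cmod (d k) \<le> M" for k unfolding M_def by (rule cSUP_upper[OF _ bdd]) simp
  have "M \<le> E + M / 3" unfolding M_def[symmetric]
    by (subst (1) M_def, rule cSUP_least) (use assms(2)[OF M] in auto)
  then show ?thesis using M[of l] by simp
qed

text \<open>Banach iteration from 0, with the uniform bound C / (1 - 1/3). The Lipschitz premise may
  assume both arguments bounded, because convolution is split over a difference of bounded
  sequences.\<close>

lemma sup_contraction_fixed_point:
  fixes \<Phi> :: "(int \<Rightarrow> complex) \<Rightarrow> int \<Rightarrow> complex"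
  assumes bd: "\<And>y B l. (\<And>k. cmod (y k) \<le> B) \<Longrightarrow> cmod (\<Phi> y l) \<le> C + B / 3"
    and lip: "\<And>y y' B b b' l. (\<And>k. cmod (y k - y' k) \<le> B) \<Longrightarrow> (\<And>k. cmod (y k) \<le> b) \<Longrightarrow>
      (\<And>k. cmod (y' k) \<le> b') \<Longrightarrow> cmod (\<Phi> y l - \<Phi> y' l) \<le> B / 3"
  shows "\<exists>y B. (\<forall>k. cmod (y k) \<le> B) \<and> \<Phi> y = y"
proof -
  have C: "0 \<le> C" by (rule order_trans[OF norm_ge_zero]) (use bd[of "\<lambda>_. 0" 0 0] in simp)
  define Y where "Y r = (\<Phi> ^^ r) (\<lambda>_. 0)" for r
  have YS: "Y (Suc r) = \<Phi> (Y r)" for r by (simp add: Y_def)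
  have Ybd: "cmod (Y r k) \<le> 3 / 2 * C" for r k
  proof (induction r arbitrary: k)
    case 0
    then show ?case using C by (simp add: Y_def)
  next
    case (Suc r)
    then show ?case using bd[of "Y r" "3 / 2 * C" k] by (simp add: YS)
  qed
  have step: "cmod (Y (Suc r) k - Y r k) \<le> C * (1 / 3) ^ r" for r k
  proof (induction r arbitrary: k)
    case 0
    then show ?case using bd[of "\<lambda>_. 0" 0 k] by (simp add: Y_def)
  next
    case (Suc r)
    have "cmod (\<Phi> (Y (Suc r)) k - \<Phi> (Y r) k) \<le> C * (1 / 3) ^ r / 3"
      by (rule lip[where b = "3 / 2 * C" and b' = "3 / 2 * C"]) (use Suc Ybd in auto)
    then show ?case by (simp add: YS[symmetric])
  qed
  have geo: "summable (\<lambda>r. C * (1 / 3 :: real) ^ r)" by (intro summable_mult summable_geometric) simp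
  have "uniform_limit UNIV (\<lambda>r k. \<Sum>i<r. Y (Suc i) k - Y i k) (\<lambda>k. \<Sum>i. Y (Suc i) k - Y i k) sequentially"
    by (rule Weierstrass_m_test[OF _ geo]) (rule step)
  moreover have "(\<lambda>r k. \<Sum>i<r. Y (Suc i) k - Y i k) = Y"
    by (intro ext, subst sum_lessThan_telescope) (simp add: Y_def)
  moreover define y where "y = (\<lambda>k. \<Sum>i. Y (Suc i) k - Y i k)"
  ultimately have ul: "uniform_limit UNIV Y y sequentially" by simp
  have lim: "(\<lambda>r. Y r k) \<longlonglongrightarrow> y k" for k by (rule tendsto_uniform_limitI[OF ul]) simp
  have ybd: "cmod (y k) \<le> 3 / 2 * C" for k
    by (rule tendsto_upperbound[OF tendsto_norm[OF lim[of k]]]) (use Ybd in auto)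
  have "(\<lambda>r. Y (Suc r) l) \<longlonglongrightarrow> \<Phi> y l" for l
  proof (rule tendstoI)
    fix e :: real assume e: "e > 0"
    from uniform_limitD[OF ul e] show "eventually (\<lambda>r. dist (Y (Suc r) l) (\<Phi> y l) < e) sequentially"
    proof eventually_elim
      case (elim r)
      have "cmod (\<Phi> (Y r) l - \<Phi> y l) \<le> e / 3"
        by (rule lip[where b = "3 / 2 * C" and b' = "3 / 2 * C"])
          (use elim Ybd ybd in \<open>auto simp: dist_norm less_imp_le\<close>)
      then show ?case using e by (simp add: YS dist_norm)
    qed
  qed
  then have "\<Phi> y = y" using LIMSEQ_Suc[OF lim] LIMSEQ_unique by (intro ext) blast
  then show ?thesis using ybd by blast
qed

section \<open>The diagonal resolvent on a strip\<close>

definition in_strip :: "nat \<Rightarrow> complex \<Rightarrow> bool" where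
  "in_strip n z \<longleftrightarrow> pi\<^sup>2 * (real n - 1/2)\<^sup>2 \<le> Re z \<and> Re z \<le> pi\<^sup>2 * (real n + 1/2)\<^sup>2"

text \<open>The two resonant modes are set to 0, so that only the complement of the modes n and - n
  is inverted.\<close>

definition res :: "nat \<Rightarrow> complex \<Rightarrow> int \<Rightarrow> complex" where
  "res n z k = (if \<bar>k\<bar> = int n then 0 else 1 / (z - of_real (pi\<^sup>2 * (of_int k)\<^sup>2)))"

text \<open>Factor the difference of squares at the nearer edge of the strip. A distance j - 1/2 is
  at least j / 2 for j \<ge> 1. For \<bar>k\<bar> < n the other factor n - 1/2 + \<bar>k\<bar> is
  only known to be at least n / 2; with pi^2 \<ge> 9 this gives 9/4.\<close>

lemma strip_distance:
  assumes "in_strip n z" "n \<ge> 1" "\<bar>k\<bar> \<noteq> int n"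
  shows "9 / 4 * real n * \<bar>\<bar>of_int k\<bar> - real n\<bar> \<le> cmod (z - of_real (pi\<^sup>2 * (of_int k)\<^sup>2))"
proof -
  let ?a = "\<bar>of_int k\<bar> :: real"
  have aint: "?a = of_int \<bar>k\<bar>" by simp
  have *: "9 / 4 * real n * \<bar>?a - real n\<bar> \<le> \<bar>Re z - pi\<^sup>2 * (of_int k)\<^sup>2\<bar>"
  proof (cases "\<bar>k\<bar> > int n")
    case True
    then have j: "?a - real n \<ge> 1" by linarith
    have "9 / 4 * real n * (?a - real n) \<le> 9 * ((?a - (real n + 1/2)) * (?a + (real n + 1/2)))"
    proof -
      have "(?a - real n) / 2 * real n \<le> (?a - (real n + 1/2)) * (?a + (real n + 1/2))"
        using j by (intro mult_mono) auto
      then have "9 * ((?a - real n) / 2 * real n) \<le> 9 * ((?a - (real n + 1/2)) * (?a + (real n + 1/2)))"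
        by (intro mult_left_mono) auto
      moreover have "9 / 4 * real n * (?a - real n) \<le> 9 * ((?a - real n) / 2 * real n)"
      proof -
        have "9 * ((?a - real n) / 2 * real n) = 9 / 2 * (real n * (?a - real n))" by simp
        moreover have "0 \<le> real n * (?a - real n)" using j by (intro mult_nonneg_nonneg) auto
        ultimately show ?thesis by linarith
      qed
      ultimately show ?thesis by linarith
    qed
    also have "\<dots> \<le> pi\<^sup>2 * ((?a - (real n + 1/2)) * (?a + (real n + 1/2)))"
      using j by (intro mult_right_mono pi_squared_ge mult_nonneg_nonneg) auto
    also have "\<dots> = pi\<^sup>2 * (of_int k)\<^sup>2 - pi\<^sup>2 * (real n + 1/2)\<^sup>2"
      by (simp add: power2_eq_square algebra_simps)
    also have "\<dots> \<le> pi\<^sup>2 * (of_int k)\<^sup>2 - Re z" using assms(1) by (simp add: in_strip_def)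
    finally have "9 / 4 * real n * (?a - real n) \<le> \<bar>Re z - pi\<^sup>2 * (of_int k)\<^sup>2\<bar>" by linarith
    then show ?thesis using j by simp
  next
    case False
    then have j: "real n - ?a \<ge> 1" using assms(3) by linarith
    have "9 / 4 * real n * (real n - ?a) \<le> 9 * (((real n - 1/2) - ?a) * ((real n - 1/2) + ?a))"
    proof -
      have "(real n - ?a) / 2 * (real n / 2) \<le> ((real n - 1/2) - ?a) * ((real n - 1/2) + ?a)"
        using j assms(2) by (intro mult_mono) auto
      then show ?thesis by (simp add: mult.commute)
    qed
    also have "\<dots> \<le> pi\<^sup>2 * (((real n - 1/2) - ?a) * ((real n - 1/2) + ?a))"
      using j assms(2) by (intro mult_right_mono pi_squared_ge mult_nonneg_nonneg) auto
    also have "\<dots> = pi\<^sup>2 * (real n - 1/2)\<^sup>2 - pi\<^sup>2 * (of_int k)\<^sup>2"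
      by (simp add: power2_eq_square algebra_simps)
    also have "\<dots> \<le> Re z - pi\<^sup>2 * (of_int k)\<^sup>2" using assms(1) by (simp add: in_strip_def)
    finally have "9 / 4 * real n * (real n - ?a) \<le> \<bar>Re z - pi\<^sup>2 * (of_int k)\<^sup>2\<bar>" by linarith
    then show ?thesis using j by simp
  qed
  have "\<bar>Re z - pi\<^sup>2 * (of_int k)\<^sup>2\<bar> = \<bar>Re (z - of_real (pi\<^sup>2 * (of_int k)\<^sup>2))\<bar>" by simp
  also have "\<dots> \<le> cmod (z - of_real (pi\<^sup>2 * (of_int k)\<^sup>2))" by (rule abs_Re_le_cmod)
  finally show ?thesis using * by linarith
qed

lemma res_norm_le:
  assumes "0 < r" "r \<le> cmod (z - of_real (pi\<^sup>2 * (of_int k)\<^sup>2))"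
  shows "cmod (res n z k) \<le> 1 / r"
proof (cases "\<bar>k\<bar> = int n")
  case False
  then have "cmod (res n z k) = 1 / cmod (z - of_real (pi\<^sup>2 * (of_int k)\<^sup>2))"
    by (simp add: res_def norm_divide)
  also have "\<dots> \<le> 1 / r" by (rule frac_le) (use assms in auto)
  finally show ?thesis .
qed (use assms(1) in \<open>simp add: res_def\<close>)

text \<open>Squaring \<open>strip_distance\<close> gives 16 / (81 n^2) times inverse squares centred
  at n and at - n. Each centre contributes at most 4; the total 8 is raised to 9 so that the bound
  is the square of 4 / (3 n).\<close>

lemma res_l2:
  assumes "in_strip n z" "n \<ge> 1"
  shows "(\<lambda>k. (cmod (res n z k))\<^sup>2) summable_on UNIV"
    and "sqrt (\<Sum>\<^sub>\<infinity>k. (cmod (res n z k))\<^sup>2) \<le> 4 / (3 * real n)"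
    and "cmod (res n z k) \<le> 4 / (3 * real n)"
proof -
  let ?j = "\<lambda>m::int. 1 / (of_int m :: real)\<^sup>2"
  let ?c = "16 / (81 * (real n)\<^sup>2)"
  have n: "real n > 0" using assms(2) by simp
  have pt: "(cmod (res n z k))\<^sup>2 \<le> ?c * (?j (k - int n) + ?j (k - (- int n)))" for k
  proof (cases "\<bar>k\<bar> = int n")
    case False
    let ?d = "\<bar>\<bar>of_int k\<bar> - real n\<bar>"
    have d: "?d > 0" using False by linarith
    have "cmod (res n z k) \<le> 1 / (9 / 4 * real n * ?d)"
      using d n by (intro res_norm_le strip_distance[OF assms False]) auto
    then have "(cmod (res n z k))\<^sup>2 \<le> (1 / (9 / 4 * real n * ?d))\<^sup>2" by (intro power_mono) auto
    also have "\<dots> = ?c * (1 / ?d\<^sup>2)" by (simp add: power_mult_distrib power_divide)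
    also have "\<dots> \<le> ?c * (?j (k - int n) + ?j (k - (- int n)))"
    proof (intro mult_left_mono)
      have "?d\<^sup>2 = (of_int (k - int n))\<^sup>2 \<or> ?d\<^sup>2 = (of_int (k - (- int n)))\<^sup>2"
        by (cases "k \<ge> 0") (auto simp: power2_eq_square algebra_simps)
      then show "1 / ?d\<^sup>2 \<le> ?j (k - int n) + ?j (k - (- int n))"
        by (elim disjE) (simp_all only:, auto)
    qed simp
    finally show ?thesis .
  qed (simp add: res_def)
  have js: "(\<lambda>k. ?j (k - s)) summable_on UNIV" "(\<Sum>\<^sub>\<infinity>k. ?j (k - s)) \<le> 4" for s
    using summable_on_int_shift[of ?j s] infsum_inverse_squares_int by auto
  have s2: "(\<lambda>k. ?c * (?j (k - int n) + ?j (k - (- int n)))) summable_on UNIV"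
    by (intro summable_on_cmult_right summable_on_add js)
  show s: "(\<lambda>k. (cmod (res n z k))\<^sup>2) summable_on UNIV"
    by (rule summable_on_comparison_test[OF s2 pt]) auto
  have "(\<Sum>\<^sub>\<infinity>k. (cmod (res n z k))\<^sup>2) \<le> (\<Sum>\<^sub>\<infinity>k. ?c * (?j (k - int n) + ?j (k - (- int n))))"
    by (rule infsum_mono[OF s s2 pt])
  also have "\<dots> = ?c * ((\<Sum>\<^sub>\<infinity>k. ?j (k - int n)) + (\<Sum>\<^sub>\<infinity>k. ?j (k - (- int n))))"
    by (subst infsum_cmult_right', subst infsum_add[OF js(1) js(1)]) simp
  also have "\<dots> \<le> ?c * 9" using js(2)[of "int n"] js(2)[of "- int n"] by (intro mult_left_mono) auto
  also have "\<dots> = (4 / (3 * real n))\<^sup>2" by (simp add: power_divide power_mult_distrib)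
  finally have le: "(\<Sum>\<^sub>\<infinity>k. (cmod (res n z k))\<^sup>2) \<le> (4 / (3 * real n))\<^sup>2" .
  then show "sqrt (\<Sum>\<^sub>\<infinity>k. (cmod (res n z k))\<^sup>2) \<le> 4 / (3 * real n)"
    using n by (intro real_le_lsqrt) (auto simp: infsum_nonneg)
  have "(cmod (res n z k))\<^sup>2 \<le> (\<Sum>\<^sub>\<infinity>k. (cmod (res n z k))\<^sup>2)"
    using finite_sum_le_infsum[OF s, of "{k}"] by simp
  then have "(cmod (res n z k))\<^sup>2 \<le> (4 / (3 * real n))\<^sup>2" using le by (rule order_trans)
  then show "cmod (res n z k) \<le> 4 / (3 * real n)" by (rule power2_le_imp_le) simp
qed

lemma res_decay: "res n z \<in> decay"
proof -
  define m where "m = nat \<lceil>cmod z\<rceil> + 1"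
  define C where "C = (\<Sum>k\<in>idx m. (1 + (of_int k)\<^sup>2) * cmod (res n z k))"
  have "(1 + (of_int k)\<^sup>2) * cmod (res n z k) \<le> C + 1" for k
  proof (cases "k \<in> idx m")
    case True
    then have "(1 + (of_int k)\<^sup>2) * cmod (res n z k) \<le> C" unfolding C_def by (intro member_le_sum) auto
    then show ?thesis by simp
  next
    case False
    then have k: "real m + 1 \<le> \<bar>of_int k\<bar>" by (simp add: idx_iff)
    have zm: "cmod z \<le> real m" by (simp add: m_def) linarith
    have k2: "\<bar>of_int k\<bar> \<le> (of_int k :: real)\<^sup>2"
      using mult_mono[of 1 "\<bar>of_int k\<bar>" "\<bar>of_int k\<bar>" "\<bar>of_int k :: real\<bar>"] k by (simp add: power2_eq_square abs_mult[symmetric])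
    have "9 * (of_int k)\<^sup>2 \<le> pi\<^sup>2 * (of_int k :: real)\<^sup>2" by (intro mult_right_mono pi_squared_ge) auto
    moreover have "pi\<^sup>2 * (of_int k)\<^sup>2 - cmod z \<le> cmod (z - of_real (pi\<^sup>2 * (of_int k)\<^sup>2))"
      using norm_triangle_ineq2[of "of_real (pi\<^sup>2 * (of_int k)\<^sup>2)" z]
      by (simp add: norm_minus_commute norm_mult norm_power del: of_real_mult of_real_power) 
    ultimately have le: "1 + (of_int k)\<^sup>2 \<le> cmod (z - of_real (pi\<^sup>2 * (of_int k)\<^sup>2))" using k k2 zm by linarith
    have pos: "0 < 1 + (of_int k :: real)\<^sup>2" by (simp add: add_pos_nonneg)
    have "cmod (res n z k) \<le> 1 / (1 + (of_int k)\<^sup>2)"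
      by (rule res_norm_le[OF pos le])
    then have "(1 + (of_int k)\<^sup>2) * cmod (res n z k) \<le> 1" using pos by (simp add: field_simps)
    moreover have "0 \<le> C" unfolding C_def by (intro sum_nonneg) auto
    ultimately show ?thesis by simp
  qed
  then show ?thesis by (auto simp: decay_def)
qed

lemma decay_mult:
  assumes "f \<in> decay" "\<And>k. cmod (g k) \<le> B"
  shows "(\<lambda>k. f k * g k) \<in> decay"
proof -
  obtain C where C: "\<And>k. (1 + (of_int k)\<^sup>2) * cmod (f k) \<le> C" using decay_bound[OF assms(1)] by blast
  have "(1 + (of_int k)\<^sup>2) * cmod (f k * g k) \<le> C * B" for k
  proof -
    have "((1 + (of_int k)\<^sup>2) * cmod (f k)) * cmod (g k) \<le> C * B"
      using C[of k] assms(2)[of k] by (intro mult_mono) (auto intro: order_trans[OF _ C[of k]])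
    then show ?thesis by (simp add: norm_mult mult.assoc)
  qed
  then show ?thesis by (auto simp: decay_def)
qed

lemma unit_seq_decay: "unit_seq j \<in> decay"
proof -
  have "unit_seq j \<in> VM (nat \<bar>j\<bar>)" by (auto simp: VM_def unit_seq_def)
  then show ?thesis using VM_subset_decay by blast
qed

lemma infsum_unit_seq: "(\<Sum>\<^sub>\<infinity>k. unit_seq j k * g k) = g j"
proof -
  have "(\<Sum>\<^sub>\<infinity>k. unit_seq j k * g k) = (\<Sum>\<^sub>\<infinity>k\<in>{j}. unit_seq j k * g k)"
    by (rule infsum_cong_neutral) (auto simp: unit_seq_def)
  then show ?thesis by (simp add: unit_seq_def)
qed

section \<open>Convolution composed with the resolvent\<close>

context potential
begin

lemma conv_unit_seq: "conv (unit_seq j) k = v (k - j)"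
  using infsum_unit_seq[of j "\<lambda>l. v (k - l)"] by (simp add: conv_def mult.commute)

lemma conv_res_bound:
  assumes "in_strip n z" "n \<ge> 1" "\<And>k. cmod (g k) \<le> M"
  shows "cmod (conv (\<lambda>k. res n z k * g k) l) \<le> nv * (4 / (3 * real n)) * M"
proof -
  have M: "0 \<le> M" using assms(3)[of 0] norm_ge_zero order_trans by blast
  note r = res_l2[OF assms(1,2)]
  have s: "(\<lambda>k. (cmod (res n z k))\<^sup>2 * M\<^sup>2) summable_on UNIV" by (intro summable_on_cmult_left r(1))
  have le: "(cmod (res n z k * g k))\<^sup>2 \<le> (cmod (res n z k))\<^sup>2 * M\<^sup>2" for k
    using assms(3)[of k] by (simp add: norm_mult power_mult_distrib mult_left_mono power_mono)
  have s': "(\<lambda>k. (cmod (res n z k * g k))\<^sup>2) summable_on UNIV"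
    by (rule summable_on_comparison_test[OF s le]) auto
  have "(\<Sum>\<^sub>\<infinity>k. (cmod (res n z k * g k))\<^sup>2) \<le> (\<Sum>\<^sub>\<infinity>k. (cmod (res n z k))\<^sup>2 * M\<^sup>2)"
    by (rule infsum_mono[OF s' s le])
  also have "\<dots> = (\<Sum>\<^sub>\<infinity>k. (cmod (res n z k))\<^sup>2) * M\<^sup>2" by (rule infsum_cmult_left')
  finally have "sqrt (\<Sum>\<^sub>\<infinity>k. (cmod (res n z k * g k))\<^sup>2) \<le> sqrt ((\<Sum>\<^sub>\<infinity>k. (cmod (res n z k))\<^sup>2) * M\<^sup>2)"
    by (rule real_sqrt_le_mono)
  also have "\<dots> = sqrt (\<Sum>\<^sub>\<infinity>k. (cmod (res n z k))\<^sup>2) * M"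
    using M by (simp add: real_sqrt_mult)
  also have "\<dots> \<le> 4 / (3 * real n) * M" by (rule mult_right_mono[OF r(2) M])
  finally have "nv * sqrt (\<Sum>\<^sub>\<infinity>k. (cmod (res n z k * g k))\<^sup>2) \<le> nv * (4 / (3 * real n) * M)"
    by (rule mult_left_mono[OF _ nv_nonneg])
  then show ?thesis using conv_summable(3)[OF s', of l] by (simp add: mult.assoc)
qed

text \<open>This pairing is the bilinear integral of a product of two functions, without conjugate,
  for which multiplication by a complex \<open>q\<close> is symmetric. On coefficients the kernel v
  (- k - l) is symmetric in k and l; Fubini applies since x and y are absolutely summable and v is
  bounded.\<close>

lemma conv_symmetric:
  assumes "x \<in> decay" "y \<in> decay"
  shows "(\<Sum>\<^sub>\<infinity>k. x (- k) * conv y k) = (\<Sum>\<^sub>\<infinity>k. y (- k) * conv x k)"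
proof -
  have bij: "bij_betw uminus (UNIV::int set) UNIV"
    by (rule bij_betwI[of _ _ _ uminus]) auto
  have neg: "(\<Sum>\<^sub>\<infinity>k. g (- k)) = (\<Sum>\<^sub>\<infinity>k. g k)" for g :: "int \<Rightarrow> complex"
    using infsum_reindex_bij_betw[OF bij, of g] by simp
  have "(\<lambda>p. norm (case p of (k,l) \<Rightarrow> x k * y l)) summable_on (UNIV \<times> UNIV)"
    by (rule summable_on_SigmaI[where g = "\<lambda>k. cmod (x k) * (\<Sum>\<^sub>\<infinity>l. cmod (y l))"])
      (use decay_abs_summable[OF assms(1)] decay_abs_summable[OF assms(2)] in
        \<open>auto simp: norm_mult intro!: has_sum_cmult_right has_sum_infsum summable_on_cmult_left\<close>)
  then have s0: "(\<lambda>p. nv * norm (case p of (k,l) \<Rightarrow> x k * y l)) summable_on (UNIV \<times> UNIV)"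
    by (rule summable_on_cmult_right)
  have s: "(\<lambda>(k,l). x k * (v (- k - l) * y l)) summable_on (UNIV \<times> UNIV)"
  proof (rule abs_summable_summable, rule summable_on_comparison_test[OF s0])
    fix p :: "int \<times> int"
    show "norm (case p of (k,l) \<Rightarrow> x k * (v (- k - l) * y l)) \<le> nv * norm (case p of (k,l) \<Rightarrow> x k * y l)"
      using mult_right_mono[OF v_bounded[of "- fst p - snd p"], of "cmod (x (fst p)) * cmod (y (snd p))"]
      by (simp add: case_prod_unfold norm_mult mult_ac)
  qed auto
  have "(\<Sum>\<^sub>\<infinity>k. x (- k) * conv y k) = (\<Sum>\<^sub>\<infinity>k. x k * conv y (- k))"
    using neg[of "\<lambda>k. x k * conv y (- k)"] by simp
  also have "\<dots> = (\<Sum>\<^sub>\<infinity>k. \<Sum>\<^sub>\<infinity>l. x k * (v (- k - l) * y l))"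
    unfolding conv_def by (simp add: infsum_cmult_right')
  also have "\<dots> = (\<Sum>\<^sub>\<infinity>l. \<Sum>\<^sub>\<infinity>k. x k * (v (- k - l) * y l))"
    by (rule infsum_swap_banach[OF s])
  also have "\<dots> = (\<Sum>\<^sub>\<infinity>l. \<Sum>\<^sub>\<infinity>k. y l * (v (- l - k) * x k))"
  proof (intro infsum_cong)
    fix l k :: int
    have "v (- k - l) = v (- l - k)" by (rule arg_cong[of _ _ v]) simp
    then show "x k * (v (- k - l) * y l) = y l * (v (- l - k) * x k)" by (simp only: mult_ac)
  qed
  also have "\<dots> = (\<Sum>\<^sub>\<infinity>l. y l * conv x (- l))"
    unfolding conv_def by (simp add: infsum_cmult_right')
  also have "\<dots> = (\<Sum>\<^sub>\<infinity>k. y (- k) * conv x k)"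
    using neg[of "\<lambda>k. y k * conv x (- k)"] by simp
  finally show ?thesis .
qed

lemma conv_res_add:
  assumes "\<And>k. cmod (g k) \<le> B" "\<And>k. cmod (h k) \<le> B'"
  shows "conv (\<lambda>k. res n z k * (c * g k + d * h k)) l =
     c * conv (\<lambda>k. res n z k * g k) l + d * conv (\<lambda>k. res n z k * h k) l"
proof -
  have 1: "sscale c (\<lambda>k. res n z k * g k) \<in> decay" "sscale d (\<lambda>k. res n z k * h k) \<in> decay"
    using decay_mult[where g = g, OF res_decay assms(1)] decay_mult[where g = h, OF res_decay assms(2)]
      seq.subspace_scale[OF subspace_decay] by auto
  have "(\<lambda>k. res n z k * (c * g k + d * h k)) = sscale c (\<lambda>k. res n z k * g k) + sscale d (\<lambda>k. res n z k * h k)"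
    by (auto simp: sscale_def fun_eq_iff algebra_simps)
  then show ?thesis using conv_add[OF 1] by (simp add: conv_scale)
qed

end

text \<open>Submultiplicativity is required along the support of \<open>v\<close> only. The weight
  used later equals 1 at odd indices, where the full inequality can fail for two odd arguments, but
  \<open>v\<close> vanishes there.\<close>

locale weighted_potential = potential +
  fixes \<omega> :: "int \<Rightarrow> real"
  assumes \<omega>_ge_1: "1 \<le> \<omega> m"
    and \<omega>_submult: "v m \<noteq> 0 \<Longrightarrow> \<omega> (m + j) \<le> \<omega> m * \<omega> j"
    and \<omega>_summable: "(\<lambda>m. (\<omega> m * cmod (v m))\<^sup>2) summable_on UNIV"
begin

definition nw :: real where "nw = sqrt (\<Sum>\<^sub>\<infinity>m. (\<omega> m * cmod (v m))\<^sup>2)"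

lemma nw_nonneg: "0 \<le> nw" by (simp add: nw_def infsum_nonneg)

lemma \<omega>_pos: "0 < \<omega> m" using \<omega>_ge_1[of m] by linarith

lemma nv_le_nw: "nv \<le> nw"
  unfolding nv_def nw_def
proof (intro real_sqrt_le_mono infsum_mono v_l2 \<omega>_summable power_mono)
  show "cmod (v m) \<le> \<omega> m * cmod (v m)" for m
    using mult_right_mono[OF \<omega>_ge_1[of m], of "cmod (v m)"] by simp
qed auto

lemma weighted_v_le: "\<omega> m * cmod (v m) \<le> nw"
proof -
  have "(\<omega> m * cmod (v m))\<^sup>2 \<le> nw\<^sup>2"
    using finite_sum_le_infsum[OF \<omega>_summable, of "{m}"] by (simp add: nw_def infsum_nonneg)
  then show ?thesis using nw_nonneg by (rule power2_le_imp_le)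
qed

text \<open>The weight is anchored at \<open>s\<close>: submultiplicativity gives \<omega> (l - k)
  to \<open>v\<close> and \<omega> (k - s) to \<open>g\<close>, and Cauchy-Schwarz pairs the
  weighted \<open>v\<close> with \<open>res\<close>.\<close>

lemma weighted_row:
  assumes "in_strip n z" "n \<ge> 1" "\<And>k. \<omega> (k - s) * cmod (g k) \<le> M"
  shows "(\<lambda>k. cmod (v (l - k) * (res n z k * g k))) summable_on UNIV"
    and "\<omega> (l - s) * cmod (conv (\<lambda>k. res n z k * g k) l) \<le> nw * (4 / (3 * real n)) * M"
proof -
  have M: "0 \<le> M"
    using assms(3)[of 0] mult_nonneg_nonneg[OF less_imp_le[OF \<omega>_pos[of "0 - s"]] norm_ge_zero[of "g 0"]] by linarith
  have ws: "(\<lambda>k. (\<omega> (l - k) * cmod (v (l - k)))\<^sup>2) summable_on UNIV"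
    "(\<Sum>\<^sub>\<infinity>k. (\<omega> (l - k) * cmod (v (l - k)))\<^sup>2) = (\<Sum>\<^sub>\<infinity>m. (\<omega> m * cmod (v m))\<^sup>2)"
    using summable_on_int_shift[of "\<lambda>m. (\<omega> m * cmod (v m))\<^sup>2" l] \<omega>_summable by auto
  note r = res_l2[OF assms(1,2)]
  note cs = infsum_cauchy_schwarz[OF ws(1) r(1)]
  let ?u = "\<lambda>k. \<omega> (l - k) * cmod (v (l - k)) * cmod (res n z k)"
  have us: "?u summable_on UNIV" by (rule cs(1)) (auto simp: less_imp_le[OF \<omega>_pos])
  have uM: "(\<lambda>k. ?u k * M) summable_on UNIV" by (rule summable_on_cmult_left[OF us])
  have key: "\<omega> (l - s) * cmod (v (l - k) * (res n z k * g k)) \<le> ?u k * M" for k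
  proof (cases "v (l - k) = 0")
    case True
    then show ?thesis by simp
  next
    case False
    have "\<omega> (l - s) \<le> \<omega> (l - k) * \<omega> (k - s)"
      using \<omega>_submult[OF False, of "k - s"] by simp
    then have "\<omega> (l - s) * cmod (v (l - k) * (res n z k * g k))
        \<le> (\<omega> (l - k) * \<omega> (k - s)) * cmod (v (l - k) * (res n z k * g k))"
      by (rule mult_right_mono) simp
    also have "\<dots> = ?u k * (\<omega> (k - s) * cmod (g k))" by (simp add: norm_mult mult_ac)
    also have "\<dots> \<le> ?u k * M"
      by (intro mult_left_mono assms(3)) (simp add: less_imp_le[OF \<omega>_pos])
    finally show ?thesis .
  qed
  show s: "(\<lambda>k. cmod (v (l - k) * (res n z k * g k))) summable_on UNIV"
  proof (rule summable_on_comparison_test[OF uM])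
    fix k
    have "cmod (v (l - k) * (res n z k * g k)) \<le> \<omega> (l - s) * cmod (v (l - k) * (res n z k * g k))"
      using mult_right_mono[OF \<omega>_ge_1[of "l - s"], of "cmod (v (l - k) * (res n z k * g k))"] by simp
    then show "cmod (v (l - k) * (res n z k * g k)) \<le> ?u k * M" using key[of k] by linarith
  qed auto
  have "\<omega> (l - s) * cmod (conv (\<lambda>k. res n z k * g k) l) \<le> \<omega> (l - s) * (\<Sum>\<^sub>\<infinity>k. cmod (v (l - k) * (res n z k * g k)))"
    unfolding conv_def by (intro mult_left_mono norm_infsum_bound[OF s] less_imp_le[OF \<omega>_pos])
  also have "\<dots> = (\<Sum>\<^sub>\<infinity>k. \<omega> (l - s) * cmod (v (l - k) * (res n z k * g k)))"
    by (rule infsum_cmult_right'[symmetric])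
  also have "\<dots> \<le> (\<Sum>\<^sub>\<infinity>k. ?u k * M)"
    by (rule infsum_mono[OF summable_on_cmult_right[OF s] uM key])
  also have "\<dots> = (\<Sum>\<^sub>\<infinity>k. ?u k) * M" by (rule infsum_cmult_left')
  also have "\<dots> \<le> (nw * (4 / (3 * real n))) * M"
  proof (rule mult_right_mono[OF _ M])
    have "(\<Sum>\<^sub>\<infinity>k. ?u k) \<le> nw * sqrt (\<Sum>\<^sub>\<infinity>k. (cmod (res n z k))\<^sup>2)"
      using cs(2) ws(2) by (simp add: nw_def less_imp_le[OF \<omega>_pos])
    also have "\<dots> \<le> nw * (4 / (3 * real n))" by (rule mult_left_mono[OF r(2) nw_nonneg])
    finally show "(\<Sum>\<^sub>\<infinity>k. ?u k) \<le> nw * (4 / (3 * real n))" .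
  qed
  finally show "\<omega> (l - s) * cmod (conv (\<lambda>k. res n z k * g k) l) \<le> nw * (4 / (3 * real n)) * M" .
qed

text \<open>\<open>g\<close> is a column of V (1 - R V)^-1, with V the convolution and R the
  multiplication by \<open>res\<close>. As 4 nw / (3 n) \<le> 1/3, its weighted norm is at most nw /
  (1 - 1/3). One more application of \<open>weighted_row\<close> gives the deviation from
  \<open>v\<close>: nw (4 / (3 n)) (3/2) nw = 2 nw^2 / n.\<close>

lemma resolvent_column:
  assumes "in_strip n z" "n \<ge> 1" "nw \<le> real n / 4"
  shows "\<exists>g. (\<forall>l. g l = v (l - s) + conv (\<lambda>k. res n z k * g k) l) \<and>
    (\<forall>l. \<omega> (l - s) * cmod (g l) \<le> 3 / 2 * nw) \<and>
    (\<forall>l. \<omega> (l - s) * cmod (g l - v (l - s)) \<le> 2 * nw\<^sup>2 / real n)"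
proof -
  have n: "real n > 0" using assms(2) by simp
  have \<kappa>: "nw * (4 / (3 * real n)) \<le> 1 / 3" using assms(3) n by (simp add: field_simps)
  \<comment> \<open>\<open>y\<close> is the weighted unknown and \<open>U y\<close> the sequence
    itself; this turns the weighted norm into the plain supremum norm.\<close>
  define U where "U = (\<lambda>y k. y k / of_real (\<omega> (k - s)) :: complex)"
  have wU: "\<omega> (k - s) * cmod (U y k) = cmod (y k)" for y k
    using \<omega>_pos[of "k - s"] by (simp add: U_def norm_divide)
  define \<Phi> where "\<Phi> = (\<lambda>y l. of_real (\<omega> (l - s)) * (v (l - s) + conv (\<lambda>k. res n z k * U y k) l))"
  have Ubd: "cmod (U y k) \<le> B" if "\<And>k. cmod (y k) \<le> B" for y B k
  proof -
    have "cmod (U y k) \<le> \<omega> (k - s) * cmod (U y k)"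
      using mult_right_mono[OF \<omega>_ge_1[of "k - s"], of "cmod (U y k)"] by simp
    then show ?thesis using wU[of k y] that[of k] by simp
  qed
  have \<Phi>bd: "cmod (\<Phi> y l) \<le> nw + B / 3" if B: "\<And>k. cmod (y k) \<le> B" for y B l
  proof -
    have "cmod (\<Phi> y l) \<le> \<omega> (l - s) * (cmod (v (l - s)) + cmod (conv (\<lambda>k. res n z k * U y k) l))"
      unfolding \<Phi>_def norm_mult using \<omega>_pos[of "l - s"] by (simp add: norm_triangle_ineq mult_left_mono)
    also have "\<dots> \<le> nw + nw * (4 / (3 * real n)) * B"
      using weighted_v_le[of "l - s"] weighted_row(2)[OF assms(1,2), of s "U y" B l] wU[of _ y] B
      by (simp add: distrib_left)
    also have "\<dots> \<le> nw + 1 / 3 * B"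
      using B[of 0] by (intro add_left_mono mult_right_mono \<kappa>) (auto intro: order_trans[OF norm_ge_zero])
    finally show ?thesis by simp
  qed
  have \<Phi>lip: "cmod (\<Phi> y l - \<Phi> y' l) \<le> B / 3"
    if B: "\<And>k. cmod (y k - y' k) \<le> B" and b: "\<And>k. cmod (y k) \<le> C" "\<And>k. cmod (y' k) \<le> C'" for y y' B C C' l
  proof -
    have "conv (\<lambda>k. res n z k * U y k) l - conv (\<lambda>k. res n z k * U y' k) l = conv (\<lambda>k. res n z k * U (\<lambda>k. y k - y' k) k) l"
      using conv_res_add[where g = "U y" and h = "U y'" and n = n and z = z and c = 1 and d = "-1" and l = l, OF Ubd[of y, OF b(1)] Ubd[of y', OF b(2)]]
      by (simp add: U_def diff_divide_distrib)
    then have "\<Phi> y l - \<Phi> y' l = of_real (\<omega> (l - s)) * conv (\<lambda>k. res n z k * U (\<lambda>k. y k - y' k) k) l"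
      by (simp add: \<Phi>_def algebra_simps)
    then have "cmod (\<Phi> y l - \<Phi> y' l) = \<omega> (l - s) * cmod (conv (\<lambda>k. res n z k * U (\<lambda>k. y k - y' k) k) l)"
      using \<omega>_pos[of "l - s"] by (simp add: norm_mult)
    also have "\<dots> \<le> nw * (4 / (3 * real n)) * B"
      using weighted_row(2)[OF assms(1,2), of s "U (\<lambda>k. y k - y' k)" B l] wU[of _ "\<lambda>k. y k - y' k"] B by simp
    also have "\<dots> \<le> 1 / 3 * B"
      using B[of 0] by (intro mult_right_mono \<kappa>) (auto intro: order_trans[OF norm_ge_zero])
    finally show ?thesis by simp
  qed
  obtain y B where yB: "\<And>k. cmod (y k) \<le> B" and Y: "\<Phi> y = y"
    using sup_contraction_fixed_point[of \<Phi> nw] \<Phi>bd \<Phi>lip by metis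
  define g where "g = U y"
  have g1: "g l = v (l - s) + conv (\<lambda>k. res n z k * g k) l" for l
    using fun_cong[OF Y, of l] \<omega>_pos[of "l - s"] by (simp add: g_def U_def \<Phi>_def field_simps)
  have "cmod (y l) \<le> 3 / 2 * nw" for l
  proof (rule bounded_contraction)
    show "cmod (y l) \<le> B" for l by (rule yB)
    show "cmod (y l) \<le> nw + M / 3" if "\<And>k. cmod (y k) \<le> M" for M l
      using \<Phi>bd[where y = y, OF that, of l] Y by simp
  qed
  then have g2: "\<omega> (l - s) * cmod (g l) \<le> 3 / 2 * nw" for l unfolding g_def wU .
  have g3: "\<omega> (l - s) * cmod (g l - v (l - s)) \<le> 2 * nw\<^sup>2 / real n" for l
  proof -
    have "g l - v (l - s) = conv (\<lambda>k. res n z k * g k) l" using g1[of l] by (simp add: algebra_simps)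
    then show ?thesis using weighted_row(2)[OF assms(1,2) g2, of l] by (simp add: power2_eq_square)
  qed
  show ?thesis using g1 g2 g3 by blast
qed

lemma resolvent_column_bounded:
  assumes "\<And>l. \<omega> (l - s) * cmod (g l) \<le> 3 / 2 * nw"
  shows "cmod (g l) \<le> 3 / 2 * nw"
  using assms[of l] mult_right_mono[OF \<omega>_ge_1[of "l - s"], of "cmod (g l)"] by simp

lemma nv_contraction:
  assumes "in_strip n z" "n \<ge> 1" "nw \<le> real n / 4" "\<And>k. cmod (d k) \<le> M"
  shows "cmod (conv (\<lambda>k. res n z k * d k) l) \<le> M / 3"
proof -
  have M: "0 \<le> M" using assms(4)[of 0] norm_ge_zero order_trans by blast
  have "nv * (4 / (3 * real n)) \<le> nw * (4 / (3 * real n))" by (intro mult_right_mono nv_le_nw) auto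
  also have "\<dots> \<le> 1 / 3" using assms(2,3) by (simp add: field_simps)
  finally have "nv * (4 / (3 * real n)) * M \<le> 1 / 3 * M" using M by (rule mult_right_mono)
  with conv_res_bound[where g = d and l = l, OF assms(1,2,4)]
  have "cmod (conv (\<lambda>k. res n z k * d k) l) \<le> 1 / 3 * M" by (rule order_trans)
  then show ?thesis by simp
qed

text \<open>The two diagonal entries of the reduced two by two system agree because convolution with \<open>v\<close> is
  symmetric for the bilinear form \<open>\<Sum>k. x (- k) * y k\<close>.\<close>

lemma reduction_symmetric:
  assumes gp: "\<And>l. gp l = v (l - int n) + conv (\<lambda>k. res n z k * gp k) l" "\<And>l. cmod (gp l) \<le> B"
    and gm: "\<And>l. gm l = v (l + int n) + conv (\<lambda>k. res n z k * gm k) l" "\<And>l. cmod (gm l) \<le> B"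
  shows "gp (int n) = gm (- int n)"
proof -
  \<comment> \<open>The modes n and - n, corrected so that convolution with \<open>v\<close> gives
    \<open>gp\<close> and \<open>gm\<close>. The terms containing \<open>res\<close> agree in both
    pairings, since \<open>res\<close> is even, and cancel.\<close>
  define xp where "xp = unit_seq (int n) + (\<lambda>k. res n z k * gp k)"
  define xm where "xm = unit_seq (- int n) + (\<lambda>k. res n z k * gm k)"
  have dp: "(\<lambda>k. res n z k * gp k) \<in> decay" by (rule decay_mult[OF res_decay gp(2)])
  have dm: "(\<lambda>k. res n z k * gm k) \<in> decay" by (rule decay_mult[OF res_decay gm(2)])
  have D: "xp \<in> decay" "xm \<in> decay"
    unfolding xp_def xm_def using dp dm seq.subspace_add[OF subspace_decay] unit_seq_decay by auto
  have cp: "conv xp k = gp k" for k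
    unfolding xp_def using conv_add[OF unit_seq_decay dp] gp(1)[of k] by (simp add: conv_unit_seq)
  have cm: "conv xm k = gm k" for k
    unfolding xm_def using conv_add[OF unit_seq_decay dm] gm(1)[of k] by (simp add: conv_unit_seq)
  have res_even: "res n z (- k) = res n z k" for k by (simp add: res_def)
  have bij: "bij_betw uminus (UNIV::int set) UNIV"
    by (rule bij_betwI[of _ _ _ uminus]) auto
  have neg: "(\<lambda>k. g (- k)) summable_on UNIV \<longleftrightarrow> g summable_on UNIV" "(\<Sum>\<^sub>\<infinity>k. g (- k)) = (\<Sum>\<^sub>\<infinity>k. g k)" for g :: "int \<Rightarrow> complex"
    using infsum_reindex_bij_betw[OF bij, of g] summable_on_reindex_bij_betw[OF bij, of g] by auto
  have unit_neg: "unit_seq j (- k) = unit_seq (- j) k" for j k by (auto simp: unit_seq_def)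
  have summ: "(\<lambda>k. unit_seq j k * g k) summable_on UNIV" for j and g :: "int \<Rightarrow> complex"
    using summable_on_cong_neutral[of UNIV "{j}" "\<lambda>k. unit_seq j k * g k" "\<lambda>k. unit_seq j k * g k"]
    by (auto simp: unit_seq_def)
  have sp: "(\<lambda>k. res n z k * gp k * gm (- k)) summable_on UNIV"
    by (rule abs_summable_summable) (use decay_mult_abs_summable[OF dp, of "\<lambda>k. gm (- k)" B] gm(2) in \<open>simp add: mult_ac\<close>)
  have sm: "(\<lambda>k. res n z k * gm (- k) * gp k) summable_on UNIV" using sp by (simp add: mult_ac)
  have sm': "(\<lambda>k. res n z k * gp (- k) * gm k) summable_on UNIV"
    using neg(1)[of "\<lambda>k. res n z k * gp k * gm (- k)"] sp by (simp add: res_even)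
  have "(\<Sum>\<^sub>\<infinity>k. xm (- k) * gp k) = (\<Sum>\<^sub>\<infinity>k. unit_seq (int n) k * gp k + res n z k * gm (- k) * gp k)"
    by (simp add: xm_def unit_neg res_even algebra_simps)
  also have "\<dots> = gp (int n) + (\<Sum>\<^sub>\<infinity>k. res n z k * gm (- k) * gp k)"
    by (subst infsum_add[OF summ sm]) (simp add: infsum_unit_seq)
  finally have 1: "(\<Sum>\<^sub>\<infinity>k. xm (- k) * gp k) = gp (int n) + (\<Sum>\<^sub>\<infinity>k. res n z k * gm (- k) * gp k)" .
  have "(\<Sum>\<^sub>\<infinity>k. xp (- k) * gm k) = (\<Sum>\<^sub>\<infinity>k. unit_seq (- int n) k * gm k + res n z k * gp (- k) * gm k)"
    by (simp add: xp_def unit_neg res_even algebra_simps)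
  also have "\<dots> = gm (- int n) + (\<Sum>\<^sub>\<infinity>k. res n z k * gp (- k) * gm k)"
    by (subst infsum_add[OF summ sm']) (simp add: infsum_unit_seq)
  finally have 2: "(\<Sum>\<^sub>\<infinity>k. xp (- k) * gm k) = gm (- int n) + (\<Sum>\<^sub>\<infinity>k. res n z k * gp (- k) * gm k)" .
  have "(\<Sum>\<^sub>\<infinity>k. res n z k * gp (- k) * gm k) = (\<Sum>\<^sub>\<infinity>k. res n z k * gm (- k) * gp k)"
    using neg(2)[of "\<lambda>k. res n z k * gm (- k) * gp k"] by (simp add: res_even mult_ac)
  then show ?thesis using conv_symmetric[OF D(2,1)] 1 2 by (simp add: cp cm)
qed

text \<open>All modes of f except n and - n equal \<open>res * g\<close> with g = conv f, so g
  solves the fixed-point equation of the columns, with their two sources weighted by the resonant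
  modes of f. Uniqueness of bounded solutions makes g the same combination of gp and gm; at n and -
  n this leaves a two by two system with equal diagonal entries.\<close>

lemma reduced_equation:
  assumes "in_strip n z" "n \<ge> 1" "nw \<le> real n / 4"
    and f: "f \<in> decay" "f \<noteq> 0" "hill f = sscale z f"
    and gp: "\<And>l. gp l = v (l - int n) + conv (\<lambda>k. res n z k * gp k) l" "\<And>l. cmod (gp l) \<le> B"
    and gm: "\<And>l. gm l = v (l + int n) + conv (\<lambda>k. res n z k * gm k) l" "\<And>l. cmod (gm l) \<le> B"
  shows "(z - of_real (pi\<^sup>2 * (real n)\<^sup>2) - gp (int n))\<^sup>2 = gm (int n) * gp (- int n)"
proof -
  define g where "g = conv f"
  have fz: "(z - of_real (pi\<^sup>2 * (of_int k)\<^sup>2)) * f k = g k" for k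
    using fun_cong[OF f(3), of k] by (simp add: hill_def sscale_def g_def algebra_simps)
  have fres: "f k = res n z k * g k" if "\<bar>k\<bar> \<noteq> int n" for k
  proof -
    have "\<bar>\<bar>of_int k\<bar> - real n\<bar> > 0" using that by linarith
    then have "0 < 9 / 4 * real n * \<bar>\<bar>of_int k\<bar> - real n\<bar>" using assms(2) by (intro mult_pos_pos) auto
    then have "z - of_real (pi\<^sup>2 * (of_int k)\<^sup>2) \<noteq> 0"
      using strip_distance[OF assms(1,2) that] by auto
    then show ?thesis using fz[of k] that by (simp add: res_def field_simps del: of_real_mult of_real_power)
  qed
  obtain G where G: "\<And>k. cmod (g k) \<le> G" using conv_bounded[OF f(1)] by (auto simp: g_def)
  let ?fp = "f (int n)" and ?fm = "f (- int n)"
  have rd: "(\<lambda>k. res n z k * g k) \<in> decay" by (rule decay_mult[OF res_decay G])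
  have fdec: "f = sscale ?fp (unit_seq (int n)) + sscale ?fm (unit_seq (- int n)) + (\<lambda>k. res n z k * g k)"
  proof
    fix k
    consider "k = int n" | "k = - int n" | "\<bar>k\<bar> \<noteq> int n" by linarith
    then show "f k = (sscale ?fp (unit_seq (int n)) + sscale ?fm (unit_seq (- int n)) + (\<lambda>k. res n z k * g k)) k"
      using assms(2) fres[of k] by cases (auto simp: sscale_def unit_seq_def res_def)
  qed
  have geq: "g l = ?fp * v (l - int n) + ?fm * v (l + int n) + conv (\<lambda>k. res n z k * g k) l" for l
  proof -
    have u: "sscale c (unit_seq j) \<in> decay" for c j using unit_seq_decay seq.subspace_scale[OF subspace_decay] by blast
    have "g l = conv (sscale ?fp (unit_seq (int n)) + sscale ?fm (unit_seq (- int n)) + (\<lambda>k. res n z k * g k)) l"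
      unfolding g_def using fdec by (simp add: g_def)
    also have "\<dots> = conv (sscale ?fp (unit_seq (int n))) l + conv (sscale ?fm (unit_seq (- int n))) l + conv (\<lambda>k. res n z k * g k) l"
      using u seq.subspace_add[OF subspace_decay] rd by (simp add: conv_add)
    finally show ?thesis by (simp add: conv_scale conv_unit_seq)
  qed
  \<comment> \<open>The difference solves the homogeneous equation, so the contraction with E = 0
    makes it vanish.\<close>
  define d where "d = (\<lambda>k. g k - (?fp * gp k + ?fm * gm k))"
  have pm: "cmod (?fp * gp k + ?fm * gm k) \<le> cmod ?fp * B + cmod ?fm * B" for k
    by (rule order_trans[OF norm_triangle_ineq]) (auto simp: norm_mult intro!: add_mono mult_left_mono gp(2) gm(2))
  have d1: "d l = conv (\<lambda>k. res n z k * d k) l" for l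
  proof -
    have "(\<lambda>k. res n z k * d k) = (\<lambda>k. res n z k * (1 * g k + -1 * (?fp * gp k + ?fm * gm k)))"
      unfolding d_def by (rule ext) (simp add: algebra_simps)
    then have "conv (\<lambda>k. res n z k * d k) l = conv (\<lambda>k. res n z k * g k) l - conv (\<lambda>k. res n z k * (?fp * gp k + ?fm * gm k)) l"
      using conv_res_add[where g = g and h = "\<lambda>k. ?fp * gp k + ?fm * gm k" and n = n and z = z and c = 1 and d = "-1" and l = l, OF G pm] by (simp only:) simp
    also have "conv (\<lambda>k. res n z k * (?fp * gp k + ?fm * gm k)) l
        = ?fp * conv (\<lambda>k. res n z k * gp k) l + ?fm * conv (\<lambda>k. res n z k * gm k) l"
      by (rule conv_res_add[OF gp(2) gm(2)])
    finally show ?thesis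
      using geq[of l] gp(1)[of l] gm(1)[of l] by (simp add: d_def algebra_simps)
  qed
  have "cmod (d l) \<le> 3 / 2 * 0" for l
  proof (rule bounded_contraction)
    show "cmod (d l) \<le> G + (cmod ?fp * B + cmod ?fm * B)" for l
      unfolding d_def by (rule order_trans[OF norm_triangle_ineq4]) (intro add_mono G pm)
    show "cmod (d l) \<le> 0 + M / 3" if "\<And>k. cmod (d k) \<le> M" for M l
      using nv_contraction[where d = d and l = l, OF assms(1-3) that] d1[of l] by simp
  qed
  then have gk: "g k = ?fp * gp k + ?fm * gm k" for k by (auto simp: d_def)
  \<comment> \<open>If both resonant modes vanished, then g = 0 and with it every other mode of
    f.\<close>
  have nz: "?fp \<noteq> 0 \<or> ?fm \<noteq> 0"
  proof (rule ccontr)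
    assume a: "\<not> ?thesis"
    then have "g = (\<lambda>_. 0)" using gk by auto
    have "f k = 0" for k
    proof (cases "\<bar>k\<bar> = int n")
      case True
      then have "k = int n \<or> k = - int n" by linarith
      then show ?thesis using a by auto
    qed (simp add: fres \<open>g = (\<lambda>_. 0)\<close>)
    then have "f = 0" by (simp add: fun_eq_iff)
    then show False using f(2) by simp
  qed
  define x where "x = z - of_real (pi\<^sup>2 * (real n)\<^sup>2) - gp (int n)"
  have sym: "gp (int n) = gm (- int n)" by (rule reduction_symmetric[OF gp gm])
  have e1: "x * ?fp = ?fm * gm (int n)"
    using fz[of "int n"] gk[of "int n"] by (simp add: x_def algebra_simps)
  have e2: "x * ?fm = ?fp * gp (- int n)"
    using fz[of "- int n"] gk[of "- int n"] by (simp add: x_def sym algebra_simps)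
  have "x\<^sup>2 * ?fp = gm (int n) * gp (- int n) * ?fp" "x\<^sup>2 * ?fm = gm (int n) * gp (- int n) * ?fm"
    using e1 e2 by (metis mult.assoc mult.commute power2_eq_square)+
  then show ?thesis using nz by (auto simp: x_def)
qed

text \<open>The resolvent identity turns d = g1 - g2 into a solution of d = V R2 (e + d), with R2
  the multiplication by \<open>res n z2\<close> and \<bar>e\<bar> \<le> \<bar>z1 - z2\<bar> / 2. The
  contraction factor 1/3 gives E = \<bar>z1 - z2\<bar> / 6, and 3/2 E is a quarter of the
  distance.\<close>

lemma column_lipschitz:
  assumes z: "in_strip n z1" "in_strip n z2" "n \<ge> 1" "nw \<le> real n / 4"
    and g1: "\<And>l. g1 l = b l + conv (\<lambda>k. res n z1 k * g1 k) l" "\<And>l. cmod (g1 l) \<le> 3 / 2 * nw"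
    and g2: "\<And>l. g2 l = b l + conv (\<lambda>k. res n z2 k * g2 k) l" "\<And>l. cmod (g2 l) \<le> 3 / 2 * nw"
  shows "cmod (g1 l - g2 l) \<le> cmod (z1 - z2) / 4"
proof -
  have n: "real n > 0" using z(3) by simp
  define d where "d = (\<lambda>k. g1 k - g2 k)"
  have dbd: "cmod (d k) \<le> 3 / 2 * nw + 3 / 2 * nw" for k
    unfolding d_def by (rule order_trans[OF norm_triangle_ineq4]) (intro add_mono g1(2) g2(2))
  define e where "e = (\<lambda>k. (z2 - z1) * (res n z1 k * g1 k))"
  have resdiff: "res n z1 k - res n z2 k = (z2 - z1) * res n z1 k * res n z2 k" for k
  proof (cases "\<bar>k\<bar> = int n")
    case False
    have "\<bar>\<bar>of_int k\<bar> - real n\<bar> > 0" using False by linarith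
    then have "0 < 9 / 4 * real n * \<bar>\<bar>of_int k\<bar> - real n\<bar>" using z(3) by (intro mult_pos_pos) auto
    then have "z1 - of_real (pi\<^sup>2 * (of_int k)\<^sup>2) \<noteq> 0" "z2 - of_real (pi\<^sup>2 * (of_int k)\<^sup>2) \<noteq> 0"
      using strip_distance[OF z(1,3) False] strip_distance[OF z(2,3) False] by auto
    then show ?thesis using False by (simp add: res_def field_simps del: of_real_mult of_real_power)
  qed (simp add: res_def)
  have ebd: "cmod (e k) \<le> cmod (z1 - z2) * (4 / (3 * real n) * (3 / 2 * nw))" for k
  proof -
    have "cmod (res n z1 k) * cmod (g1 k) \<le> 4 / (3 * real n) * (3 / 2 * nw)"
      by (intro mult_mono res_l2(3)[OF z(1,3)] g1(2)) auto
    from mult_left_mono[OF this, of "cmod (z1 - z2)"] show ?thesis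
      by (simp add: e_def norm_mult norm_minus_commute[of z2])
  qed
  have deq: "d l = conv (\<lambda>k. res n z2 k * (1 * e k + 1 * d k)) l" for l
  proof -
    have "res n z1 k * g1 k + (- 1) * (res n z2 k * g2 k) = res n z2 k * (1 * e k + 1 * d k)" for k
    proof -
      have "res n z1 k * g1 k = res n z2 k * g1 k + (res n z1 k - res n z2 k) * g1 k" by (simp add: algebra_simps)
      then show ?thesis unfolding resdiff by (simp add: e_def d_def algebra_simps)
    qed
    then have "(\<lambda>k. res n z2 k * (1 * e k + 1 * d k)) = (\<lambda>k. res n z1 k * g1 k) + sscale (-1) (\<lambda>k. res n z2 k * g2 k)"
      by (auto simp: fun_eq_iff sscale_def)
    then have "conv (\<lambda>k. res n z2 k * (1 * e k + 1 * d k)) l =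
        conv ((\<lambda>k. res n z1 k * g1 k) + sscale (-1) (\<lambda>k. res n z2 k * g2 k)) l" by (simp only:)
    moreover have "(\<lambda>k. res n z1 k * g1 k) \<in> decay" "sscale (-1) (\<lambda>k. res n z2 k * g2 k) \<in> decay"
      using decay_mult[where g = g1, OF res_decay g1(2)] decay_mult[where g = g2, OF res_decay g2(2)]
      by (blast intro: seq.subspace_scale[OF subspace_decay])+
    ultimately have "conv (\<lambda>k. res n z2 k * (1 * e k + 1 * d k)) l
      = conv (\<lambda>k. res n z1 k * g1 k) l - conv (\<lambda>k. res n z2 k * g2 k) l"
      by (simp only: conv_add conv_scale) simp
    then show ?thesis using g1(1)[of l] g2(1)[of l] by (simp add: d_def)
  qed
  have small: "nw * (4 / (3 * real n)) \<le> 1 / 3" using z(4) n by (simp add: field_simps)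
  have "cmod (d l) \<le> 3 / 2 * (cmod (z1 - z2) / 6)" for l
  proof (rule bounded_contraction[OF dbd])
    fix M l assume M: "\<And>k. cmod (d k) \<le> M"
    have "d l = conv (\<lambda>k. res n z2 k * e k) l + conv (\<lambda>k. res n z2 k * d k) l"
      using conv_res_add[where g = e and h = d and n = n and z = z2 and c = 1 and d = 1 and l = l, OF ebd dbd] deq[of l] by simp
    then have "cmod (d l) \<le> cmod (conv (\<lambda>k. res n z2 k * e k) l) + cmod (conv (\<lambda>k. res n z2 k * d k) l)"
      using norm_triangle_ineq by metis
    also have "cmod (conv (\<lambda>k. res n z2 k * d k) l) \<le> M / 3"
      by (rule nv_contraction[OF z(2-4) M])
    also have "cmod (conv (\<lambda>k. res n z2 k * e k) l) \<le> (cmod (z1 - z2) * (4 / (3 * real n) * (3 / 2 * nw))) / 3"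
      by (rule nv_contraction[OF z(2-4) ebd])
    also have "\<dots> \<le> cmod (z1 - z2) / 6"
    proof -
      have "4 / (3 * real n) * (3 / 2 * nw) \<le> 1 / 2" using small by (simp add: mult.commute)
      from mult_left_mono[OF this norm_ge_zero[of "z1 - z2"]] have "cmod (z1 - z2) * (4 / (3 * real n) * (3 / 2 * nw)) / 3 \<le> cmod (z1 - z2) * (1 / 2) / 3"
        by (rule divide_right_mono) simp
      also have "\<dots> = cmod (z1 - z2) / 6" by simp
      finally show ?thesis .
    qed
    finally show "cmod (d l) \<le> cmod (z1 - z2) / 6 + M / 3" by simp
  qed
  then show ?thesis by (simp add: d_def)
qed

text \<open>Each eigenvalue satisfies its own reduced equation, whose right side evaluates the
  columns at distance 2 n from their base modes, hence the weight \<open>W\<close>. Comparing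
  absolute values avoids a choice of square roots.\<close>

theorem gap_bound:
  assumes z: "in_strip n z1" "in_strip n z2" "n \<ge> 1" "nw \<le> real n / 4"
    and f1: "f1 \<in> decay" "f1 \<noteq> 0" "hill f1 = sscale z1 f1"
    and f2: "f2 \<in> decay" "f2 \<noteq> 0" "hill f2 = sscale z2 f2"
    and W: "\<omega> (2 * int n) = W" "\<omega> (- 2 * int n) = W"
  shows "W\<^sup>2 * (cmod (z1 - z2))\<^sup>2 \<le>
    9 * ((W * cmod (v (2 * int n)) + 2 * nw\<^sup>2 / real n) * (W * cmod (v (- 2 * int n)) + 2 * nw\<^sup>2 / real n))"
proof -
  let ?P = "W * cmod (v (2 * int n)) + 2 * nw\<^sup>2 / real n" and ?M = "W * cmod (v (- 2 * int n)) + 2 * nw\<^sup>2 / real n"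
  have W0: "W > 0" using \<omega>_pos[of "2 * int n"] W by simp
  have PM: "0 \<le> ?P" "0 \<le> ?M" using W0 by auto
  define col where "col = (\<lambda>z g. (\<forall>l. g l = v (l - int n) + conv (\<lambda>k. res n z k * g k) l) \<and> (\<forall>l. cmod (g l) \<le> 3 / 2 * nw))"
  have red: "\<exists>gp. col z gp \<and>
      W * cmod (z - of_real (pi\<^sup>2 * (real n)\<^sup>2) - gp (int n)) \<le> sqrt (?P * ?M)"
    if zs: "in_strip n z" and f: "f \<in> decay" "f \<noteq> 0" "hill f = sscale z f" for z f
  proof -
    obtain gp where gp: "\<And>l. gp l = v (l - int n) + conv (\<lambda>k. res n z k * gp k) l"
      "\<And>l. \<omega> (l - int n) * cmod (gp l) \<le> 3 / 2 * nw"
      "\<And>l. \<omega> (l - int n) * cmod (gp l - v (l - int n)) \<le> 2 * nw\<^sup>2 / real n"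
      using resolvent_column[OF zs z(3,4), of "int n"] by blast
    obtain gm where gm: "\<And>l. gm l = v (l - (- int n)) + conv (\<lambda>k. res n z k * gm k) l"
      "\<And>l. \<omega> (l - (- int n)) * cmod (gm l) \<le> 3 / 2 * nw"
      "\<And>l. \<omega> (l - (- int n)) * cmod (gm l - v (l - (- int n))) \<le> 2 * nw\<^sup>2 / real n"
      using resolvent_column[OF zs z(3,4), of "- int n"] by blast
    note bp = resolvent_column_bounded[OF gp(2)] and bm = resolvent_column_bounded[OF gm(2)]
    let ?x = "z - of_real (pi\<^sup>2 * (real n)\<^sup>2) - gp (int n)"
    have gm': "gm l = v (l + int n) + conv (\<lambda>k. res n z k * gm k) l" for l using gm(1)[of l] by simp
    have x: "?x\<^sup>2 = gm (int n) * gp (- int n)"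
      by (rule reduced_equation[OF zs z(3,4) f gp(1) bp gm' bm])
    have tri: "W * cmod a \<le> W * cmod b + r" if "W * cmod (a - b) \<le> r" for a b r
      using that mult_left_mono[OF norm_triangle_sub[of a b], of W] W0 by (simp add: distrib_left)
    have "W * cmod (gm (int n)) \<le> ?P"
      using gm(3)[of "int n"] W by (intro tri) simp
    moreover have "W * cmod (gp (- int n)) \<le> ?M"
      using gp(3)[of "- int n"] W by (intro tri) simp
    ultimately have "(W * cmod (gm (int n))) * (W * cmod (gp (- int n))) \<le> ?P * ?M"
      using PM W0 by (intro mult_mono) auto
    then have "(W * cmod ?x)\<^sup>2 \<le> ?P * ?M"
      using arg_cong[OF x, of cmod] by (simp add: norm_mult norm_power power_mult_distrib power2_eq_square mult_ac)
    then have "W * cmod ?x \<le> sqrt (?P * ?M)" using W0 by (intro real_le_rsqrt)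
    moreover have "col z gp" unfolding col_def using gp(1) bp by blast
    ultimately show ?thesis by blast
  qed
  obtain g1 where c1: "col z1 g1" and d1: "W * cmod (z1 - of_real (pi\<^sup>2 * (real n)\<^sup>2) - g1 (int n)) \<le> sqrt (?P * ?M)"
    using red[OF z(1) f1] by blast
  obtain g2 where c2: "col z2 g2" and d2: "W * cmod (z2 - of_real (pi\<^sup>2 * (real n)\<^sup>2) - g2 (int n)) \<le> sqrt (?P * ?M)"
    using red[OF z(2) f2] by blast
  have g1: "g1 l = v (l - int n) + conv (\<lambda>k. res n z1 k * g1 k) l" "cmod (g1 l) \<le> 3 / 2 * nw" for l
    using c1 unfolding col_def by blast+
  have g2: "g2 l = v (l - int n) + conv (\<lambda>k. res n z2 k * g2 k) l" "cmod (g2 l) \<le> 3 / 2 * nw" for l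
    using c2 unfolding col_def by blast+
  let ?x1 = "z1 - of_real (pi\<^sup>2 * (real n)\<^sup>2) - g1 (int n)" and ?x2 = "z2 - of_real (pi\<^sup>2 * (real n)\<^sup>2) - g2 (int n)"
  have lip: "cmod (g1 (int n) - g2 (int n)) \<le> cmod (z1 - z2) / 4"
    by (rule column_lipschitz[OF z g1(1,2) g2(1,2)])
  have "z1 - z2 = ?x1 - ?x2 + (g1 (int n) - g2 (int n))" by simp
  then have "cmod (z1 - z2) \<le> cmod (?x1 - ?x2) + cmod (g1 (int n) - g2 (int n))" by (metis norm_triangle_ineq)
  also have "\<dots> \<le> cmod ?x1 + cmod ?x2 + cmod (z1 - z2) / 4"
    by (intro add_mono norm_triangle_ineq4 lip)
  finally have "3 / 4 * cmod (z1 - z2) \<le> cmod ?x1 + cmod ?x2" by simp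
  then have "W * (3 / 4 * cmod (z1 - z2)) \<le> W * (cmod ?x1 + cmod ?x2)" using W0 by (intro mult_left_mono) auto
  also have "\<dots> \<le> 2 * sqrt (?P * ?M)" using d1 d2 by (simp add: distrib_left)
  finally have "3 / 4 * (W * cmod (z1 - z2)) \<le> 2 * sqrt (?P * ?M)" by (simp only: mult.left_commute)
  moreover have "0 \<le> sqrt (?P * ?M)" using PM by (intro real_sqrt_ge_zero mult_nonneg_nonneg)
  \<comment> \<open>The Lipschitz term absorbed a quarter of the gap. The exact factor 2 / (3/4) =
    8/3 is rounded up to 3.\<close>
  ultimately have "W * cmod (z1 - z2) \<le> 3 * sqrt (?P * ?M)" by linarith
  then have "(W * cmod (z1 - z2))\<^sup>2 \<le> (3 * sqrt (?P * ?M))\<^sup>2" using W0 by (intro power_mono) auto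
  also have "\<dots> = 9 * (?P * ?M)" using PM by (simp add: power_mult_distrib)
  finally show ?thesis by (simp add: power_mult_distrib)
qed

end

section \<open>Fourier series\<close>

definition md :: "int \<Rightarrow> real \<Rightarrow> complex" where "md k x = cis (pi * of_int k * x)"

lemma md_0 [simp]: "md 0 x = 1" by (simp add: md_def)
lemma md_at_0 [simp]: "md k 0 = 1" by (simp add: md_def)
lemma norm_md [simp]: "cmod (md k x) = 1" by (simp add: md_def)
lemma md_mult: "md k x * md l x = md (k + l) x" by (simp add: md_def cis_mult algebra_simps)

lemma md_shift: "md k (x + 2) = md k x"
proof -
  have "cis (pi * of_int k * 2) = 1"
    using cis_multiple_2pi[of "of_int k"] by (simp add: mult.commute mult.left_commute)
  then have "md k x * cis (pi * of_int k * 2) = md k x" by simp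
  then show ?thesis by (simp add: md_def cis_mult algebra_simps)
qed

lemma md_shift_1: "md k (x + 1) = (-1) ^ nat \<bar>k\<bar> * md k x"
proof -
  have "cis (pi * of_int k) = (-1) ^ nat \<bar>k\<bar>"
    using sin_int_times_real cos_int_times_real by (auto simp: complex_eq_iff cos_integer_2pi mult.commute)
  then show ?thesis by (simp add: md_def cis_mult[symmetric] algebra_simps)
qed

lemma continuous_md [continuous_intros]: "continuous_on A (md k)"
  unfolding md_def by (intro continuous_intros)

lemma md_vector_derivative: "(md k has_vector_derivative \<i> * of_real (pi * of_int k) * md k x) (at x within A)"
proof -
  let ?c = "pi * of_int k :: real"
  have "((\<lambda>z. exp (\<i> * of_real ?c * z)) has_field_derivative \<i> * of_real ?c * exp (\<i> * of_real ?c * of_real x)) (at (of_real x))"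
    by (auto intro!: derivative_eq_intros)
  from has_vector_derivative_real_field[OF this, of A] show ?thesis
    by (simp add: md_def[abs_def] cis_conv_exp mult_ac)
qed

section \<open>Fourier coefficients and integration by parts\<close>

definition cf :: "(real \<Rightarrow> complex) \<Rightarrow> int \<Rightarrow> complex" where
  "cf h k = integral {0..2} (\<lambda>x. h x * md (- k) x) / 2"

lemma absolutely_integrable_continuous_mult:
  fixes h g :: "real \<Rightarrow> complex"
  assumes "h absolutely_integrable_on {a..b}" "continuous_on {a..b} g"
  shows "(\<lambda>x. h x * g x) absolutely_integrable_on {a..b}"
proof -
  have "(\<lambda>x. g x * h x) absolutely_integrable_on {a..b}"
  proof (rule absolutely_integrable_bounded_measurable_product[OF bilinear_times])
    show "g \<in> borel_measurable (lebesgue_on {a..b})"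
      using assms(2) by (intro continuous_imp_measurable_on_sets_lebesgue) auto
    show "bounded (g ` {a..b})"
      using assms(2) compact_continuous_image compact_imp_bounded compact_Icc by blast
  qed (use assms(1) in auto)
  then show ?thesis by (simp add: mult.commute)
qed

lemma mult_mode_integrable:
  assumes "h absolutely_integrable_on {a..b}"
  shows "(\<lambda>x. h x * md k x) absolutely_integrable_on {a..b}" "(\<lambda>x. h x * md k x) integrable_on {a..b}"
  using absolutely_integrable_continuous_mult[OF assms continuous_md]
  by (auto simp: absolutely_integrable_on_def)

lemma cf_mode: "cf (md j) k = (if j = k then 1 else 0)"
proof (cases "j = k")
  case True
  have "cf (md j) k = integral {0..2} (\<lambda>x::real. 1 :: complex) / 2"
    unfolding cf_def md_mult using True by simp
  then show ?thesis using True by (simp add: scaleR_conv_of_real)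
next
  case False
  let ?m = "j - k"
  have "((\<lambda>x. \<i> * of_real (pi * of_int ?m) * md ?m x) has_integral (md ?m 2 - md ?m 0)) {0..2}"
    by (rule fundamental_theorem_of_calculus[OF _ md_vector_derivative]) simp
  moreover have "md ?m 2 = 1" using md_shift[of ?m 0] by simp
  ultimately have "((\<lambda>x. \<i> * of_real (pi * of_int ?m) * md ?m x) has_integral 0) {0..2}" by simp
  from has_integral_mult_right[OF this, of "1 / (\<i> * of_real (pi * of_int ?m))"]
  have "((\<lambda>x. md ?m x) has_integral 0) {0..2}" using False by simp
  then have "integral {0..2} (md ?m) = 0" by (simp add: integral_unique)
  then show ?thesis unfolding cf_def md_mult using False by simp
qed

text \<open>Replaces differentiation below, where \<open>F\<close> is a primitive of a function that is merely integrable.\<close>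

lemma eq_of_quadratic_increments:
  fixes D :: "real \<Rightarrow> complex" and \<Phi> :: "real \<Rightarrow> real"
  assumes "a \<le> b"
    and "\<And>x y. a \<le> x \<Longrightarrow> x \<le> y \<Longrightarrow> y \<le> b \<Longrightarrow> cmod (D y - D x) \<le> K * (y - x) * (\<Phi> y - \<Phi> x)"
  shows "D b = D a"
proof -
  have bd: "cmod (D b - D a) \<le> K * (b - a) * (\<Phi> b - \<Phi> a) * (1 / real (Suc N))" for N
  proof -
    let ?n = "Suc N"
    define t where "t i = a + real i * ((b - a) / real ?n)" for i
    have t0: "t 0 = a" "t ?n = b" by (simp_all add: t_def)
    have t3: "t (Suc i) - t i = (b - a) / real ?n" for i
    proof -
      have "real (Suc i) = real i + 1" by simp
      then show ?thesis unfolding t_def by (simp only: distrib_right mult_1_left)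
    qed
    have dn: "0 \<le> (b - a) / real ?n" using assms(1) by simp
    have ti: "a \<le> t i" "t i \<le> t (Suc i)" "t (Suc i) - t i = (b - a) / real ?n" for i
    proof -
      show "a \<le> t i" unfolding t_def using mult_nonneg_nonneg[OF _ dn, of "real i"] by (simp del: of_nat_Suc)
      show "t i \<le> t (Suc i)" using t3[of i] dn by linarith
    qed (rule t3)
    have tb: "t (Suc i) \<le> b" if "i < ?n" for i
    proof -
      have "real (Suc i) * ((b - a) / real ?n) \<le> real ?n * ((b - a) / real ?n)"
        using that assms(1) by (intro mult_right_mono) auto
      then show ?thesis by (simp add: t_def)
    qed
    have "D b - D a = (\<Sum>i<?n. D (t (Suc i)) - D (t i))"
      by (subst sum_lessThan_telescope) (simp only: t0)
    then have "cmod (D b - D a) \<le> (\<Sum>i<?n. cmod (D (t (Suc i)) - D (t i)))" by (simp only: norm_sum)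
    also have "\<dots> \<le> (\<Sum>i<?n. K * ((b - a) / real ?n) * (\<Phi> (t (Suc i)) - \<Phi> (t i)))"
      using assms(2)[OF ti(1,2) tb] by (intro sum_mono) (simp only: ti(3) lessThan_iff)
    also have "\<dots> = K * ((b - a) / real ?n) * (\<Sum>i<?n. \<Phi> (t (Suc i)) - \<Phi> (t i))"
      by (simp only: sum_distrib_left)
    also have "(\<Sum>i<?n. \<Phi> (t (Suc i)) - \<Phi> (t i)) = \<Phi> b - \<Phi> a"
      by (subst sum_lessThan_telescope) (simp only: t0)
    finally show ?thesis by simp
  qed
  have "(\<lambda>N. K * (b - a) * (\<Phi> b - \<Phi> a) * (1 / real (Suc N))) \<longlonglongrightarrow> K * (b - a) * (\<Phi> b - \<Phi> a) * 0"
    by (intro tendsto_intros LIMSEQ_Suc[OF lim_1_over_n])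
  then have "cmod (D b - D a) \<le> 0"
    by (intro tendsto_lowerbound[of _ 0 sequentially]) (use bd in auto)
  then show ?thesis by simp
qed

lemma norm_md_diff: "x \<le> y \<Longrightarrow> cmod (md k y - md k x) \<le> \<bar>pi * of_int k\<bar> * (y - x)"
proof -
  assume xy: "x \<le> y"
  have "((\<lambda>x. \<i> * of_real (pi * of_int k) * md k x) has_integral (md k y - md k x)) {x..y}"
    by (rule fundamental_theorem_of_calculus[OF xy md_vector_derivative])
  from has_integral_bound_real[OF _ _ this, of "\<bar>pi * of_int k\<bar>" "{}"] xy
  show ?thesis by (simp add: norm_mult)
qed

text \<open>\<open>F\<close> is absolutely continuous but need not be differentiable everywhere.
  \<open>D x\<close> is, up to a constant, the defect of the formula on {a..x}; over a short
  interval it changes by at most a constant times the length times the integral of \<bar>h\<bar>,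
  and such increments add up to 0.\<close>

lemma integration_by_parts_mode:
  fixes h F :: "real \<Rightarrow> complex"
  assumes h: "h absolutely_integrable_on {a..b}" and ab: "a \<le> b"
    and F: "\<And>x y. a \<le> x \<Longrightarrow> x \<le> y \<Longrightarrow> y \<le> b \<Longrightarrow> (h has_integral (F y - F x)) {x..y}"
  shows "integral {a..b} (\<lambda>x. h x * md k x) =
    F b * md k b - F a * md k a - integral {a..b} (\<lambda>x. F x * (\<i> * of_real (pi * of_int k) * md k x))"
proof -
  let ?c = "\<bar>pi * of_int k\<bar>" and ?g' = "\<lambda>x. \<i> * of_real (pi * of_int k) * md k x"
  have hi: "h integrable_on {a..b}" and hn: "(\<lambda>x. cmod (h x)) integrable_on {a..b}"
    using h by (auto simp: absolutely_integrable_on_def)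
  have Fc: "continuous_on {a..b} F"
  proof -
    have "continuous_on {a..b} (\<lambda>x. F a + integral {a..x} h)"
      by (intro continuous_intros indefinite_integral_continuous_1 hi)
    then show ?thesis
    proof (rule continuous_on_eq)
      fix x assume "x \<in> {a..b}"
      then show "F a + integral {a..x} h = F x" using integral_unique[OF F[of a x]] by simp
    qed
  qed
  have gc: "continuous_on {a..b} ?g'" by (intro continuous_intros)
  have i1: "(\<lambda>x. h x * md k x) integrable_on {a..b}" by (rule mult_mode_integrable(2)[OF h])
  have i2: "(\<lambda>x. F x * ?g' x) integrable_on {a..b}"
    by (intro integrable_continuous_real continuous_on_mult Fc gc)
  define D where "D x = integral {a..x} (\<lambda>x. h x * md k x) + integral {a..x} (\<lambda>x. F x * ?g' x) - F x * md k x" for x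
  define \<Phi> where "\<Phi> x = integral {a..x} (\<lambda>x. cmod (h x))" for x
  have "D b = D a"
  proof (rule eq_of_quadratic_increments[OF ab])
    fix x y assume xy: "a \<le> x" "x \<le> y" "y \<le> b"
    have sub: "u integrable_on {x..y}" if "u integrable_on {a..b}" for u :: "real \<Rightarrow> complex"
      using integrable_subinterval_real[OF that] xy by auto
    have subr: "u integrable_on {x..y}" "u integrable_on {a..y}" if "u integrable_on {a..b}" for u :: "real \<Rightarrow> real"
      using integrable_subinterval_real[OF that] xy by auto
    have diff: "integral {a..y} u - integral {a..x} u = integral {x..y} u" if "u integrable_on {a..b}" for u :: "real \<Rightarrow> complex"
    proof -
      have "u integrable_on {a..y}" using integrable_subinterval_real[OF that] xy by auto
      from Henstock_Kurzweil_Integration.integral_combine[OF xy(1,2) this] show ?thesis by (simp add: algebra_simps)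
    qed
    have \<Phi>diff: "\<Phi> y - \<Phi> x = integral {x..y} (\<lambda>x. cmod (h x))"
      unfolding \<Phi>_def using Henstock_Kurzweil_Integration.integral_combine[OF xy(1,2) subr(2)[OF hn]] by simp
    have Fd: "cmod (F y - F t) \<le> \<Phi> y - \<Phi> x" if t: "x \<le> t" "t \<le> y" for t
    proof -
      have "cmod (F y - F t) = cmod (integral {t..y} h)" using F[of t y] t xy by (simp add: integral_unique)
      also have "\<dots> \<le> integral {t..y} (\<lambda>x. cmod (h x))"
        using integrable_subinterval_real[OF hi, of t y] integrable_subinterval_real[OF hn, of t y] t xy
        by (intro integral_norm_bound_integral) auto
      also have "\<dots> \<le> integral {x..y} (\<lambda>x. cmod (h x))"
        using subr(1)[OF hn] integrable_subinterval_real[OF hn, of t y] t xy by (intro integral_subset_le) auto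
      finally show ?thesis by (simp add: \<Phi>diff)
    qed
    have gx: "(?g' has_integral (md k y - md k x)) {x..y}"
      by (rule fundamental_theorem_of_calculus[OF xy(2) md_vector_derivative])
    \<comment> \<open>Freezing \<open>md k\<close> at x and \<open>F\<close> at y makes both
      integrands small, while the subtracted terms recombine to F y md k y - F x md k x.\<close>
    have I1: "((\<lambda>t. h t * (md k t - md k x)) has_integral
        (integral {x..y} (\<lambda>t. h t * md k t) - (F y - F x) * md k x)) {x..y}"
      using has_integral_diff[OF integrable_integral[OF sub[OF i1]] has_integral_mult_left[OF F[OF xy], of "md k x"]]
      by (simp add: algebra_simps)
    have I2: "((\<lambda>t. (F t - F y) * ?g' t) has_integral
        (integral {x..y} (\<lambda>t. F t * ?g' t) - F y * (md k y - md k x))) {x..y}"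
      using has_integral_diff[OF integrable_integral[OF sub[OF i2]] has_integral_mult_right[OF gx, of "F y"]]
      by (simp add: algebra_simps)
    have b1: "cmod (integral {x..y} (\<lambda>t. h t * md k t) - (F y - F x) * md k x) \<le> ?c * (y - x) * (\<Phi> y - \<Phi> x)"
    proof -
      have "cmod (integral {x..y} (\<lambda>t. h t * (md k t - md k x))) \<le> integral {x..y} (\<lambda>t. ?c * (y - x) * cmod (h t))"
      proof (rule integral_norm_bound_integral)
        show "(\<lambda>t. h t * (md k t - md k x)) integrable_on {x..y}" using I1 by (rule has_integral_integrable)
        show "(\<lambda>t. ?c * (y - x) * cmod (h t)) integrable_on {x..y}"
          using integrable_cmul[OF subr(1)[OF hn], of "?c * (y - x)"] by simp
        fix t assume t: "t \<in> {x..y}"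
        have "cmod (md k t - md k x) \<le> ?c * (t - x)" using t by (intro norm_md_diff) auto
        also have "\<dots> \<le> ?c * (y - x)" using t by (intro mult_left_mono) auto
        finally have "cmod (h t) * cmod (md k t - md k x) \<le> cmod (h t) * (?c * (y - x))" by (rule mult_left_mono) simp
        then show "cmod (h t * (md k t - md k x)) \<le> ?c * (y - x) * cmod (h t)" by (simp add: norm_mult mult_ac)
      qed
      then show ?thesis unfolding \<Phi>diff using integral_unique[OF I1] by simp
    qed
    have b2: "cmod (integral {x..y} (\<lambda>t. F t * ?g' t) - F y * (md k y - md k x)) \<le> ?c * (y - x) * (\<Phi> y - \<Phi> x)"
    proof -
      have "cmod (integral {x..y} (\<lambda>t. F t * ?g' t) - F y * (md k y - md k x)) \<le> ((\<Phi> y - \<Phi> x) * ?c) * Henstock_Kurzweil_Integration.content {x..y}"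
      proof (rule has_integral_bound_real[OF _ _ I2, of _ "{}"])
        have "0 \<le> \<Phi> y - \<Phi> x" unfolding \<Phi>diff by (intro integral_nonneg subr hn) auto
        then show "0 \<le> (\<Phi> y - \<Phi> x) * ?c" by simp
        fix t assume t: "t \<in> {x..y} - {}"
        show "cmod ((F t - F y) * ?g' t) \<le> (\<Phi> y - \<Phi> x) * ?c"
          using Fd[of t] t by (simp add: norm_mult norm_minus_commute abs_mult mult_right_mono)
      qed simp_all
      then show ?thesis using xy by (simp add: mult_ac)
    qed
    have "D y - D x = (integral {x..y} (\<lambda>t. h t * md k t) - (F y - F x) * md k x)
        + (integral {x..y} (\<lambda>t. F t * ?g' t) - F y * (md k y - md k x))"
      unfolding D_def using diff[OF i1] diff[OF i2] by (simp add: algebra_simps)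
    then have "cmod (D y - D x) \<le> ?c * (y - x) * (\<Phi> y - \<Phi> x) + ?c * (y - x) * (\<Phi> y - \<Phi> x)"
      using norm_triangle_mono[OF b1 b2] by simp
    then show "cmod (D y - D x) \<le> (2 * ?c) * (y - x) * (\<Phi> y - \<Phi> x)" by (simp add: mult_ac)
  qed
  then show ?thesis by (simp add: D_def algebra_simps)
qed

lemma cf_derivative:
  assumes h: "h absolutely_integrable_on {0..2}"
    and F: "\<And>x y. 0 \<le> x \<Longrightarrow> x \<le> y \<Longrightarrow> y \<le> 2 \<Longrightarrow> (h has_integral (F y - F x)) {x..y}" and "F 2 = F 0"
  shows "cf h k = \<i> * of_real (pi * of_int k) * cf F k"
proof -
  have m2: "md (- k) 2 = 1" using md_shift[of "- k" 0] by simp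
  have "integral {0..2} (\<lambda>x. h x * md (- k) x) =
      F 2 * md (- k) 2 - F 0 * md (- k) 0 - integral {0..2} (\<lambda>x. F x * (\<i> * of_real (pi * of_int (- k)) * md (- k) x))"
    by (rule integration_by_parts_mode[OF h _ F]) auto
  also have "\<dots> = - integral {0..2} (\<lambda>x. (- \<i> * of_real (pi * of_int k)) * (F x * md (- k) x))"
    using m2 assms(3) by (simp add: mult_ac)
  also have "\<dots> = \<i> * of_real (pi * of_int k) * integral {0..2} (\<lambda>x. F x * md (- k) x)"
    by (subst integral_mult_right) simp
  finally show ?thesis by (simp add: cf_def)
qed

section \<open>Trigonometric approximation and uniqueness\<close>

inductive trig_poly :: "(real \<Rightarrow> complex) \<Rightarrow> bool" where
  mode: "trig_poly (\<lambda>x. c * md k x)"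
| add: "trig_poly p \<Longrightarrow> trig_poly r \<Longrightarrow> trig_poly (\<lambda>x. p x + r x)"

lemma trig_poly_const: "trig_poly (\<lambda>x. c)"
  using trig_poly.mode[of c 0] by simp

lemma trig_poly_mult: "trig_poly p \<Longrightarrow> trig_poly r \<Longrightarrow> trig_poly (\<lambda>x. p x * r x)"
proof (induction p rule: trig_poly.induct)
  case (mode c k)
  from mode show ?case
  proof (induction r rule: trig_poly.induct)
    case (mode d l)
    have "(\<lambda>x. c * md k x * (d * md l x)) = (\<lambda>x. (c * d) * md (k + l) x)"
      by (simp add: fun_eq_iff md_mult[symmetric] mult_ac)
    then show ?case using trig_poly.mode by metis
  next
    case (add p r)
    then show ?case using trig_poly.add by (fastforce simp: distrib_left)
  qed
next
  case (add p r')
  then show ?case using trig_poly.add by (fastforce simp: distrib_right)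
qed

text \<open>A real-linear function of a point on the circle is a combination of cosine and sine,
  hence of the modes 1 and - 1; products are covered by \<open>trig_poly_mult\<close>.\<close>

lemma trig_poly_of_polynomial:
  assumes "real_polynomial_function p"
  shows "trig_poly (\<lambda>x. of_real (p (md 1 x)))"
  using assms
proof (induction rule: real_polynomial_function.induct)
  case (linear p)
  interpret bounded_linear p by fact
  define \<alpha> where "\<alpha> = (of_real (p 1) - \<i> * of_real (p \<i>)) / 2"
  define \<beta> where "\<beta> = (of_real (p 1) + \<i> * of_real (p \<i>)) / 2"
  have "of_real (p (md 1 x)) = \<alpha> * md 1 x + \<beta> * md (- 1) x" for x
  proof -
    have "md 1 x = Re (md 1 x) *\<^sub>R 1 + Im (md 1 x) *\<^sub>R \<i>" by (simp add: complex_eq_iff)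
    then have "p (md 1 x) = Re (md 1 x) * p 1 + Im (md 1 x) * p \<i>"
      using add[of "Re (md 1 x) *\<^sub>R 1" "Im (md 1 x) *\<^sub>R \<i>"] scaleR[of "Re (md 1 x)" 1] scaleR[of "Im (md 1 x)" \<i>] by simp
    then show ?thesis by (simp add: \<alpha>_def \<beta>_def md_def complex_eq_iff algebra_simps add_divide_distrib[symmetric])
  qed
  then show ?case using trig_poly.add[OF trig_poly.mode[of \<alpha> 1] trig_poly.mode[of \<beta> "-1"]] by simp
next
  case (const c)
  then show ?case by (rule trig_poly_const)
next
  case (add f g)
  then show ?case using trig_poly.add by fastforce
next
  case (mult f g)
  then show ?case using trig_poly_mult by fastforce
qed

lemma periodic_int:
  fixes f :: "real \<Rightarrow> 'a"
  assumes "\<And>x. f (x + p) = f x"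
  shows "f (x + of_int k * p) = f x"
proof -
  have n: "f (x + real n * p) = f x" for n x
  proof (induction n arbitrary: x)
    case (Suc n)
    have "f (x + real (Suc n) * p) = f ((x + real n * p) + p)" by (simp add: algebra_simps)
    then show ?case using assms Suc by simp
  qed simp
  show ?thesis
  proof (cases "k \<ge> 0")
    case True
    then show ?thesis using n[of x "nat k"] by simp
  next
    case False
    then show ?thesis using n[of "x + of_int k * p" "nat (- k)"] by simp
  qed
qed

text \<open>A function of period 2 is a function on the unit circle, where Stone-Weierstrass
  applies. \<open>Arg\<close> jumps on the negative axis; continuity there is obtained with the
  branch \<open>Arg2pi\<close>, which gives the same \<open>F\<close> by periodicity.\<close>

lemma trig_approximation:
  fixes f :: "real \<Rightarrow> complex"
  assumes "continuous_on UNIV f" "\<And>x. f (x + 2) = f x" "e > 0"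
  shows "\<exists>p. trig_poly p \<and> (\<forall>x. cmod (f x - p x) < e)"
proof -
  define F where "F z = f (Arg z / pi)" for z
  have same: "f (s / pi) = f (t / pi)" if "cis s = cis t" for s t
  proof -
    have "sin s = sin t \<and> cos s = cos t" using that by (simp add: complex_eq_iff)
    then obtain n :: int where "s = t + 2 * pi * of_int n" using sin_cos_eq_iff[of s t] by auto
    then have "s / pi = t / pi + of_int n * 2" by (simp add: field_simps)
    then show ?thesis using periodic_int[of f 2 "t / pi" n] assms(2) by simp
  qed
  have Fcis: "F (cis t) = f (t / pi)" for t
    unfolding F_def by (rule same) (simp add: cis_Arg)
  have fc: "isCont f x" for x using assms(1) by (simp add: continuous_on_eq_continuous_at)
  have "continuous (at z) F" if "z \<in> sphere 0 1" for z
  proof (cases "z \<in> \<real>\<^sub>\<le>\<^sub>0")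
    case False
    have "isCont (\<lambda>z. Arg z / pi) z" using continuous_at_Arg[OF False] by (intro continuous_intros) auto
    then show ?thesis unfolding F_def using isCont_o2[OF _ fc] by blast
  next
    case True
    moreover have "z \<noteq> 0" using that by auto
    ultimately have nn: "z \<notin> \<real>\<^sub>\<ge>\<^sub>0" by (auto simp: complex_nonpos_Reals_iff complex_nonneg_Reals_iff complex_eq_iff)
    have "isCont (\<lambda>z. Arg2pi z / pi) z" using continuous_at_Arg2pi[OF nn] by (intro continuous_intros) auto
    then have "isCont (\<lambda>z. f (Arg2pi z / pi)) z" using isCont_o2[OF _ fc] by blast
    moreover have "(\<lambda>z. f (Arg2pi z / pi)) = F"
    proof
      fix z
      show "f (Arg2pi z / pi) = F z"
      proof (cases "z = 0")
        case False
        then have "cis (Arg2pi z) = cis (Arg z)"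
          using Arg2pi_eq[of z] Arg_eq[of z] by (metis cis_conv_exp mult_left_cancel norm_eq_zero of_real_eq_0_iff)
        then show ?thesis unfolding F_def by (rule same)
      qed (simp add: F_def Arg_def Arg2pi_def)
    qed
    ultimately show ?thesis by simp
  qed
  then have "continuous_on (sphere 0 1) F" by (simp add: continuous_at_imp_continuous_on)
  from Stone_Weierstrass_polynomial_function[OF compact_sphere this assms(3)]
  obtain g where g: "polynomial_function g" "\<And>z. z \<in> sphere 0 1 \<Longrightarrow> cmod (F z - g z) < e" by blast
  define p where "p x = g (md 1 x)" for x
  have "real_polynomial_function (Re \<circ> g)" "real_polynomial_function (Im \<circ> g)"
    using g(1) bounded_linear_Re bounded_linear_Im by (auto simp: polynomial_function_def)
  then have "trig_poly (\<lambda>x. of_real ((Re \<circ> g) (md 1 x)) + \<i> * of_real ((Im \<circ> g) (md 1 x)))"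
    by (intro trig_poly.add trig_poly_mult[OF trig_poly_const] trig_poly_of_polynomial)
  moreover have "(\<lambda>x. of_real ((Re \<circ> g) (md 1 x)) + \<i> * of_real ((Im \<circ> g) (md 1 x))) = p"
    by (auto simp: p_def complex_eq[symmetric])
  moreover have "cmod (f x - p x) < e" for x
    using g(2)[of "md 1 x"] Fcis[of "pi * x"] by (simp add: p_def md_def)
  ultimately show ?thesis by auto
qed

text \<open>The integral of f p vanishes for every trigonometric polynomial p; letting p approximate
  the conjugate of f makes the integral of \<bar>f\<bar>^2 vanish.\<close>

lemma fourier_uniqueness:
  fixes f :: "real \<Rightarrow> complex"
  assumes f: "continuous_on UNIV f" "\<And>x. f (x + 2) = f x" and cf: "\<And>k. cf f k = 0"
  shows "f x = 0"
proof -
  have fc: "continuous_on {0..2} f" using f(1) continuous_on_subset by blast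
  have fa: "f absolutely_integrable_on {0..2}" by (rule absolutely_integrable_continuous_real[OF fc])
  have trig: "((\<lambda>x. f x * p x) has_integral 0) {0..2}" if "trig_poly p" for p
    using that
  proof (induction rule: trig_poly.induct)
    case (mode c k)
    have "((\<lambda>x. f x * md k x) has_integral integral {0..2} (\<lambda>x. f x * md k x)) {0..2}"
      by (rule integrable_integral[OF mult_mode_integrable(2)[OF fa]])
    moreover have "integral {0..2} (\<lambda>x. f x * md k x) = 0" using cf[of "- k"] by (simp add: cf_def)
    ultimately have "((\<lambda>x. f x * md k x) has_integral 0) {0..2}" by simp
    from has_integral_mult_right[OF this, of c] show ?case by (simp add: mult_ac)
  next
    case (add p r)
    from has_integral_add[OF add.IH] show ?case by (simp add: distrib_left)
  qed
  define M where "M = integral {0..2} (\<lambda>x. cmod (f x))"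
  have Mi: "(\<lambda>x. cmod (f x)) integrable_on {0..2}" using fa by (simp add: absolutely_integrable_on_def)
  have M0: "0 \<le> M" unfolding M_def by (rule integral_nonneg[OF Mi]) simp
  have cc: "continuous_on {0..2} (\<lambda>x. f x * cnj (f x))" by (intro continuous_intros fc)
  have ci: "continuous_on UNIV (\<lambda>x. cnj (f x))" by (intro continuous_intros f(1))
  have small: "cmod (integral {0..2} (\<lambda>x. f x * cnj (f x))) \<le> e * M" if e: "e > 0" for e
  proof -
    have per: "cnj (f (x + 2)) = cnj (f x)" for x using f(2) by simp
    obtain p where p: "trig_poly p" "\<And>x. cmod (cnj (f x) - p x) < e"
      using trig_approximation[OF ci per e] by blast
    have hi: "((\<lambda>x. f x * cnj (f x) - f x * p x) has_integral (integral {0..2} (\<lambda>x. f x * cnj (f x)) - 0)) {0..2}"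
      by (intro has_integral_diff integrable_integral integrable_continuous_real cc trig[OF p(1)])
    have "cmod (integral {0..2} (\<lambda>x. f x * cnj (f x) - f x * p x)) \<le> integral {0..2} (\<lambda>x. e * cmod (f x))"
    proof (rule integral_norm_bound_integral)
      show "(\<lambda>x. f x * cnj (f x) - f x * p x) integrable_on {0..2}" using hi by (rule has_integral_integrable)
      show "(\<lambda>x. e * cmod (f x)) integrable_on {0..2}" using integrable_cmul[OF Mi, of e] by simp
      fix x
      have "cmod (f x) * cmod (cnj (f x) - p x) \<le> cmod (f x) * e" using p(2)[of x] by (intro mult_left_mono) auto
      then show "cmod (f x * cnj (f x) - f x * p x) \<le> e * cmod (f x)"
        by (simp add: right_diff_distrib[symmetric] norm_mult mult.commute)
    qed
    then show ?thesis using integral_unique[OF hi] by (simp add: M_def)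
  qed
  have "cmod (integral {0..2} (\<lambda>x. f x * cnj (f x))) \<le> 0"
  proof (rule field_le_epsilon)
    fix e :: real assume e: "e > 0"
    have "e / (M + 1) * M \<le> e" using M0 e by (simp add: field_simps)
    then show "cmod (integral {0..2} (\<lambda>x. f x * cnj (f x))) \<le> 0 + e"
      using small[of "e / (M + 1)"] M0 e by simp
  qed
  then have "integral {0..2} (\<lambda>x. f x * cnj (f x)) = 0" by simp
  then have "((\<lambda>x. f x * cnj (f x)) has_integral 0) {0..2}"
    using integrable_integral[OF integrable_continuous_real[OF cc]] by simp
  then have "((\<lambda>x. Re (f x * cnj (f x))) has_integral Re 0) {0..2}" by (rule has_integral_Re)
  then have "integral {0..2} (\<lambda>x. (cmod (f x))\<^sup>2) = 0"
    by (intro integral_unique) (simp add: cmod_power2[unfolded power2_eq_square] power2_eq_square)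
  moreover have "continuous_on {0..2} (\<lambda>x. (cmod (f x))\<^sup>2)" by (intro continuous_intros fc)
  ultimately have "\<forall>x\<in>{0..2}. (cmod (f x))\<^sup>2 = 0"
    using integral_eq_0_iff[of 0 2 "\<lambda>x. (cmod (f x))\<^sup>2"] by simp
  then have z: "f x = 0" if "x \<in> {0..2}" for x using that by simp
  have "f x = f (x + of_int (- \<lfloor>x / 2\<rfloor>) * 2)" using periodic_int[of f 2 x "- \<lfloor>x / 2\<rfloor>"] f(2) by simp
  also have "x + of_int (- \<lfloor>x / 2\<rfloor>) * 2 \<in> {0..2}"
    using floor_correct[of "x / 2"] by (auto simp: field_simps)
  then have "f (x + of_int (- \<lfloor>x / 2\<rfloor>) * 2) = 0" by (rule z)
  finally show ?thesis .
qed

section \<open>Absolutely convergent Fourier series\<close>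

definition synth :: "(int \<Rightarrow> complex) \<Rightarrow> real \<Rightarrow> complex" where
  "synth a x = (\<Sum>\<^sub>\<infinity>k. a k * md k x)"

lemma synth_summable:
  assumes "a \<in> decay"
  shows "(\<lambda>k. cmod (a k * md k x)) summable_on UNIV" "(\<lambda>k. a k * md k x) summable_on UNIV"
proof -
  show 1: "(\<lambda>k. cmod (a k * md k x)) summable_on UNIV" using decay_abs_summable[OF assms] by (simp add: norm_mult)
  show "(\<lambda>k. a k * md k x) summable_on UNIV" by (rule abs_summable_summable[OF 1])
qed

text \<open>The bound does not depend on x, so partial sums over finite sets converge uniformly.
  This yields continuity and integration term by term.\<close>

lemma synth_tail:
  assumes "a \<in> decay" "finite A"
  shows "cmod (synth a x - (\<Sum>k\<in>A. a k * md k x)) \<le> (\<Sum>\<^sub>\<infinity>k. cmod (a k)) - (\<Sum>k\<in>A. cmod (a k))"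
proof -
  note s = synth_summable[OF assms(1), of x]
  have "synth a x = (\<Sum>k\<in>A. a k * md k x) + (\<Sum>\<^sub>\<infinity>k\<in>-A. a k * md k x)"
    unfolding synth_def using infsum_Un_disjoint[of "\<lambda>k. a k * md k x" A "- A"] summable_on_subset_banach[OF s(2)] assms(2) by simp
  then have "cmod (synth a x - (\<Sum>k\<in>A. a k * md k x)) = cmod (\<Sum>\<^sub>\<infinity>k\<in>-A. a k * md k x)" by simp
  also have "\<dots> \<le> (\<Sum>\<^sub>\<infinity>k\<in>-A. cmod (a k * md k x))"
    by (rule norm_infsum_bound) (rule summable_on_subset_banach[OF s(1)], simp)
  also have "\<dots> = (\<Sum>\<^sub>\<infinity>k\<in>-A. cmod (a k))" by (simp add: norm_mult)
  also have "\<dots> = (\<Sum>\<^sub>\<infinity>k. cmod (a k)) - (\<Sum>k\<in>A. cmod (a k))"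
    using infsum_Un_disjoint[of "\<lambda>k. cmod (a k)" A "- A"] summable_on_subset_banach[OF decay_abs_summable[OF assms(1)]] assms(2) by simp
  finally show ?thesis .
qed

lemma synth_tail_tendsto:
  assumes "a \<in> decay"
  shows "((\<lambda>A. (\<Sum>\<^sub>\<infinity>k. cmod (a k)) - (\<Sum>k\<in>A. cmod (a k))) \<longlongrightarrow> 0) (finite_subsets_at_top UNIV)"
proof -
  have "((\<lambda>A. \<Sum>k\<in>A. cmod (a k)) \<longlongrightarrow> (\<Sum>\<^sub>\<infinity>k. cmod (a k))) (finite_subsets_at_top UNIV)"
    by (rule infsum_tendsto[OF decay_abs_summable[OF assms]])
  from tendsto_diff[OF tendsto_const[of "\<Sum>\<^sub>\<infinity>k. cmod (a k)"] this] show ?thesis by simp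
qed

lemma continuous_synth:
  assumes "a \<in> decay"
  shows "continuous_on UNIV (synth a)"
proof (rule uniform_limit_theorem)
  show "\<forall>\<^sub>F A in finite_subsets_at_top UNIV. continuous_on UNIV (\<lambda>x. \<Sum>k\<in>A. a k * md k x)"
    by (intro always_eventually allI continuous_intros)
  show "uniform_limit UNIV (\<lambda>A x. \<Sum>k\<in>A. a k * md k x) (synth a) (finite_subsets_at_top UNIV)"
  proof (rule uniform_limitI)
    fix e :: real assume e: "e > 0"
    have "\<forall>\<^sub>F A in finite_subsets_at_top UNIV. (\<Sum>\<^sub>\<infinity>k. cmod (a k)) - (\<Sum>k\<in>A. cmod (a k)) < e"
      using order_tendstoD(2)[OF synth_tail_tendsto[OF assms] e] .
    moreover have "\<forall>\<^sub>F A in finite_subsets_at_top (UNIV::int set). finite A"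
      by (rule eventually_finite_subsets_at_top_weakI)
    ultimately show "\<forall>\<^sub>F A in finite_subsets_at_top UNIV. \<forall>x\<in>UNIV. dist (\<Sum>k\<in>A. a k * md k x) (synth a x) < e"
    proof eventually_elim
      case (elim A)
      show ?case using synth_tail[OF assms elim(2)] elim(1)
        by (auto simp: dist_norm norm_minus_commute intro: le_less_trans)
    qed
  qed
qed simp

lemma synth_periodic: "synth a (x + 2) = synth a x"
  by (simp add: synth_def md_shift)

lemma synth_add: "a \<in> decay \<Longrightarrow> b \<in> decay \<Longrightarrow> synth (a + b) x = synth a x + synth b x"
  unfolding synth_def by (simp add: infsum_add[OF synth_summable(2) synth_summable(2), symmetric] distrib_right)

lemma synth_scale: "synth (sscale c a) x = c * synth a x"
  unfolding synth_def sscale_def by (simp add: infsum_cmult_right'[symmetric] mult_ac)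

lemma integral_mult_synth:
  assumes h: "h absolutely_integrable_on {0..2}" and a: "a \<in> decay"
  shows "integral {0..2} (\<lambda>x. h x * synth a x) = (\<Sum>\<^sub>\<infinity>l. a l * integral {0..2} (\<lambda>x. h x * md l x))"
proof -
  define H where "H = integral {0..2} (\<lambda>x. cmod (h x))"
  have Hi: "(\<lambda>x. cmod (h x)) integrable_on {0..2}" using h by (simp add: absolutely_integrable_on_def)
  let ?I = "integral {0..2} (\<lambda>x. h x * synth a x)"
  let ?t = "\<lambda>A. (\<Sum>\<^sub>\<infinity>k. cmod (a k)) - (\<Sum>k\<in>A. cmod (a k))"
  have si: "(\<lambda>x. h x * synth a x) integrable_on {0..2}"
    using absolutely_integrable_continuous_mult[OF h continuous_on_subset[OF continuous_synth[OF a]]]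
    by (simp add: absolutely_integrable_on_def)
  have bd: "cmod ((\<Sum>l\<in>A. a l * integral {0..2} (\<lambda>x. h x * md l x)) - ?I) \<le> ?t A * H" if A: "finite A" for A
  proof -
    have 1: "((\<lambda>x. \<Sum>l\<in>A. a l * (h x * md l x)) has_integral (\<Sum>l\<in>A. a l * integral {0..2} (\<lambda>x. h x * md l x))) {0..2}"
      by (intro has_integral_sum A has_integral_mult_right integrable_integral mult_mode_integrable(2)[OF h])
    have 2: "((\<lambda>x. (\<Sum>l\<in>A. a l * (h x * md l x)) - h x * synth a x) has_integral
        ((\<Sum>l\<in>A. a l * integral {0..2} (\<lambda>x. h x * md l x)) - ?I)) {0..2}"
      by (rule has_integral_diff[OF 1 integrable_integral[OF si]])
    have "cmod (integral {0..2} (\<lambda>x. (\<Sum>l\<in>A. a l * (h x * md l x)) - h x * synth a x)) \<le> integral {0..2} (\<lambda>x. ?t A * cmod (h x))"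
    proof (rule integral_norm_bound_integral)
      show "(\<lambda>x. (\<Sum>l\<in>A. a l * (h x * md l x)) - h x * synth a x) integrable_on {0..2}"
        using 2 by (rule has_integral_integrable)
      show "(\<lambda>x. ?t A * cmod (h x)) integrable_on {0..2}" using integrable_cmul[OF Hi, of "?t A"] by simp
      fix x
      have "(\<Sum>l\<in>A. a l * (h x * md l x)) - h x * synth a x = h x * ((\<Sum>l\<in>A. a l * md l x) - synth a x)"
        by (simp add: right_diff_distrib sum_distrib_left mult_ac)
      then have "cmod ((\<Sum>l\<in>A. a l * (h x * md l x)) - h x * synth a x) = cmod (h x) * cmod (synth a x - (\<Sum>l\<in>A. a l * md l x))"
        by (simp add: norm_mult norm_minus_commute)
      also have "\<dots> \<le> cmod (h x) * ?t A" by (intro mult_left_mono synth_tail[OF a A]) simp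
      finally show "cmod ((\<Sum>l\<in>A. a l * (h x * md l x)) - h x * synth a x) \<le> ?t A * cmod (h x)" by (simp only: mult.commute)
    qed
    then show ?thesis using integral_unique[OF 2] by (simp add: H_def)
  qed
  have "((\<lambda>A. ?t A * H) \<longlongrightarrow> 0 * H) (finite_subsets_at_top UNIV)"
    by (intro tendsto_intros synth_tail_tendsto[OF a])
  then have t0: "((\<lambda>A. ?t A * H) \<longlongrightarrow> 0) (finite_subsets_at_top UNIV)" by simp
  have "((\<lambda>A. (\<Sum>l\<in>A. a l * integral {0..2} (\<lambda>x. h x * md l x)) - ?I) \<longlongrightarrow> 0) (finite_subsets_at_top UNIV)"
    by (rule Lim_null_comparison[OF _ t0]) (rule eventually_finite_subsets_at_top_weakI, rule bd)
  then have "((\<lambda>l. a l * integral {0..2} (\<lambda>x. h x * md l x)) has_sum ?I) UNIV"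
    unfolding has_sum_def by (simp add: LIM_zero_iff)
  then show ?thesis by (simp add: infsumI)
qed

lemma cf_synth:
  assumes "a \<in> decay" shows "cf (synth a) k = a k"
proof -
  have "cf (synth a) k = integral {0..2} (\<lambda>x. md (- k) x * synth a x) / 2" by (simp add: cf_def mult.commute)
  also have "\<dots> = (\<Sum>\<^sub>\<infinity>l. a l * integral {0..2} (\<lambda>x. md (- k) x * md l x)) / 2"
    by (subst integral_mult_synth[OF _ assms]) (auto intro!: absolutely_integrable_continuous_real continuous_intros)
  also have "\<dots> = (\<Sum>\<^sub>\<infinity>l. a l * cf (md l) k)"
    unfolding cf_def using infsum_cmult_left'[of "\<lambda>l. a l * integral {0..2} (\<lambda>x. md (- k) x * md l x)" "1/2" UNIV]
    by (simp add: mult.commute)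
  also have "\<dots> = (\<Sum>\<^sub>\<infinity>l. unit_seq k l * a l)"
    by (intro infsum_cong) (simp add: cf_mode unit_seq_def)
  finally show ?thesis by (simp add: infsum_unit_seq)
qed

lemma synth_inj:
  assumes "a \<in> decay" "b \<in> decay" "synth a = synth b" shows "a = b"
  using cf_synth[OF assms(1)] cf_synth[OF assms(2)] assms(3) by (simp add: fun_eq_iff)

lemma fourier_inversion:
  assumes "continuous_on UNIV f" "\<And>x. f (x + 2) = f x" "cf f \<in> decay"
  shows "f = synth (cf f)"
proof
  fix x
  have "f x - synth (cf f) x = 0"
  proof (rule fourier_uniqueness)
    show "continuous_on UNIV (\<lambda>x. f x - synth (cf f) x)" by (intro continuous_intros assms(1) continuous_synth[OF assms(3)])
    show "f (x + 2) - synth (cf f) (x + 2) = f x - synth (cf f) x" for x by (simp add: assms(2) synth_periodic)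
    fix k
    have i: "(\<lambda>x. u x * md (- k) x) integrable_on {0..2}" if "continuous_on UNIV u" for u
      by (rule mult_mode_integrable(2)[OF absolutely_integrable_continuous_real[OF continuous_on_subset[OF that]]]) simp
    have "cf (\<lambda>x. f x - synth (cf f) x) k = cf f k - cf (synth (cf f)) k"
      using Henstock_Kurzweil_Integration.integral_diff[OF i[OF assms(1)] i[OF continuous_synth[OF assms(3)]]]
      by (simp add: cf_def left_diff_distrib diff_divide_distrib)
    then show "cf (\<lambda>x. f x - synth (cf f) x) k = 0" by (simp add: cf_synth[OF assms(3)])
  qed
  then show "f x = synth (cf f) x" by simp
qed

section \<open>From periodic functions to Fourier coefficients\<close>

lemma periodic_integrable:
  fixes h :: "real \<Rightarrow> 'a::banach"
  assumes p: "p > 0" "\<And>x. h (x + p) = h x" and h: "h integrable_on {0..p}"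
  shows "h integrable_on {a..b}"
proof -
  have unit: "h integrable_on {of_int k * p..of_int (k + 1) * p}" for k
  proof -
    have "(\<lambda>x. h (x + - (of_int k * p))) integrable_on {0 - - (of_int k * p)..p - - (of_int k * p)}"
      by (rule integrable_shift_real_ivl[OF h])
    moreover have "h (x + - (of_int k * p)) = h x" for x
      using periodic_int[of h p x "- k"] p(2) by simp
    ultimately show ?thesis by (simp add: algebra_simps)
  qed
  have sym: "h integrable_on {- (real n * p)..real n * p}" for n
  proof (induction n)
    case (Suc n)
    have pos: "0 \<le> real n * p" using p(1) by simp
    have le: "real n * p \<le> real (Suc n) * p" using p(1) by (intro mult_right_mono) auto
    have 1: "h integrable_on {- (real (Suc n) * p)..- (real n * p)}"
      using unit[of "- int (Suc n)"] by (simp add: algebra_simps)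
    have 2: "h integrable_on {real n * p..real (Suc n) * p}"
      using unit[of "int n"] by (simp add: algebra_simps)
    have "h integrable_on {- (real (Suc n) * p)..real n * p}"
      by (rule Henstock_Kurzweil_Integration.integrable_combine[OF _ _ 1 Suc]) (use pos le in linarith)+
    then show ?case
      by (rule Henstock_Kurzweil_Integration.integrable_combine[rotated 2, OF _ 2]) (use pos le in linarith)+
  qed (use integrable_on_refl[of h "0::real"] in simp)
  obtain n where n: "max \<bar>a\<bar> \<bar>b\<bar> < real n * p" using ex_less_of_nat_mult[OF p(1)] by blast
  show ?thesis by (rule integrable_subinterval_real[OF sym[of n]]) (use n in auto)
qed

lemma periodic_absolutely_integrable:
  fixes h :: "real \<Rightarrow> 'a::euclidean_space"
  assumes p: "p > 0" "\<And>x. h (x + p) = h x" and h: "h absolutely_integrable_on {0..p}"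
  shows "h absolutely_integrable_on {a..b}"
  using periodic_integrable[of p h a b] periodic_integrable[of p "\<lambda>x. norm (h x)" a b] p h
  unfolding absolutely_integrable_on_def by auto

lemma L2_periodic_absolutely_integrable:
  assumes "f \<in> L2_periodic p" "p > 0"
  shows "f absolutely_integrable_on {a..b}"
proof (rule periodic_absolutely_integrable[OF assms(2)])
  show "f (x + p) = f x" for x using assms(1) by (simp add: L2_periodic_def)
  have m: "f \<in> borel_measurable lebesgue" and i: "set_integrable lebesgue {0..p} (\<lambda>x. (cmod (f x))\<^sup>2)"
    using assms(1) by (auto simp: L2_periodic_def)
  have 1: "set_integrable lebesgue {0..p} (\<lambda>x::real. 1::real)"
    by (intro absolutely_integrable_continuous_real continuous_on_const)
  have b: "set_integrable lebesgue {0..p} (\<lambda>x. 1 + (cmod (f x))\<^sup>2)" using set_integral_add(1)[OF 1 i] .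
  have le: "t \<le> 1 + t\<^sup>2" for t :: real
    using zero_le_power2[of "t - 1/2"] by (simp add: power2_eq_square algebra_simps)
  show "f absolutely_integrable_on {0..p}"
  proof (rule set_integrable_bound[OF b])
    show "set_borel_measurable lebesgue {0..p} f"
      unfolding set_borel_measurable_def by (intro borel_measurable_scaleR borel_measurable_indicator m) auto
    show "AE x in lebesgue. x \<in> {0..p} \<longrightarrow> norm (f x) \<le> norm (1 + (cmod (f x))\<^sup>2)" using le by auto
  qed
qed

definition prim :: "(real \<Rightarrow> complex) \<Rightarrow> real \<Rightarrow> complex" where
  "prim h x = (if 0 \<le> x then integral {0..x} h else - integral {x..0} h)"

lemma prim_has_integral:
  assumes h: "\<And>a b. h integrable_on {a..b}" and ab: "a \<le> b"
  shows "(h has_integral (prim h b - prim h a)) {a..b}"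
proof -
  have comb: "integral {x..y} h + integral {y..z} h = integral {x..z} h" if "x \<le> y" "y \<le> z" for x y z
    by (rule Henstock_Kurzweil_Integration.integral_combine[OF that h])
  have "integral {a..b} h = prim h b - prim h a"
    using ab comb[of 0 a b] comb[of a 0 b] comb[of a b 0] by (auto simp: prim_def algebra_simps)
  then show ?thesis using integrable_integral[OF h[of a b]] by simp
qed

lemma prim_continuous:
  assumes h: "\<And>a b. h integrable_on {a..b}"
  shows "continuous_on UNIV (prim h)"
proof -
  have "isCont (prim h) x" for x
  proof -
    have "continuous_on {x - 1..x + 1} (\<lambda>y. prim h (x - 1) + integral {x - 1..y} h)"
      by (intro continuous_intros indefinite_integral_continuous_1 h)
    then have "continuous_on {x - 1..x + 1} (prim h)"
    proof (rule continuous_on_eq)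
      fix y assume "y \<in> {x - 1..x + 1}"
      then show "prim h (x - 1) + integral {x - 1..y} h = prim h y"
        using integral_unique[OF prim_has_integral[OF h, of "x - 1" y]] by simp
    qed
    then show ?thesis by (rule continuous_on_interior) simp
  qed
  then show ?thesis by (simp add: continuous_on_eq_continuous_at)
qed

lemma prim_periodic:
  assumes h: "\<And>a b. h integrable_on {a..b}" and per: "\<And>x. h (x + 2) = h x" and zero: "integral {0..2} h = 0"
  shows "prim h (x + 2) = prim h x"
proof -
  have shift: "prim h (b + 2) - prim h (a + 2) = prim h b - prim h a" if "a \<le> b" for a b
  proof -
    have "(h has_integral (prim h (b + 2) - prim h (a + 2))) {a + 2..b + 2}"
      using that by (intro prim_has_integral h) simp
    from has_integral_shift_real_ivl[OF this, of 2]
    have "(h has_integral (prim h (b + 2) - prim h (a + 2))) {a..b}" by (simp add: per)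
    then show ?thesis using prim_has_integral[OF h that] has_integral_unique by blast
  qed
  have "prim h 2 = prim h 0" using zero by (simp add: prim_def)
  then show ?thesis using shift[of 0 x] shift[of x 0] by (cases "0 \<le> x") auto
qed

lemma prim_vector_derivative:
  assumes "continuous_on UNIV g"
  shows "(prim g has_vector_derivative g x) (at x)"
proof -
  have g: "g integrable_on {a..b}" for a b
    by (rule integrable_continuous_real[OF continuous_on_subset[OF assms]]) simp
  have "((\<lambda>y. integral {x - 1..y} g) has_vector_derivative g x) (at x within {x - 1..x + 1})"
    by (rule integral_has_vector_derivative[OF continuous_on_subset[OF assms]]) auto
  then have "((\<lambda>y. prim g (x - 1) + integral {x - 1..y} g) has_vector_derivative g x) (at x within {x - 1..x + 1})"
    by (auto intro!: derivative_eq_intros)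
  then have "(prim g has_vector_derivative g x) (at x within {x - 1..x + 1})"
  proof (rule has_vector_derivative_transform[rotated 2])
    fix y assume "y \<in> {x - 1..x + 1}"
    then show "prim g y = prim g (x - 1) + integral {x - 1..y} g"
      using integral_unique[OF prim_has_integral[OF g, of "x - 1" y]] by simp
  qed simp
  then show ?thesis by (simp add: at_within_Icc_at)
qed

lemma cf_norm_le:
  assumes "h absolutely_integrable_on {0..2}"
  shows "cmod (cf h k) \<le> integral {0..2} (\<lambda>x. cmod (h x)) / 2"
proof -
  have "cmod (integral {0..2} (\<lambda>x. h x * md (- k) x)) \<le> integral {0..2} (\<lambda>x. cmod (h x))"
    using assms mult_mode_integrable(2)[OF assms]
    by (intro integral_norm_bound_integral) (auto simp: norm_mult absolutely_integrable_on_def)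
  then show ?thesis by (simp add: cf_def norm_divide)
qed

lemma cf_diff:
  assumes "h absolutely_integrable_on {0..2}" "g absolutely_integrable_on {0..2}"
  shows "cf (\<lambda>x. h x - g x) k = cf h k - cf g k"
  using Henstock_Kurzweil_Integration.integral_diff[OF mult_mode_integrable(2)[OF assms(1)] mult_mode_integrable(2)[OF assms(2)]]
  by (simp add: cf_def left_diff_distrib diff_divide_distrib)

lemma cf_const: "cf (\<lambda>x. c) k = (if k = 0 then c else 0)"
proof -
  have "cf (\<lambda>x. c) k = c * cf (md 0) k" by (simp add: cf_def)
  then show ?thesis by (simp add: cf_mode)
qed

lemma cf_AE_cong:
  assumes "AE x in lebesgue. g x = h x"
  shows "cf g k = cf h k"
proof -
  obtain N where N: "N \<in> null_sets lebesgue" "{x \<in> space lebesgue. g x \<noteq> h x} \<subseteq> N"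
    using assms by (auto elim!: AE_E3 simp: eventually_ae_filter)
  have "negligible N" using N(1) by (simp add: negligible_iff_null_sets)
  then have "integral {0..2} (\<lambda>x. g x * md (- k) x) = integral {0..2} (\<lambda>x. h x * md (- k) x)"
  proof (rule integral_spike)
    fix x assume "x \<in> {0..2} - N"
    then have "g x = h x" using N(2) by auto
    then show "h x * md (- k) x = g x * md (- k) x" by simp
  qed
  then show ?thesis by (simp add: cf_def)
qed

text \<open>A shift by 1 multiplies the mode by (- 1)^m, so the second half of {0..2} cancels the
  first for odd m and doubles it for even m.\<close>

lemma cf_periodic_1:
  assumes q: "q \<in> L2_periodic 1"
  shows "cf q m = (if even m then fourier_coeff q (m div 2) else 0)"
proof -
  have per: "q (x + 1) = q x" for x using q by (simp add: L2_periodic_def)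
  have qi: "q absolutely_integrable_on {a..b}" for a b by (rule L2_periodic_absolutely_integrable[OF q]) simp
  let ?g = "\<lambda>x. q x * md (- m) x"
  have gi: "?g integrable_on {a..b}" for a b by (rule mult_mode_integrable(2)[OF qi])
  have "integral {1..2} ?g = integral {1 - 1..2 - 1} (\<lambda>x. ?g (x + 1))"
    by (rule integral_shift_real_ivl[symmetric])
  also have "\<dots> = integral {0..1} (\<lambda>x. (-1) ^ nat \<bar>m\<bar> * ?g x)"
    by (simp add: per md_shift_1 mult_ac)
  also have "\<dots> = (-1) ^ nat \<bar>m\<bar> * integral {0..1} ?g" by (rule integral_mult_right)
  finally have "integral {0..2} ?g = (1 + (-1) ^ nat \<bar>m\<bar>) * integral {0..1} ?g"
    using Henstock_Kurzweil_Integration.integral_combine[of 0 1 2 ?g] gi by (simp add: algebra_simps)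
  moreover have "even (nat \<bar>m\<bar>) \<longleftrightarrow> even m" by (simp add: even_nat_iff)
  ultimately have e: "cf q m = (if even m then integral {0..1} ?g else 0)" by (simp add: cf_def)
  have "fourier_coeff q (m div 2) = integral {0..1} ?g" if "even m"
  proof -
    have c: "cis (- 2 * of_int (m div 2) * pi * x) = md (- m) x" for x
    proof -
      have "2 * (of_int (m div 2) :: real) = of_int m" using that by (metis dvd_mult_div_cancel of_int_mult of_int_numeral)
      then show ?thesis by (simp add: md_def mult_ac)
    qed
    show ?thesis unfolding fourier_coeff_def c
      by (rule set_lebesgue_integral_eq_integral(2)[OF mult_mode_integrable(1)[OF qi]])
  qed
  then show ?thesis using e by simp
qed

lemma imaginary_square: "\<i> * of_real y * (\<i> * of_real y * c) = - of_real (y\<^sup>2) * c"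
proof -
  have "\<i> * of_real y * (\<i> * of_real y * c) = (\<i> * \<i>) * (of_real y * of_real y) * c" by (simp only: mult_ac)
  then show ?thesis by (simp add: power2_eq_square)
qed

section \<open>Equivalence of the problems for functions and for coefficients\<close>

locale hill_potential = potential +
  fixes q :: "real \<Rightarrow> complex"
  assumes q: "q \<in> L2_periodic 1" and v_eq: "v m = cf q m"
begin

lemma q_integrable: "q absolutely_integrable_on {a..b}"
  by (rule L2_periodic_absolutely_integrable[OF q]) simp

lemma q_periodic: "q (x + 2) = q x"
proof -
  have "q (y + 1) = q y" for y using q by (simp add: L2_periodic_def)
  from this[of "x + 1"] this[of x] show ?thesis by (simp add: add.assoc)
qed

lemma cf_mult_synth:
  assumes "a \<in> decay"
  shows "cf (\<lambda>x. q x * synth a x) k = conv a k"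
proof -
  have "cf (\<lambda>x. q x * synth a x) k = integral {0..2} (\<lambda>x. (q x * md (- k) x) * synth a x) / 2"
    by (simp add: cf_def mult_ac)
  also have "\<dots> = (\<Sum>\<^sub>\<infinity>l. a l * integral {0..2} (\<lambda>x. (q x * md (- k) x) * md l x)) / 2"
    by (subst integral_mult_synth[OF mult_mode_integrable(1)[OF q_integrable] assms]) simp
  also have "\<dots> = (\<Sum>\<^sub>\<infinity>l. a l * integral {0..2} (\<lambda>x. (q x * md (- k) x) * md l x) * (1 / 2))"
    by (subst infsum_cmult_left') simp
  also have "\<dots> = conv a k"
    unfolding conv_def
  proof (rule infsum_cong)
    fix l
    have "integral {0..2} (\<lambda>x. (q x * md (- k) x) * md l x) = integral {0..2} (\<lambda>x. q x * md (- (k - l)) x)"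
      by (simp add: mult.assoc md_mult)
    then show "a l * integral {0..2} (\<lambda>x. (q x * md (- k) x) * md l x) * (1 / 2) = v (k - l) * a l"
      by (simp add: v_eq cf_def)
  qed
  finally show ?thesis .
qed

text \<open>Two integrations by parts give \<open>f''\<close> the coefficients - pi^2 k^2 cf f k.
  Since \<open>f''\<close> is integrable these are bounded, which puts \<open>cf f\<close> into
  \<open>decay\<close>.\<close>

lemma hill_graph_coefficients:
  assumes "hill_graph q f g"
  shows "cf f \<in> decay" "f = synth (cf f)" "hill (cf f) k = cf g k"
proof -
  obtain f' f'' where f: "\<And>x. f (x + 2) = f x" "\<And>x. (f has_vector_derivative f' x) (at x)" "f'' \<in> L2_periodic 2"
    "\<And>a b. a \<le> b \<Longrightarrow> (f'' has_integral (f' b - f' a)) {a..b}" "AE x in lebesgue. g x = - f'' x + q x * f x"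
    using assms unfolding hill_graph_def by blast
  have fc: "continuous_on UNIV f"
    using f(2) by (auto intro!: continuous_at_imp_continuous_on has_vector_derivative_continuous)
  have f''i: "f'' absolutely_integrable_on {a..b}" for a b by (rule L2_periodic_absolutely_integrable[OF f(3)]) simp
  have f'c: "continuous_on {0..2} f'"
  proof -
    have "continuous_on {0..2} (\<lambda>x. f' 0 + integral {0..x} f'')"
      using f''i by (intro continuous_intros indefinite_integral_continuous_1) (auto simp: absolutely_integrable_on_def)
    then show ?thesis
    proof (rule continuous_on_eq)
      fix x assume "x \<in> {0..2::real}"
      then show "f' 0 + integral {0..x} f'' = f' x" using integral_unique[OF f(4)[of 0 x]] by simp
    qed
  qed
  \<comment> \<open>Periodicity of \<open>f'\<close> is not part of \<open>hill_graph\<close>; it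
    follows by differentiating f (x + 2) = f x.\<close>
  have f'2: "f' 2 = f' 0"
  proof -
    have "((\<lambda>x::real. x + 2) has_vector_derivative 1) (at 0)"
      by (auto intro!: derivative_eq_intros)
    from vector_diff_chain_at[OF this, of f "f' 2"] f(2)[of 2]
    have "(f \<circ> (\<lambda>x. x + 2) has_vector_derivative f' 2) (at 0)" by simp
    moreover have "f \<circ> (\<lambda>x. x + 2) = f" by (simp add: fun_eq_iff f(1))
    ultimately have "(f has_vector_derivative f' 2) (at 0)" by simp
    then show ?thesis using f(2)[of 0] vector_derivative_unique_at by blast
  qed
  have f'i: "f' absolutely_integrable_on {0..2}" by (rule absolutely_integrable_continuous_real[OF f'c])
  have c1: "cf f' k = \<i> * of_real (pi * of_int k) * cf f k" for k
  proof (rule cf_derivative[OF f'i])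
    show "(f' has_integral (f y - f x)) {x..y}" if "x \<le> y" for x y
      by (rule fundamental_theorem_of_calculus[OF that]) (use f(2) in \<open>auto intro: has_vector_derivative_at_within\<close>)
    show "f 2 = f 0" using f(1)[of 0] by simp
  qed
  have c2: "cf f'' k = \<i> * of_real (pi * of_int k) * cf f' k" for k
    by (rule cf_derivative[OF f''i f(4) f'2])
  have c3: "cf f'' k = - of_real (pi\<^sup>2 * (of_int k)\<^sup>2) * cf f k" for k
    unfolding c2 c1 imaginary_square by (simp add: power_mult_distrib)
  define C where "C = integral {0..2} (\<lambda>x. cmod (f'' x)) / 2"
  define C0 where "C0 = integral {0..2} (\<lambda>x. cmod (f x)) / 2"
  have fi: "f absolutely_integrable_on {0..2}"
    by (rule absolutely_integrable_continuous_real[OF continuous_on_subset[OF fc]]) simp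
  have "(1 + (of_int k)\<^sup>2) * cmod (cf f k) \<le> C0 + C" for k
  proof -
    have "pi\<^sup>2 * (of_int k)\<^sup>2 * cmod (cf f k) = cmod (cf f'' k)"
      unfolding c3 norm_mult norm_minus_cancel norm_of_real by simp
    also have "\<dots> \<le> C" unfolding C_def by (rule cf_norm_le[OF f''i])
    finally have 1: "pi\<^sup>2 * (of_int k)\<^sup>2 * cmod (cf f k) \<le> C" .
    have "1 * ((of_int k)\<^sup>2 * cmod (cf f k)) \<le> pi\<^sup>2 * ((of_int k)\<^sup>2 * cmod (cf f k))"
      using pi_squared_ge by (intro mult_right_mono) auto
    moreover have "cmod (cf f k) \<le> C0" unfolding C0_def by (rule cf_norm_le[OF fi])
    ultimately show ?thesis using 1 by (simp add: distrib_right mult.assoc)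
  qed
  then show dec: "cf f \<in> decay" by (auto simp: decay_def)
  show inv: "f = synth (cf f)" by (rule fourier_inversion[OF fc f(1) dec])
  have qfi: "(\<lambda>x. q x * f x) absolutely_integrable_on {0..2}"
    by (rule absolutely_integrable_continuous_mult[OF q_integrable continuous_on_subset[OF fc]]) simp
  have "AE x in lebesgue. g x = q x * f x - f'' x" using f(5) by eventually_elim simp
  then have "cf g k = cf (\<lambda>x. q x * f x - f'' x) k" by (rule cf_AE_cong)
  also have "\<dots> = cf (\<lambda>x. q x * f x) k - cf f'' k" by (rule cf_diff[OF qfi f''i])
  also have "cf (\<lambda>x. q x * f x) k = conv (cf f) k"
    using cf_mult_synth[OF dec, of k] inv by simp
  finally show "hill (cf f) k = cf g k" by (simp add: hill_def c3)
qed

text \<open>Coefficients of order 1 / k^2 do not justify differentiating twice term by term. Instead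
  the function h that ought to be the second derivative is integrated twice, and the result is
  identified with \<open>synth a\<close> by its coefficients.\<close>

lemma hill_graph_synth:
  assumes a: "a \<in> decay" and b: "b \<in> decay" and ab: "hill a = b"
  shows "hill_graph q (synth a) (synth b)"
proof -
  define h where "h x = q x * synth a x - synth b x" for x
  have ac: "continuous_on UNIV (synth a)" and bc: "continuous_on UNIV (synth b)"
    using continuous_synth a b by auto
  have per: "h (x + 2) = h x" for x by (simp add: h_def q_periodic synth_periodic)
  have L2: "h \<in> L2_periodic 2"
  proof -
    have meas: "u \<in> borel_measurable lebesgue" if "continuous_on UNIV u" for u :: "real \<Rightarrow> complex"
      by (rule measurable_completion) (use borel_measurable_continuous_onI[OF that] in simp)
    have qm: "q \<in> borel_measurable lebesgue" using q by (simp add: L2_periodic_def)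
    have hm: "h \<in> borel_measurable lebesgue"
      unfolding h_def by (intro borel_measurable_diff borel_measurable_times qm meas ac bc)
    have "(\<lambda>x. (cmod (q x))\<^sup>2) absolutely_integrable_on {0..2}"
      by (rule periodic_absolutely_integrable[of 1]) (use q in \<open>auto simp: L2_periodic_def\<close>)
    then have q2: "set_integrable lebesgue {0..2} (\<lambda>x. (cmod (q x))\<^sup>2)" .
    obtain A where A: "\<forall>x\<in>{0..2}. cmod (synth a x) \<le> A"
      using compact_imp_bounded[OF compact_continuous_image[OF continuous_on_subset[OF ac subset_UNIV] compact_Icc[of 0 2]]]
      by (auto simp: bounded_iff)
    obtain B where B: "\<forall>x\<in>{0..2}. cmod (synth b x) \<le> B"
      using compact_imp_bounded[OF compact_continuous_image[OF continuous_on_subset[OF bc subset_UNIV] compact_Icc[of 0 2]]]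
      by (auto simp: bounded_iff)
    have 1: "set_integrable lebesgue {0..2} (\<lambda>x::real. 2 * B\<^sup>2 :: real)"
      by (intro absolutely_integrable_continuous_real continuous_on_const)
    have bd: "set_integrable lebesgue {0..2} (\<lambda>x. 2 * A\<^sup>2 * (cmod (q x))\<^sup>2 + 2 * B\<^sup>2)"
      using set_integral_add(1)[OF set_integrable_mult_right[of "2 * A\<^sup>2", OF q2] 1] .
    have "set_integrable lebesgue {0..2} (\<lambda>x. (cmod (h x))\<^sup>2)"
    proof (rule set_integrable_bound[OF bd])
      show "set_borel_measurable lebesgue {0..2} (\<lambda>x. (cmod (h x))\<^sup>2)"
        unfolding set_borel_measurable_def
        by (intro borel_measurable_scaleR borel_measurable_indicator borel_measurable_power measurable_compose[OF hm borel_measurable_norm]) auto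
      have "(cmod (h x))\<^sup>2 \<le> 2 * A\<^sup>2 * (cmod (q x))\<^sup>2 + 2 * B\<^sup>2" if x: "x \<in> {0..2}" for x
      proof -
        have "cmod (h x) \<le> cmod (q x * synth a x) + cmod (synth b x)" unfolding h_def by (rule norm_triangle_ineq4)
        also have "\<dots> \<le> A * cmod (q x) + B"
          using mult_left_mono[OF bspec[OF A x], of "cmod (q x)"] bspec[OF B x] by (simp add: norm_mult mult.commute)
        finally have "(cmod (h x))\<^sup>2 \<le> (A * cmod (q x) + B)\<^sup>2" by (intro power_mono) auto
        also have "\<dots> \<le> 2 * (A * cmod (q x))\<^sup>2 + 2 * B\<^sup>2"
          using sum_squares_bound[of "A * cmod (q x)" B] by (simp add: power2_sum)
        finally show ?thesis by (simp add: power_mult_distrib)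
      qed
      then show "AE x in lebesgue. x \<in> {0..2} \<longrightarrow> norm ((cmod (h x))\<^sup>2) \<le> norm (2 * A\<^sup>2 * (cmod (q x))\<^sup>2 + 2 * B\<^sup>2)"
        by (auto intro!: AE_I2 order_trans[OF _ abs_ge_self])
    qed
    then show ?thesis using per hm by (simp add: L2_periodic_def)
  qed
  have hai: "h absolutely_integrable_on {a..b}" for a b by (rule L2_periodic_absolutely_integrable[OF L2]) simp
  have hi: "h integrable_on {a..b}" for a b using hai by (simp add: absolutely_integrable_on_def)
  have ch: "cf h k = - of_real (pi\<^sup>2 * (of_int k)\<^sup>2) * a k" for k
  proof -
    have "(\<lambda>x. q x * synth a x) absolutely_integrable_on {0..2}"
      by (rule absolutely_integrable_continuous_mult[OF q_integrable continuous_on_subset[OF ac]]) simp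
    moreover have "synth b absolutely_integrable_on {0..2}"
      by (rule absolutely_integrable_continuous_real[OF continuous_on_subset[OF bc]]) simp
    ultimately have "cf h k = cf (\<lambda>x. q x * synth a x) k - cf (synth b) k"
      unfolding h_def[abs_def] by (rule cf_diff)
    also have "\<dots> = conv a k - hill a k" by (simp add: cf_mult_synth[OF a] cf_synth[OF b] ab)
    finally show ?thesis by (simp add: hill_def)
  qed
  \<comment> \<open>The coefficient of h at 0 carries the factor k^2 = 0; mean zero makes the
    primitive periodic.\<close>
  have h0: "integral {0..2} h = 0" using ch[of 0] by (simp add: cf_def)
  \<comment> \<open>This gives \<open>G\<close> mean zero, so that its primitive is periodic as
    well; the constant in \<open>F\<close> fixes the coefficient at 0, which derivatives do not
    see.\<close>
  define c1 where "c1 = cf (prim h) 0"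
  define G where "G x = prim h x - c1" for x
  have pc: "continuous_on UNIV (prim h)" by (rule prim_continuous[OF hi])
  have Gc: "continuous_on UNIV G" unfolding G_def[abs_def] by (intro continuous_intros pc)
  have Gper: "G (x + 2) = G x" for x by (simp add: G_def prim_periodic[OF hi per h0])
  have ai: "u absolutely_integrable_on {x..y}" if "continuous_on UNIV u" for u :: "real \<Rightarrow> complex" and x y
    by (rule absolutely_integrable_continuous_real[OF continuous_on_subset[OF that]]) simp
  have Gi: "G integrable_on {x..y}" for x y using ai[OF Gc] by (simp add: absolutely_integrable_on_def)
  have "cf G 0 = 0"
    unfolding G_def[abs_def] using cf_diff[OF ai[OF pc] ai[OF continuous_on_const], of c1 0] by (simp add: cf_const c1_def)
  then have G0: "integral {0..2} G = 0" by (simp add: cf_def)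
  have Gint: "(h has_integral (G y - G x)) {x..y}" if "x \<le> y" for x y
    using prim_has_integral[OF hi that] by (simp add: G_def)
  have cG: "cf h k = \<i> * of_real (pi * of_int k) * cf G k" for k
    by (rule cf_derivative[OF hai Gint]) (use Gper[of 0] in auto)
  define F where "F x = prim G x - (cf (prim G) 0 - a 0)" for x
  have pGc: "continuous_on UNIV (prim G)" by (rule prim_continuous[OF Gi])
  have Fc: "continuous_on UNIV F" unfolding F_def[abs_def] by (intro continuous_intros pGc)
  have Fper: "F (x + 2) = F x" for x by (simp add: F_def prim_periodic[OF Gi Gper G0])
  have cF: "cf G k = \<i> * of_real (pi * of_int k) * cf F k" for k
    by (rule cf_derivative[OF ai[OF Gc]]) (use prim_has_integral[OF Gi] Fper[of 0] in \<open>auto simp: F_def\<close>)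
  have "cf F k = a k" for k
  proof (cases "k = 0")
    case True
    then show ?thesis
      unfolding F_def[abs_def] using cf_diff[OF ai[OF pGc] ai[OF continuous_on_const], of "cf (prim G) 0 - a 0" 0]
      by (simp add: cf_const)
  next
    case False
    have "- of_real (pi\<^sup>2 * (of_int k)\<^sup>2) * a k = \<i> * of_real (pi * of_int k) * (\<i> * of_real (pi * of_int k) * cf F k)"
      using ch[of k] cG[of k] cF[of k] by simp
    also have "\<dots> = - of_real (pi\<^sup>2 * (of_int k)\<^sup>2) * cf F k"
      unfolding imaginary_square by (simp add: power_mult_distrib)
    finally show ?thesis using False by simp
  qed
  then have "cf F = a" by auto
  then have Fa: "F = synth a" using fourier_inversion[OF Fc Fper] a by simp
  have FG: "(F has_vector_derivative G x) (at x)" for x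
    unfolding F_def[abs_def] using prim_vector_derivative[OF Gc, of x] by (auto intro!: derivative_eq_intros)
  have AE: "AE x in lebesgue. synth b x = - h x + q x * F x" unfolding Fa by (simp add: h_def)
  show ?thesis
    unfolding hill_graph_def using Fper FG L2 Gint AE unfolding Fa by blast
qed

text \<open>Chains correspond link by link: the two preceding lemmas translate one application of L
  - z, one in each direction.\<close>

lemma hill_kernel_eq: "hill_kernel q z k = synth ` hill.kerpow z k"
proof (induction k)
  case 0
  have "synth (\<lambda>_. 0) = (\<lambda>x. 0)" by (simp add: synth_def fun_eq_iff)
  then show ?case by (simp add: zero_fun_def)
next
  case (Suc k)
  show ?case
  proof (intro equalityI subsetI)
    fix f assume "f \<in> hill_kernel q z (Suc k)"
    then obtain g where g: "g \<in> hill_kernel q z k" "hill_graph q f (\<lambda>x. z * f x + g x)" by auto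
    then obtain c where c: "c \<in> hill.kerpow z k" "g = synth c" using Suc by auto
    have cD: "c \<in> decay" using c(1) hill.kerpow_D by blast
    note hg = hill_graph_coefficients[OF g(2)]
    let ?a = "cf f"
    have D: "sscale z ?a \<in> decay" using hg(1) seq.subspace_scale[OF subspace_decay] by blast
    have "(\<lambda>x. z * f x + g x) = synth (sscale z ?a + c)"
      unfolding c(2) using hg(2) synth_add[OF D cD] by (simp add: fun_eq_iff synth_scale)
    then have "cf (\<lambda>x. z * f x + g x) j = (sscale z ?a + c) j" for j
      using cf_synth[OF seq.subspace_add[OF subspace_decay D cD]] by simp
    then have "hill ?a = sscale z ?a + c" using hg(3) by (simp add: fun_eq_iff)
    then have "?a \<in> hill.kerpow z (Suc k)" using hg(1) c(1) by simp
    then show "f \<in> synth ` hill.kerpow z (Suc k)" using hg(2) by blast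
  next
    fix f assume "f \<in> synth ` hill.kerpow z (Suc k)"
    then obtain a where a: "a \<in> decay" "hill a - sscale z a \<in> hill.kerpow z k" "f = synth a" by auto
    define c where "c = hill a - sscale z a"
    have cD: "c \<in> decay" using a(2) hill.kerpow_D by (auto simp: c_def)
    have D: "sscale z a \<in> decay" using a(1) seq.subspace_scale[OF subspace_decay] by blast
    have "hill_graph q (synth a) (synth (sscale z a + c))"
      by (rule hill_graph_synth[OF a(1) seq.subspace_add[OF subspace_decay D cD]]) (simp add: c_def)
    moreover have "synth (sscale z a + c) = (\<lambda>x. z * f x + synth c x)"
      using synth_add[OF D cD] by (simp add: fun_eq_iff synth_scale a(3))
    moreover have "synth c \<in> hill_kernel q z k" using a(2) Suc by (auto simp: c_def)
    ultimately show "f \<in> hill_kernel q z (Suc k)" using a(3) by auto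
  qed
qed

interpretation sf: vector_space_pair sscale fscale
  by unfold_locales

text \<open>\<open>synth\<close> is not linear on all sequences, as divergent sums are 0 by
  convention. A linear map \<open>T\<close> that agrees with it on the generalized eigenspace takes
  its place in the dimension count.\<close>

lemma algebraic_multiplicity_eq:
  assumes "finite B" "hill.gen z \<subseteq> seq.span B"
  shows "algebraic_multiplicity q z = seq.dim (hill.gen z)"
proof -
  have un: "(\<Union>k. hill_kernel q z k) = synth ` hill.gen z"
    by (auto simp: hill_kernel_eq hill.gen_def)
  obtain C where C: "C \<subseteq> hill.gen z" "seq.independent C" "hill.gen z \<subseteq> seq.span C" "card C = seq.dim (hill.gen z)"
    by (rule seq.basis_exists)
  have sC: "seq.span C = hill.gen z" using C hill.subspace_gen by (metis seq.span_subspace)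
  obtain T where T: "Vector_Spaces.linear sscale fscale T" "\<And>x. x \<in> C \<Longrightarrow> T x = synth x"
    using sf.linear_independent_extend[OF C(2), of synth] by blast
  interpret T: Vector_Spaces.linear sscale fscale T by (rule T(1))
  have Teq: "T x = synth x" if "x \<in> hill.gen z" for x
  proof -
    have "x \<in> decay \<and> T x = synth x" using that unfolding sC[symmetric]
    proof (induction rule: seq.span_induct_alt)
      case base
      have "T (\<lambda>_. 0) = (\<lambda>_. 0)" using T.zero by (simp add: zero_fun_def)
      moreover have "synth (\<lambda>_. 0) = (\<lambda>_. 0)" by (simp add: synth_def fun_eq_iff)
      ultimately show ?case using seq.subspace_0[OF subspace_decay] by (simp add: zero_fun_def)
    next
      case (step c x y)
      have xD: "x \<in> decay" using step(1) C(1) hill.gen_D by blast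
      have cD: "sscale c x \<in> decay" using xD seq.subspace_scale[OF subspace_decay] by blast
      have "T (sscale c x + y) = fscale c (synth x) + synth y"
        using T(2)[OF step(1)] step(2) by (simp add: T.add T.scale)
      also have "\<dots> = synth (sscale c x + y)"
        using synth_add[OF cD] step(2) by (auto simp: fun_eq_iff fscale_def synth_scale)
      finally show ?case using seq.subspace_add[OF subspace_decay cD] step(2) by blast
    qed
    then show ?thesis by blast
  qed
  have inj: "inj_on T (seq.span C)"
  proof (rule inj_onI)
    fix x y assume xy: "x \<in> seq.span C" "y \<in> seq.span C" "T x = T y"
    have "x \<in> hill.gen z" "y \<in> hill.gen z" using xy sC by auto
    then show "x = y" using synth_inj[of x y] Teq xy(3) hill.gen_D by auto
  qed
  have ind: "fun_space.independent (T ` C)"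
    by (rule sf.linear_independent_injective_image[OF T(1) C(2) inj])
  have "fun_space.span (T ` C) = T ` hill.gen z" using T.span_image[of C] sC by simp
  also have "\<dots> = synth ` hill.gen z" using Teq by (intro image_cong) auto
  finally have sp: "fun_space.span (T ` C) = synth ` hill.gen z" .
  then have "fun_space.span (T ` C) = fun_space.span (synth ` hill.gen z)" by (metis fun_space.span_span)
  then have "fun_space.dim (synth ` hill.gen z) = card (T ` C)"
    by (rule fun_space.dim_eq_card[OF _ ind])
  also have "\<dots> = card C" by (rule card_image[OF inj_on_subset[OF inj seq.span_superset]])
  finally show ?thesis by (simp add: algebraic_multiplicity_def un C(4))
qed

end

section \<open>Gap lengths\<close>

context hill_potential
begin

text \<open>The index m itself is listed at this value, so the multiplicity is positive and the
  generalized eigenspace is not zero.\<close>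

lemma listing_eigenvalue:
  assumes "nv \<le> (real n + 1) / 4" "periodic_eigenvalue_listing q ev" "Re (ev m) < mu n"
  shows "\<exists>f\<in>decay. f \<noteq> 0 \<and> hill f = sscale (ev m) f"
proof -
  let ?z = "ev m"
  obtain B where "finite B" "hill.gen ?z \<subseteq> seq.span B"
    using dim_gen_upper(1)[OF assms(1), of "{?z}" ?z] assms(3) by auto
  then have c1: "card {j. ev j = ?z} = seq.dim (hill.gen ?z)"
    using assms(2) algebraic_multiplicity_eq by (simp add: periodic_eigenvalue_listing_def)
  have "finite {j. ev j = ?z}" using assms(2) by (simp add: periodic_eigenvalue_listing_def)
  then have c2: "card {j. ev j = ?z} \<noteq> 0" by (subst card_0_eq) auto
  have d0: "seq.dim {0} = 0"
    using seq.dim_eq_card[of "{}" "{0}"] seq.independent_empty by simp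
  have "hill.gen ?z \<noteq> {0}"
  proof
    assume "hill.gen ?z = {0}"
    then show False using c1 c2 d0 by (simp only:)
  qed
  moreover have "0 \<in> hill.gen ?z" by (rule seq.subspace_0[OF hill.subspace_gen])
  ultimately have "\<exists>g\<in>hill.gen ?z. g \<noteq> 0" by blast
  then obtain g where g: "g \<in> hill.gen ?z" "g \<noteq> 0" by blast
  then obtain k where k: "g \<in> hill.kerpow ?z k" by (auto simp: hill.gen_def)
  have "\<exists>x\<in>hill.gen ?z \<inter> decay. x \<noteq> 0 \<and> hill x = sscale ?z x"
    by (rule hill.eigenvector_of_kerpow[OF k g(2,1) hill.subspace_gen]) (rule hill.L_gen)
  then show ?thesis by blast
qed

text \<open>The two dimension bounds give exactly 2 n + 1 indices; lexicographic order makes the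
  real parts monotone, so these are the first ones.\<close>

lemma listing_count:
  assumes nv: "nv \<le> (real n + 1) / 4" and ev: "periodic_eigenvalue_listing q ev"
  shows "{m. Re (ev m) < mu n} = {..2 * n}"
proof -
  let ?M = "{m. Re (ev m) < mu n}" and ?S = "\<lambda>z. {m. ev m = z}"
  have fin: "finite (?S z)" and mult: "card (?S z) = algebraic_multiplicity q z" for z
    using ev by (auto simp: periodic_eigenvalue_listing_def)
  have cardU: "card (\<Union>z\<in>Z. ?S z) = (\<Sum>z\<in>Z. seq.dim (hill.gen z))"
    if Z: "finite Z" "\<And>z. z \<in> Z \<Longrightarrow> Re z < mu n" for Z
  proof -
    have "card (\<Union>z\<in>Z. ?S z) = (\<Sum>z\<in>Z. card (?S z))"
      by (rule card_UN_disjoint) (use Z(1) fin in auto)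
    also have "\<dots> = (\<Sum>z\<in>Z. seq.dim (hill.gen z))"
    proof (rule sum.cong)
      fix z assume "z \<in> Z"
      then obtain B where "finite B" "hill.gen z \<subseteq> seq.span B"
        using dim_gen_upper(1)[OF nv Z] by blast
      then show "card (?S z) = seq.dim (hill.gen z)" unfolding mult by (rule algebraic_multiplicity_eq)
    qed simp
    finally show ?thesis .
  qed
  \<comment> \<open>The upper bound is applied to the values taken on a finite set \<open>A\<close>,
    since finiteness of \<open>?M\<close> is itself to be shown.\<close>
  have M: "finite ?M \<and> card ?M \<le> 2 * n + 1"
  proof (rule finite_if_finite_subsets_card_bdd)
    fix A assume A: "A \<subseteq> ?M" "finite A"
    have Z: "finite (ev ` A)" "\<And>z. z \<in> ev ` A \<Longrightarrow> Re z < mu n" using A by auto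
    have "card A \<le> card (\<Union>z\<in>ev ` A. ?S z)" by (rule card_mono) (use A(2) fin in auto)
    also have "\<dots> = (\<Sum>z\<in>ev ` A. seq.dim (hill.gen z))" by (rule cardU[OF Z])
    also have "\<dots> \<le> 2 * n + 1" by (rule dim_gen_upper(2)[OF nv Z])
    finally show "card A \<le> 2 * n + 1" .
  qed
  obtain Z where Z: "finite Z" "\<And>z. z \<in> Z \<Longrightarrow> Re z < mu n" "2 * n + 1 \<le> (\<Sum>z\<in>Z. seq.dim (hill.gen z))"
    using dim_gen_lower[OF nv] by blast
  have "card (\<Union>z\<in>Z. ?S z) \<le> card ?M" by (rule card_mono) (use M Z in auto)
  then have "(\<Sum>z\<in>Z. seq.dim (hill.gen z)) \<le> card ?M" using cardU[OF Z(1,2)] by simp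
  then have card: "card ?M = 2 * n + 1" using M Z(3) by simp
  have step: "Re (ev m) \<le> Re (ev (Suc m))" for m
  proof -
    have "lex_le (ev m) (ev (Suc m))" using ev by (simp add: periodic_eigenvalue_listing_def)
    then show ?thesis by (auto simp: lex_le_def)
  qed
  have mono: "Re (ev i) \<le> Re (ev j)" if "i \<le> j" for i j
    by (rule lift_Suc_mono_le[of "\<lambda>m. Re (ev m)", OF step that])
  have "?M = {..2 * n}"
  proof (rule card_subset_eq[symmetric])
    show "finite ?M" using M ..
    show "card {..2 * n} = card ?M" using card by simp
    show "{..2 * n} \<subseteq> ?M"
    proof (rule ccontr)
      assume "\<not> ?thesis"
      then obtain i where i: "i \<le> 2 * n" "\<not> Re (ev i) < mu n" by auto
      have "?M \<subseteq> {..<i}"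
      proof
        fix m assume "m \<in> ?M"
        then show "m \<in> {..<i}" using i(2) mono[of i m] by (cases "m < i") auto
      qed
      then have "card ?M \<le> i" using card_mono[of "{..<i}" ?M] by simp
      then show False using card i(1) by simp
    qed
  qed
  then show ?thesis .
qed

end

locale weighted_hill_potential = hill_potential + weighted_potential
begin

text \<open>Counting at n - 1 excludes the indices 2 n - 1 and 2 n from the left of the strip,
  counting at n places them left of its right edge. At n - 1 the counting condition reads nv \<le> n
  / 4.\<close>

lemma listing_gap_bound:
  assumes ev: "periodic_eigenvalue_listing q ev" and n: "n \<ge> 1" "nw \<le> real n / 4"
    and W: "\<omega> (2 * int n) = W" "\<omega> (- 2 * int n) = W"
  shows "W\<^sup>2 * (cmod (gap_length ev n))\<^sup>2 \<le>
    9 * ((W * cmod (v (2 * int n)) + 2 * nw\<^sup>2 / real n) * (W * cmod (v (- 2 * int n)) + 2 * nw\<^sup>2 / real n))"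
proof -
  have nv1: "nv \<le> (real (n - 1) + 1) / 4" and nv2: "nv \<le> (real n + 1) / 4"
    using nv_le_nw n by (auto simp: of_nat_diff)
  note c1 = listing_count[OF nv1 ev] and c2 = listing_count[OF nv2 ev]
  have strip: "in_strip n (ev m) \<and> Re (ev m) < mu n" if m: "2 * n - 1 \<le> m" "m \<le> 2 * n" for m
  proof -
    have "m \<notin> {..2 * (n - 1)}" using m n by auto
    then have "mu (n - 1) \<le> Re (ev m)" using c1 by (metis mem_Collect_eq not_less)
    moreover have "Re (ev m) < mu n" using c2 m(2) by (metis atMost_iff mem_Collect_eq)
    ultimately show ?thesis using n by (simp add: in_strip_def mu_def nu_def of_nat_diff)
  qed
  have s1: "in_strip n (ev (2 * n))" "in_strip n (ev (2 * n - 1))" using strip by auto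
  obtain f1 where f1: "f1 \<in> decay" "f1 \<noteq> 0" "hill f1 = sscale (ev (2 * n)) f1"
    using listing_eigenvalue[OF nv2 ev, of "2 * n"] strip[of "2 * n"] by auto
  obtain f2 where f2: "f2 \<in> decay" "f2 \<noteq> 0" "hill f2 = sscale (ev (2 * n - 1)) f2"
    using listing_eigenvalue[OF nv2 ev, of "2 * n - 1"] strip[of "2 * n - 1"] by auto
  show ?thesis unfolding gap_length_def by (rule gap_bound[OF s1 n f1 f2 W])
qed

end

section \<open>Summation over the gaps\<close>

lemma even_has_sum:
  fixes g :: "int \<Rightarrow> real"
  shows "((\<lambda>m. if even m then g (m div 2) else 0) has_sum S) UNIV \<longleftrightarrow> (g has_sum S) UNIV"
proof -
  have "((\<lambda>m. if even m then g (m div 2) else 0) has_sum S) UNIV \<longleftrightarrow>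
      ((\<lambda>m. if even m then g (m div 2) else 0) has_sum S) (range (\<lambda>n. 2 * n))"
    by (rule has_sum_cong_neutral) (auto elim!: evenE)
  also have "\<dots> \<longleftrightarrow> (((\<lambda>m. if even m then g (m div 2) else 0) \<circ> (\<lambda>n. 2 * n)) has_sum S) UNIV"
    by (rule has_sum_reindex) (simp add: inj_on_def)
  also have "((\<lambda>m. if even m then g (m div 2) else 0) \<circ> (\<lambda>n. 2 * n)) = g" by (auto simp: fun_eq_iff)
  finally show ?thesis .
qed

lemma infsum_inverse_squares_tail:
  assumes "N \<ge> 1"
  shows "(\<lambda>n. 1 / (real n)\<^sup>2) summable_on {N..}" "(\<Sum>\<^sub>\<infinity>n\<in>{N..}. 1 / (real n)\<^sup>2) \<le> 2 / real N"
proof -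
  \<comment> \<open>Telescoping with 1 / m^2 \<le> 2 / (m (m + 1)) = 2 / m - 2 / (m + 1), valid for
    m \<ge> 1.\<close>
  have seg: "(\<Sum>n=N..<N + K. 1 / (real n)\<^sup>2) \<le> 2 / real N - 2 / real (N + K)" for K
  proof (induction K)
    case (Suc K)
    let ?m = "real (N + K)"
    have m: "?m \<ge> 1" using assms by simp
    have "1 / ?m\<^sup>2 \<le> 2 / ?m - 2 / (?m + 1)"
    proof -
      have "1 / ?m\<^sup>2 = 2 / (2 * ?m\<^sup>2)" by simp
      also have "\<dots> \<le> 2 / (?m * (?m + 1))"
      proof (rule frac_le)
        show "?m * (?m + 1) \<le> 2 * ?m\<^sup>2"
          using mult_left_mono[OF m, of ?m] m by (simp add: power2_eq_square algebra_simps)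
      qed (use m in auto)
      also have "\<dots> = 2 / ?m - 2 / (?m + 1)" using m by (simp add: field_simps)
      finally show ?thesis .
    qed
    then show ?case using Suc by (simp add: algebra_simps)
  qed simp
  have fin: "(\<Sum>n\<in>F. 1 / (real n)\<^sup>2) \<le> 2 / real N" if F: "finite F" "F \<subseteq> {N..}" for F
  proof -
    define K where "K = Suc (Max F)"
    have K: "n < K" if "n \<in> F" for n using Max_ge[OF F(1) that] by (simp add: K_def)
    have "(\<Sum>n\<in>F. 1 / (real n)\<^sup>2) \<le> (\<Sum>n=N..<N + K. 1 / (real n)\<^sup>2)"
    proof (rule sum_mono2)
      show "F \<subseteq> {N..<N + K}"
      proof
        fix n assume "n \<in> F"
        then show "n \<in> {N..<N + K}" using K[of n] F(2) by auto
      qed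
    qed auto
    also have "\<dots> \<le> 2 / real N" by (rule order_trans[OF seg]) simp
    finally show ?thesis .
  qed
  show s: "(\<lambda>n. 1 / (real n)\<^sup>2) summable_on {N..}"
    by (rule nonneg_bdd_above_summable_on) (use fin in \<open>auto intro!: bdd_aboveI2\<close>)
  show "(\<Sum>\<^sub>\<infinity>n\<in>{N..}. 1 / (real n)\<^sup>2) \<le> 2 / real N" by (rule infsum_le_finite_sums[OF s fin])
qed

lemma infsum_int_tail:
  fixes g :: "int \<Rightarrow> real"
  assumes "g summable_on UNIV" "N \<ge> 1"
  shows "(\<lambda>n. g (int n) + g (- int n)) summable_on {N..}"
    "(\<Sum>\<^sub>\<infinity>n\<in>{N..}. g (int n) + g (- int n)) = (\<Sum>\<^sub>\<infinity>m. if int N \<le> \<bar>m\<bar> then g m else 0)"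
proof -
  let ?P = "int ` {N..}" and ?Q = "(\<lambda>n. - int n) ` {N..}"
  have sP: "g summable_on ?P" and sQ: "g summable_on ?Q" using summable_on_subset_banach[OF assms(1)] by auto
  have P: "(\<lambda>n. g (int n)) summable_on {N..}" "(\<Sum>\<^sub>\<infinity>n\<in>{N..}. g (int n)) = infsum g ?P"
    using summable_on_reindex[of int "{N..}" g] infsum_reindex[of int "{N..}" g] sP by (auto simp: o_def)
  have inj: "inj_on (\<lambda>n. - int n) {N..}" by (simp add: inj_on_def)
  have Q: "(\<lambda>n. g (- int n)) summable_on {N..}" "(\<Sum>\<^sub>\<infinity>n\<in>{N..}. g (- int n)) = infsum g ?Q"
    using summable_on_reindex[OF inj, of g] infsum_reindex[OF inj, of g] sQ by (auto simp: o_def)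
  show "(\<lambda>n. g (int n) + g (- int n)) summable_on {N..}" by (rule summable_on_add[OF P(1) Q(1)])
  have disj: "?P \<inter> ?Q = {}" using assms(2) by auto
  have "(\<Sum>\<^sub>\<infinity>n\<in>{N..}. g (int n) + g (- int n)) = infsum g ?P + infsum g ?Q"
    using infsum_add[OF P(1) Q(1)] P(2) Q(2) by simp
  also have "\<dots> = infsum g (?P \<union> ?Q)" using infsum_Un_disjoint[OF sP sQ disj] by simp
  also have "\<dots> = (\<Sum>\<^sub>\<infinity>m. if int N \<le> \<bar>m\<bar> then g m else 0)"
  proof (rule infsum_cong_neutral)
    fix m assume "m \<in> UNIV - (?P \<union> ?Q)"
    then have "m \<notin> ?P" "m \<notin> ?Q" by auto
    moreover have "m \<in> ?P" if "int N \<le> m" using that by (intro image_eqI[of _ _ "nat m"]) auto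
    moreover have "m \<in> ?Q" if "int N \<le> - m" using that by (intro image_eqI[of _ _ "nat (- m)"]) auto
    ultimately show "(if int N \<le> \<bar>m\<bar> then g m else 0) = 0" by (auto simp: abs_if split: if_splits)
  qed auto
  finally show "(\<Sum>\<^sub>\<infinity>n\<in>{N..}. g (int n) + g (- int n)) = (\<Sum>\<^sub>\<infinity>m. if int N \<le> \<bar>m\<bar> then g m else 0)" .
qed

text \<open>The difference of the two sides is half the sum of the squares of P - M, P - r and M -
  r.\<close>

lemma shifted_product_bound: "((P::real) + r) * (M + r) \<le> P\<^sup>2 + M\<^sup>2 + 2 * r\<^sup>2"
  using zero_le_power2[of "P - M"] zero_le_power2[of "P - r"] zero_le_power2[of "M - r"]
  by (simp add: power2_eq_square algebra_simps)

theorem theorem1: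
  fixes w :: "int \<Rightarrow> real" and q :: "real \<Rightarrow> complex" and ev :: "nat \<Rightarrow> complex" and N :: nat
  assumes "w \<in> submult_weights"
    and "q \<in> weighted_space w"
    and "periodic_eigenvalue_listing q ev"
    and "N \<ge> 1"
    and "real N \<ge> 4 * weighted_norm w q"
  shows "(\<lambda>n. (w (int n))\<^sup>2 * (cmod (gap_length ev n))\<^sup>2) summable_on {N..} \<and>
    (\<Sum>\<^sub>\<infinity>n\<in>{N..}. (w (int n))\<^sup>2 * (cmod (gap_length ev n))\<^sup>2)
      \<le> 9 * (weighted_norm w (fourier_tail N q))\<^sup>2 + 576 / real N * (weighted_norm w q) ^ 4"
proof -
  define c where "c = fourier_coeff q"
  define g where "g n = (w n)\<^sup>2 * (cmod (c n))\<^sup>2" for n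
  have w1: "1 \<le> w n" and wsym: "w (- n) = w n" and wsub: "w (n + m) \<le> w n * w m" for n m
    using assms(1) unfolding submult_weights_def normalized_weight_def by auto
  have qL: "q \<in> L2_periodic 1" and gs: "g summable_on UNIV"
    using assms(2) by (auto simp: weighted_space_def g_def[abs_def] c_def)
  have g0: "0 \<le> g n" for n by (simp add: g_def)
  have cg: "(cmod (c n))\<^sup>2 \<le> g n" for n
    using mult_right_mono[OF one_le_power[OF w1[of n], of 2], of "(cmod (c n))\<^sup>2"] by (simp add: g_def)
  have cs: "(\<lambda>n. (cmod (c n))\<^sup>2) summable_on UNIV"
    by (rule summable_on_comparison_test[OF gs cg]) simp
  define v where "v = cf q"
  \<comment> \<open>Odd indices get the least admissible value 1, so that for even m and odd j the
    submultiplicativity reduces to 1 \<le> \<omega> m.\<close>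
  define \<omega> where "\<omega> m = (if even m then w (m div 2) else 1)" for m :: int
  have v_even: "v m = (if even m then c (m div 2) else 0)" for m
    unfolding v_def c_def by (rule cf_periodic_1[OF qL])
  have e1: "(\<lambda>m. (cmod (v m))\<^sup>2) = (\<lambda>m. if even m then (cmod (c (m div 2)))\<^sup>2 else 0)"
    by (auto simp: v_even)
  have e2: "(\<lambda>m. (\<omega> m * cmod (v m))\<^sup>2) = (\<lambda>m. if even m then g (m div 2) else 0)"
    by (auto simp: v_even \<omega>_def g_def power_mult_distrib)
  interpret weighted_hill_potential v q \<omega>
  proof unfold_locales
    show "(\<lambda>m. (cmod (v m))\<^sup>2) summable_on UNIV"
      unfolding e1 using even_has_sum[of "\<lambda>n. (cmod (c n))\<^sup>2"] cs by (auto simp: summable_on_def)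
    show "(\<lambda>m. (\<omega> m * cmod (v m))\<^sup>2) summable_on UNIV"
      unfolding e2 using even_has_sum[of g] gs by (auto simp: summable_on_def)
    show "1 \<le> \<omega> m" for m using w1 by (simp add: \<omega>_def)
    show "\<omega> (m + j) \<le> \<omega> m * \<omega> j" if "v m \<noteq> 0" for m j
    proof -
      have m: "even m" using that by (auto simp: v_even split: if_splits)
      show ?thesis
      proof (cases "even j")
        case True
        then have "(m + j) div 2 = m div 2 + j div 2" using m by presburger
        then show ?thesis using m True wsub by (simp add: \<omega>_def)
      next
        case False
        then show ?thesis using m w1 by (simp add: \<omega>_def)
      qed
    qed
  qed (use qL in \<open>auto simp: v_def\<close>)
  have nw_eq: "nw = weighted_norm w q"
  proof -
    have "(\<Sum>\<^sub>\<infinity>m. (\<omega> m * cmod (v m))\<^sup>2) = (\<Sum>\<^sub>\<infinity>n. g n)"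
      unfolding e2 by (rule infsumI[OF iffD2[OF even_has_sum has_sum_infsum[OF gs]]])
    then show ?thesis by (simp add: nw_def weighted_norm_def g_def c_def)
  qed
  let ?t = "\<lambda>n. (w (int n))\<^sup>2 * (cmod (gap_length ev n))\<^sup>2"
  let ?T = "\<lambda>n. g (int n) + g (- int n)"
  \<comment> \<open>With r = 2 nw^2 / n the term 9 (2 r^2) equals 72 nw^4 / n^2.\<close>
  have bound: "?t n \<le> 9 * ?T n + 72 * nw ^ 4 * (1 / (real n)\<^sup>2)" if n: "n \<in> {N..}" for n
  proof -
    have n1: "n \<ge> 1" "nw \<le> real n / 4" using n assms(4,5) nw_eq by auto
    let ?P = "w (int n) * cmod (c (int n))" and ?M = "w (int n) * cmod (c (- int n))" and ?r = "2 * nw\<^sup>2 / real n"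
    have "?t n \<le> 9 * ((?P + ?r) * (?M + ?r))"
    proof -
      have d: "(- 2 * int n) div 2 = - int n" "(2 * int n) div 2 = int n" by simp_all
      have "v (2 * int n) = c (int n)" "v (- 2 * int n) = c (- int n)" unfolding v_even d by simp_all
      moreover have "\<omega> (2 * int n) = w (int n)" "\<omega> (- 2 * int n) = w (int n)"
        unfolding \<omega>_def d wsym by simp_all
      ultimately show ?thesis using listing_gap_bound[OF assms(3) n1, of "w (int n)"] by simp
    qed
    also have "\<dots> \<le> 9 * (?P\<^sup>2 + ?M\<^sup>2 + 2 * ?r\<^sup>2)" by (intro mult_left_mono shifted_product_bound) simp
    also have "?P\<^sup>2 + ?M\<^sup>2 + 2 * ?r\<^sup>2 = ?T n + 2 * ?r\<^sup>2" by (simp add: g_def power_mult_distrib wsym)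
    also have "9 * (?T n + 2 * ?r\<^sup>2) = 9 * ?T n + 72 * nw ^ 4 * (1 / (real n)\<^sup>2)"
      by (simp add: power_divide power_mult_distrib power_mult[symmetric] field_simps)
    finally show ?thesis by simp
  qed
  note T = infsum_int_tail[OF gs assms(4)] and I = infsum_inverse_squares_tail[OF assms(4)]
  have bs: "(\<lambda>n. 9 * ?T n + 72 * nw ^ 4 * (1 / (real n)\<^sup>2)) summable_on {N..}"
    by (intro summable_on_add summable_on_cmult_right T(1) I(1))
  have ts: "?t summable_on {N..}" by (rule summable_on_comparison_test[OF bs bound]) auto
  have tail: "(weighted_norm w (fourier_tail N q))\<^sup>2 = infsum ?T {N..}"
  proof -
    have "(\<Sum>\<^sub>\<infinity>n\<in>UNIV. (w n)\<^sup>2 * (cmod (fourier_coeff (fourier_tail N q) n))\<^sup>2) = (\<Sum>\<^sub>\<infinity>m. if int N \<le> \<bar>m\<bar> then g m else 0)"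
      by (rule infsum_cong) (simp add: fourier_coeff_tail[OF qL] g_def c_def)
    then show ?thesis unfolding weighted_norm_def T(2) by (simp add: infsum_nonneg g0)
  qed
  have "infsum ?t {N..} \<le> (\<Sum>\<^sub>\<infinity>n\<in>{N..}. 9 * ?T n + 72 * nw ^ 4 * (1 / (real n)\<^sup>2))"
    by (rule infsum_mono[OF ts bs bound])
  also have "\<dots> = 9 * infsum ?T {N..} + 72 * nw ^ 4 * (\<Sum>\<^sub>\<infinity>n\<in>{N..}. 1 / (real n)\<^sup>2)"
    using infsum_add[OF summable_on_cmult_right[OF T(1), of 9] summable_on_cmult_right[OF I(1), of "72 * nw ^ 4"]]
    by (simp only: infsum_cmult_right')
  also have "\<dots> \<le> 9 * infsum ?T {N..} + 72 * nw ^ 4 * (2 / real N)"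
    by (intro add_left_mono mult_left_mono I(2)) simp
  \<comment> \<open>The tail of the inverse squares leaves 144 / N, which the constant 576
    covers.\<close>
  also have "72 * nw ^ 4 * (2 / real N) \<le> 576 / real N * nw ^ 4"
  proof -
    have "nw ^ 4 / real N * 144 \<le> nw ^ 4 / real N * 576" by (intro mult_left_mono) auto
    then show ?thesis by (simp add: mult.commute)
  qed
  finally show ?thesis using ts by (simp add: tail nw_eq)
qed

end
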